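(* Let $k_\alpha,k_\beta\in\mathbb{N}_0$ and let $T\colon H^{k_\alpha}(\Theta)\to H^{k_\beta}(\Theta)$ be a bounded linear operator. The following statements are equivalent: (i) $T$ is a Hilbert-Schmidt operator, i.e. $T\in HS(H^{k_\alpha},H^{k_\beta})$. (ii) There exists a kernel $h\in H^{k_\alpha,k_\beta}(\Theta\times\Theta)$ such that $T=T_h$, i.e. for every $f\in H^{k_\alpha}(\Theta)$, $$[Tf](y)=\int_\Theta\sum_{|\alpha|\le k_\alpha}\partial^{(\alpha,0)}h(x,y)\,f^{(\alpha)}(x)\,dx\quad\text{for a.e. } y\in\Theta.$$ In this case, $$\|T_h\|_{HS(H^{k_\alpha},H^{k_\beta})}^2=\sum_{|\alpha|\le k_\alpha}\sum_{|\beta|\le k_\beta}\big\|\partial^{(\alpha,\beta)}h\big\|_{L^2(\Theta\times\Theta)}^2<\infty .$$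
   Context: $d\in\mathbb{N}$, $\mathbb{N}_0=\{0,1,2,\dots\}$, and $\Theta\subset\mathbb{R}^d$ is a bounded domain, meaning a bounded open subset. $\alpha,\beta\in\mathbb{N}_0^d$ are multi-indices with $|\alpha|=\sum_i\alpha_i$. All functions are real-valued. $f^{(\alpha)}=\partial^{(\alpha)}f$ denotes the weak derivative. For a kernel $h\colon\Theta\times\Theta\to\mathbb{R}$, $\partial^{(\alpha,\beta)}h$ denotes the mixed weak derivative of order $\alpha$ in the first variable $x$ and order $\beta$ in the second variable $y$. $H^k(\Theta)$ is the $L^2$-based Sobolev space of order $k\in\mathbb{N}_0$ with inner product $\langle f,g\rangle_{H^k}=\sum_{|\alpha|\le k}\langle f^{(\alpha)},g^{(\alpha)}\rangle_{L^2}$. The Sobolev space of mixed order is $$H^{k_\alpha,k_\beta}(\Theta\times\Theta)=\{h\in L^2(\Theta\times\Theta)\mid \partial^{(\alpha,\beta)}h\text{ exists and lies in }L^2(\Theta\times\Theta)\text{ for all }|\alpha|\le k_\alpha,\ |\beta|\le k_\beta\}.$$ $HS(H,K)$ is the space of Hilbert-Schmidt operators between Hilbert spaces $H$ and $K$, with norm $\|T\|_{HS}^2=\sum_j\|Te_j\|_K^2$ for any orthonormal basis $(e_j)$ of $H$. *)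

theory Defs
  imports "HOL-Analysis.Analysis"
begin

section \<open>Multi-indices\<close>

text \<open>
  A multi-index on a Euclidean space is a function from its standard basis to the natural numbers,
  extended by 0.  This makes multi-indices available on \<open>'a\<close> and on \<open>'a \<times> 'a\<close> alike.
\<close>

definition multi_order :: "('a::euclidean_space \<Rightarrow> nat) \<Rightarrow> nat" where
  "multi_order \<alpha> = (\<Sum>b\<in>Basis. \<alpha> b)"

definition multi_indices :: "nat \<Rightarrow> ('a::euclidean_space \<Rightarrow> nat) set" where
  "multi_indices k = {\<alpha>. (\<forall>b. b \<notin> Basis \<longrightarrow> \<alpha> b = 0) \<and> multi_order \<alpha> \<le> k}"

text \<open>The basis of \<open>'a \<times> 'a\<close> consists of the pairs \<open>(b, 0)\<close> and \<open>(0, b)\<close> with \<open>b \<in> Basis\<close>.\<close>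

definition pair_index :: "('a::euclidean_space \<Rightarrow> nat) \<Rightarrow> ('a \<Rightarrow> nat) \<Rightarrow> ('a \<times> 'a \<Rightarrow> nat)" where
  "pair_index \<alpha> \<beta> = (\<lambda>(u, v). if v = 0 then \<alpha> u else if u = 0 then \<beta> v else 0)"

lemma finite_multi_indices: "finite (multi_indices k :: ('a::euclidean_space \<Rightarrow> nat) set)"
proof (rule finite_subset)
  show "(multi_indices k :: ('a \<Rightarrow> nat) set)
      \<subseteq> {\<alpha>. \<forall>b. (b \<in> Basis \<longrightarrow> \<alpha> b \<in> {..k}) \<and> (b \<notin> Basis \<longrightarrow> \<alpha> b = 0)}"
  proof
    fix \<alpha> :: "'a \<Rightarrow> nat" assume \<alpha>: "\<alpha> \<in> multi_indices k"
    have "\<alpha> b \<le> k" if "b \<in> Basis" for b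
      using member_le_sum[OF that, of \<alpha>] \<alpha> by (simp add: multi_indices_def multi_order_def)
    with \<alpha> show "\<alpha> \<in> {\<alpha>. \<forall>b. (b \<in> Basis \<longrightarrow> \<alpha> b \<in> {..k}) \<and> (b \<notin> Basis \<longrightarrow> \<alpha> b = 0)}"
      by (simp add: multi_indices_def)
  qed
  show "finite {\<alpha> :: 'a \<Rightarrow> nat. \<forall>b. (b \<in> Basis \<longrightarrow> \<alpha> b \<in> {..k}) \<and> (b \<notin> Basis \<longrightarrow> \<alpha> b = 0)}"
    by (rule finite_set_of_finite_funs) auto
qed

lemma multi_order_pair_index:
  "multi_order (pair_index \<alpha> \<beta>) = multi_order \<alpha> + multi_order \<beta>"
proof -
  have "multi_order (pair_index \<alpha> \<beta>)
      = (\<Sum>b\<in>Basis. pair_index \<alpha> \<beta> (b, 0)) + (\<Sum>b\<in>Basis. pair_index \<alpha> \<beta> (0, b))"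
    unfolding multi_order_def Basis_prod_def
    by (subst sum.union_disjoint) (auto simp: sum.reindex inj_on_def)
  also have "\<dots> = multi_order \<alpha> + multi_order \<beta>"
    by (auto simp: multi_order_def pair_index_def intro!: sum.cong)
  finally show ?thesis .
qed

section \<open>Test functions and weak derivatives\<close>

definition partial_deriv :: "'a::euclidean_space \<Rightarrow> ('a \<Rightarrow> real) \<Rightarrow> 'a \<Rightarrow> real" where
  "partial_deriv b \<phi> x = frechet_derivative \<phi> (at x) b"

text \<open>
  The partial derivatives are iterated along an arbitrary but fixed enumeration of the basis; by
  symmetry of the derivatives the enumeration is irrelevant for the smooth functions to which
  \<open>multi_deriv\<close> is applied.
\<close>

definition basis_list :: "'a::euclidean_space list" where
  "basis_list = (SOME bs. set bs = Basis \<and> distinct bs)"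

definition multi_deriv :: "('a::euclidean_space \<Rightarrow> nat) \<Rightarrow> ('a \<Rightarrow> real) \<Rightarrow> 'a \<Rightarrow> real" where
  "multi_deriv \<alpha> \<phi> = foldr (\<lambda>b. partial_deriv b ^^ \<alpha> b) basis_list \<phi>"

text \<open>\<open>C\<^sub>c\<^sup>\<infinity>(\<Omega>)\<close>: all iterated partial derivatives are differentiable, hence also continuous.\<close>

definition test_fun :: "'a::euclidean_space set \<Rightarrow> ('a \<Rightarrow> real) \<Rightarrow> bool" where
  "test_fun \<Omega> \<phi> \<longleftrightarrow>
     (\<forall>bs. set bs \<subseteq> Basis \<longrightarrow> foldr partial_deriv bs \<phi> differentiable_on UNIV) \<and>
     compact (closure {x. \<phi> x \<noteq> 0}) \<and> closure {x. \<phi> x \<noteq> 0} \<subseteq> \<Omega>"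

text \<open>
  Functions on \<open>\<Omega>\<close> are total functions whose values outside \<open>\<Omega>\<close> are ignored.  We work with Borel
  measurable representatives: every Lebesgue measurable function agrees almost everywhere with a
  Borel measurable one.
\<close>

abbreviation lborel_on :: "'a::euclidean_space set \<Rightarrow> 'a measure" where
  "lborel_on \<Omega> \<equiv> restrict_space lborel \<Omega>"

definition locally_integrable :: "'a::euclidean_space set \<Rightarrow> ('a \<Rightarrow> real) \<Rightarrow> bool" where
  "locally_integrable \<Omega> f \<longleftrightarrow> (\<forall>K. compact K \<and> K \<subseteq> \<Omega> \<longrightarrow> set_integrable lborel K f)"

definition has_weak_deriv ::
  "'a::euclidean_space set \<Rightarrow> ('a \<Rightarrow> nat) \<Rightarrow> ('a \<Rightarrow> real) \<Rightarrow> ('a \<Rightarrow> real) \<Rightarrow> bool" where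
  "has_weak_deriv \<Omega> \<alpha> f g \<longleftrightarrow>
     locally_integrable \<Omega> f \<and> locally_integrable \<Omega> g \<and>
     (\<forall>\<phi>. test_fun \<Omega> \<phi> \<longrightarrow>
        (\<integral>x. f x * multi_deriv \<alpha> \<phi> x \<partial>lborel_on \<Omega>)
          = (-1) ^ multi_order \<alpha> * (\<integral>x. g x * \<phi> x \<partial>lborel_on \<Omega>))"

text \<open>Weak derivatives are unique up to null sets; \<open>weak_deriv\<close> selects a representative.\<close>

definition weak_deriv ::
  "'a::euclidean_space set \<Rightarrow> ('a \<Rightarrow> nat) \<Rightarrow> ('a \<Rightarrow> real) \<Rightarrow> 'a \<Rightarrow> real" where
  "weak_deriv \<Omega> \<alpha> f = (SOME g. has_weak_deriv \<Omega> \<alpha> f g)"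

section \<open>Square-integrable functions and Sobolev spaces\<close>

definition L2_norm_sq :: "'a::euclidean_space set \<Rightarrow> ('a \<Rightarrow> real) \<Rightarrow> ennreal" where
  "L2_norm_sq \<Omega> f = (\<integral>\<^sup>+x. ennreal ((f x)\<^sup>2) \<partial>lborel_on \<Omega>)"

definition L2 :: "'a::euclidean_space set \<Rightarrow> ('a \<Rightarrow> real) set" where
  "L2 \<Omega> = {f \<in> borel_measurable (lborel_on \<Omega>). L2_norm_sq \<Omega> f < \<infinity>}"

definition L2_inner :: "'a::euclidean_space set \<Rightarrow> ('a \<Rightarrow> real) \<Rightarrow> ('a \<Rightarrow> real) \<Rightarrow> real" where
  "L2_inner \<Omega> f g = (\<integral>x. f x * g x \<partial>lborel_on \<Omega>)"

definition sobolev :: "'a::euclidean_space set \<Rightarrow> nat \<Rightarrow> ('a \<Rightarrow> real) set" where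
  "sobolev \<Omega> k =
     {f \<in> L2 \<Omega>. \<forall>\<alpha>\<in>multi_indices k. \<exists>g\<in>L2 \<Omega>. has_weak_deriv \<Omega> \<alpha> f g}"

definition sobolev_inner ::
  "'a::euclidean_space set \<Rightarrow> nat \<Rightarrow> ('a \<Rightarrow> real) \<Rightarrow> ('a \<Rightarrow> real) \<Rightarrow> real" where
  "sobolev_inner \<Omega> k f g =
     (\<Sum>\<alpha>\<in>multi_indices k. L2_inner \<Omega> (weak_deriv \<Omega> \<alpha> f) (weak_deriv \<Omega> \<alpha> g))"

definition sobolev_norm :: "'a::euclidean_space set \<Rightarrow> nat \<Rightarrow> ('a \<Rightarrow> real) \<Rightarrow> real" where
  "sobolev_norm \<Omega> k f = sqrt (sobolev_inner \<Omega> k f f)"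

definition mixed_sobolev ::
  "'a::euclidean_space set \<Rightarrow> nat \<Rightarrow> nat \<Rightarrow> ('a \<times> 'a \<Rightarrow> real) set" where
  "mixed_sobolev \<Theta> k l =
     {h \<in> L2 (\<Theta> \<times> \<Theta>). \<forall>\<alpha>\<in>multi_indices k. \<forall>\<beta>\<in>multi_indices l.
        \<exists>g\<in>L2 (\<Theta> \<times> \<Theta>). has_weak_deriv (\<Theta> \<times> \<Theta>) (pair_index \<alpha> \<beta>) h g}"

section \<open>Operators between Sobolev spaces\<close>

text \<open>
  The elements of a Sobolev space are classes of functions modulo equality almost everywhere.
  Operators act on representatives; they have to respect this equivalence, and linearity holds
  up to it.
\<close>

definition sobolev_bounded_linear ::
  "'a::euclidean_space set \<Rightarrow> nat \<Rightarrow> nat \<Rightarrow> (('a \<Rightarrow> real) \<Rightarrow> 'a \<Rightarrow> real) \<Rightarrow> bool" where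
  "sobolev_bounded_linear \<Theta> k l T \<longleftrightarrow>
     (\<forall>f\<in>sobolev \<Theta> k. T f \<in> sobolev \<Theta> l) \<and>
     (\<forall>f\<in>sobolev \<Theta> k. \<forall>g\<in>sobolev \<Theta> k.
        (AE x in lborel_on \<Theta>. f x = g x) \<longrightarrow> (AE y in lborel_on \<Theta>. T f y = T g y)) \<and>
     (\<forall>f\<in>sobolev \<Theta> k. \<forall>g\<in>sobolev \<Theta> k. \<forall>a b.
        AE y in lborel_on \<Theta>. T (\<lambda>x. a * f x + b * g x) y = a * T f y + b * T g y) \<and>
     (\<exists>C. \<forall>f\<in>sobolev \<Theta> k. sobolev_norm \<Theta> l (T f) \<le> C * sobolev_norm \<Theta> k f)"

text \<open>Orthonormal set with dense linear span.\<close>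

definition sobolev_onb :: "'a::euclidean_space set \<Rightarrow> nat \<Rightarrow> ('a \<Rightarrow> real) set \<Rightarrow> bool" where
  "sobolev_onb \<Theta> k E \<longleftrightarrow>
     E \<subseteq> sobolev \<Theta> k \<and>
     (\<forall>e\<in>E. \<forall>e'\<in>E. sobolev_inner \<Theta> k e e' = (if e = e' then 1 else 0)) \<and>
     (\<forall>f\<in>sobolev \<Theta> k. \<forall>\<epsilon>>0. \<exists>F c. finite F \<and> F \<subseteq> E \<and>
        sobolev_norm \<Theta> k (\<lambda>x. f x - (\<Sum>e\<in>F. c e * e x)) < \<epsilon>)"

definition hs_sum ::
  "'a::euclidean_space set \<Rightarrow> nat \<Rightarrow> (('a \<Rightarrow> real) \<Rightarrow> 'a \<Rightarrow> real) \<Rightarrow> ('a \<Rightarrow> real) set \<Rightarrow> ennreal" where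
  "hs_sum \<Theta> l T E = (\<Sum>\<^sub>\<infinity>e\<in>E. ennreal ((sobolev_norm \<Theta> l (T e))\<^sup>2))"

definition hilbert_schmidt ::
  "'a::euclidean_space set \<Rightarrow> nat \<Rightarrow> nat \<Rightarrow> (('a \<Rightarrow> real) \<Rightarrow> 'a \<Rightarrow> real) \<Rightarrow> bool" where
  "hilbert_schmidt \<Theta> k l T \<longleftrightarrow>
     sobolev_bounded_linear \<Theta> k l T \<and> (\<exists>E. sobolev_onb \<Theta> k E \<and> hs_sum \<Theta> l T E < \<infinity>)"

text \<open>The common value of the sum for all orthonormal bases.\<close>

definition hs_norm_sq ::
  "'a::euclidean_space set \<Rightarrow> nat \<Rightarrow> nat \<Rightarrow> (('a \<Rightarrow> real) \<Rightarrow> 'a \<Rightarrow> real) \<Rightarrow> ennreal" where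
  "hs_norm_sq \<Theta> k l T = (THE s. \<forall>E. sobolev_onb \<Theta> k E \<longrightarrow> hs_sum \<Theta> l T E = s)"

text \<open>The function \<open>T\<^sub>h f\<close>; \<open>(\<alpha>, 0)\<close> differentiates \<open>h\<close> in its first variable only.\<close>

definition kernel_operator ::
  "'a::euclidean_space set \<Rightarrow> nat \<Rightarrow> ('a \<times> 'a \<Rightarrow> real) \<Rightarrow> ('a \<Rightarrow> real) \<Rightarrow> 'a \<Rightarrow> real" where
  "kernel_operator \<Theta> k h f y =
     (\<integral>x. (\<Sum>\<alpha>\<in>multi_indices k.
        weak_deriv (\<Theta> \<times> \<Theta>) (pair_index \<alpha> (\<lambda>_. 0)) h (x, y) * weak_deriv \<Theta> \<alpha> f x) \<partial>lborel_on \<Theta>)"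

definition is_kernel_operator ::
  "'a::euclidean_space set \<Rightarrow> nat \<Rightarrow> (('a \<Rightarrow> real) \<Rightarrow> 'a \<Rightarrow> real) \<Rightarrow> ('a \<times> 'a \<Rightarrow> real) \<Rightarrow> bool" where
  "is_kernel_operator \<Theta> k T h \<longleftrightarrow>
     (\<forall>f\<in>sobolev \<Theta> k. AE y in lborel_on \<Theta>. T f y = kernel_operator \<Theta> k h f y)"

end

theory Submission
  imports Defs
begin

text \<open>
  The map sending \<open>f\<close> to the family of its weak derivatives embeds \<open>H\<^sup>k(\<Theta>)\<close> isometrically onto a
  closed subspace of \<open>L\<^sup>2\<close> of finitely many copies of \<open>\<Theta>\<close>. A kernel \<open>h\<close> of mixed regularity
  becomes the \<open>L\<^sup>2\<close> kernel \<open>K\<close> with blocks \<open>\<partial>\<^sup>(\<^sup>\<alpha>\<^sup>,\<^sup>\<beta>\<^sup>)h\<close>, and \<open>T\<^sub>h\<close> becomes the integral operator with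
  kernel \<open>K\<close>. All columns \<open>\<integral>K(\<cdot>, q) g(q) dq\<close> are again families of weak derivatives, so an
  orthonormal basis of \<open>H\<^sup>k\<close> computes their norms; expanding \<open>K\<close> in a product basis and
  exchanging two sums gives \<open>\<Sum>\<^sub>e \<parallel>T e\<parallel>\<^sup>2 = \<parallel>K\<parallel>\<^sup>2\<close>. Conversely, for a Hilbert--Schmidt operator the
  orthogonal series \<open>\<Sum>\<^sub>e e \<otimes> T e\<close> converges in \<open>L\<^sup>2\<close> together with all mixed derivatives, and its
  sum is the kernel.
\<close>

section \<open>Square-integrable functions and orthonormal families\<close>

text \<open>The Hilbert-Schmidt sum runs over a basis of H^k, which as a space of jets is in general
  only a subspace of the L2 space on which \<open>K\<close> acts, while the L2 norm of
  \<open>K\<close> needs a basis of everything. The two numbers agree because no column of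
  \<open>K\<close> leaves that subspace. This is where the mixed derivatives must be separated: the
  definition tests \<open>h\<close> on the product domain, whereas a column pairs a derivative in
  one variable with an arbitrary L2 function of the other. Tensor products of test functions,
  symmetry of iterated derivatives and the fundamental lemma of the calculus of variations supply
  this. In the converse, the series determines the kernel only through the basis elements;
  boundedness of \<open>T\<close> extends the representation to all of H^k. Weak derivatives are
  representatives selected by choice, so identities are proved by testing with inner products and
  hold almost everywhere. Boundedness of the domain keeps all measures finite: L2 functions are then
  integrable, which the weak formulation and the completeness and density arguments use.\<close>

definition sq_int :: "'m measure \<Rightarrow> ('m \<Rightarrow> real) set" where
  "sq_int M = {f \<in> borel_measurable M. integrable M (\<lambda>x. (f x)\<^sup>2)}"

definition ip :: "'m measure \<Rightarrow> ('m \<Rightarrow> real) \<Rightarrow> ('m \<Rightarrow> real) \<Rightarrow> real" where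
  "ip M f g = (\<integral>x. f x * g x \<partial>M)"

text \<open>Functions are not identified modulo null sets, so this is only a seminorm, and limits
  are determined only almost everywhere.\<close>

definition nrm :: "'m measure \<Rightarrow> ('m \<Rightarrow> real) \<Rightarrow> real" where
  "nrm M f = sqrt (ip M f f)"

lemma sq_intI: "f \<in> borel_measurable M \<Longrightarrow> integrable M (\<lambda>x. (f x)\<^sup>2) \<Longrightarrow> f \<in> sq_int M"
  by (simp add: sq_int_def)

lemma sq_int_integrable_sq: "f \<in> sq_int M \<Longrightarrow> integrable M (\<lambda>x. (f x)\<^sup>2)"
  by (simp add: sq_int_def)

lemma sq_int_measurable [measurable_dest]: "f \<in> sq_int M \<Longrightarrow> f \<in> borel_measurable M"
  by (simp add: sq_int_def)

declare sq_int_integrable_sq [simp] sq_int_measurable [simp]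

lemma sq_int_integrable_mult [simp]:
  assumes [simp, measurable]: "f \<in> sq_int M" "g \<in> sq_int M"
  shows "integrable M (\<lambda>x. f x * g x)"
proof (rule Bochner_Integration.integrable_bound)
  show "integrable M (\<lambda>x. (f x)\<^sup>2 + (g x)\<^sup>2)" by simp
  show "(\<lambda>x. f x * g x) \<in> borel_measurable M" by measurable
  have "\<bar>a * b\<bar> \<le> a\<^sup>2 + b\<^sup>2" for a b :: real
    using sum_squares_bound[of "\<bar>a\<bar>" "\<bar>b\<bar>"] mult_nonneg_nonneg[of "\<bar>a\<bar>" "\<bar>b\<bar>"]
    unfolding abs_mult power2_abs by linarith
  then show "AE x in M. norm (f x * g x) \<le> norm ((f x)\<^sup>2 + (g x)\<^sup>2)" by simp
qed

lemma sq_int_zero [simp]: "(\<lambda>x. 0) \<in> sq_int M"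
  by (rule sq_intI) auto

lemma sq_int_scale [simp]: "f \<in> sq_int M \<Longrightarrow> (\<lambda>x. c * f x) \<in> sq_int M"
  by (rule sq_intI) (simp_all add: power_mult_distrib)

lemma sq_int_add [simp]:
  assumes [simp, measurable]: "f \<in> sq_int M" "g \<in> sq_int M"
  shows "(\<lambda>x. f x + g x) \<in> sq_int M"
  by (rule sq_intI) (simp_all add: power2_sum mult.assoc)

lemma sq_int_diff [simp]:
  assumes [simp, measurable]: "f \<in> sq_int M" "g \<in> sq_int M"
  shows "(\<lambda>x. f x - g x) \<in> sq_int M"
  by (rule sq_intI) (simp_all add: power2_diff mult.assoc)

lemma sq_int_sum [simp]: "(\<And>i. i \<in> A \<Longrightarrow> u i \<in> sq_int M) \<Longrightarrow> (\<lambda>x. \<Sum>i\<in>A. u i x) \<in> sq_int M"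
  by (induction A rule: infinite_finite_induct) auto

lemma sq_int_AE_eq:
  assumes "f \<in> sq_int M" "g \<in> borel_measurable M" "AE x in M. f x = g x"
  shows "g \<in> sq_int M"
proof -
  have "integrable M (\<lambda>x. (f x)\<^sup>2) \<longleftrightarrow> integrable M (\<lambda>x. (g x)\<^sup>2)"
    by (rule integrable_cong_AE) (use assms in auto)
  with assms show ?thesis by (intro sq_intI) auto
qed

lemma (in finite_measure) sq_int_const [simp]: "(\<lambda>x. c) \<in> sq_int M"
  by (rule sq_intI) auto

lemma (in finite_measure) sq_int_integrable: "f \<in> sq_int M \<Longrightarrow> integrable M f"
  using sq_int_integrable_mult[of f M "\<lambda>x. 1"] by simp

lemma ip_commute: "ip M f g = ip M g f"
  by (simp add: ip_def mult.commute)

lemma ip_add_left: "f \<in> sq_int M \<Longrightarrow> g \<in> sq_int M \<Longrightarrow> h \<in> sq_int M \<Longrightarrow>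
    ip M (\<lambda>x. f x + g x) h = ip M f h + ip M g h"
  by (simp add: ip_def distrib_right)

lemma ip_diff_left: "f \<in> sq_int M \<Longrightarrow> g \<in> sq_int M \<Longrightarrow> h \<in> sq_int M \<Longrightarrow>
    ip M (\<lambda>x. f x - g x) h = ip M f h - ip M g h"
  by (simp add: ip_def left_diff_distrib)

lemma ip_scale_left [simp]: "ip M (\<lambda>x. c * f x) h = c * ip M f h"
  by (simp add: ip_def mult.assoc)

lemma ip_scale_right [simp]: "ip M f (\<lambda>x. c * h x) = c * ip M f h"
  by (simp add: ip_commute[of M f])

lemma ip_zero_left [simp]: "ip M (\<lambda>x. 0) h = 0"
  by (simp add: ip_def)

lemma ip_sum_left: "(\<And>i. i \<in> A \<Longrightarrow> u i \<in> sq_int M) \<Longrightarrow> h \<in> sq_int M \<Longrightarrow>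
    ip M (\<lambda>x. \<Sum>i\<in>A. u i x) h = (\<Sum>i\<in>A. ip M (u i) h)"
  by (simp add: ip_def sum_distrib_right)

lemma ip_sum_right: "(\<And>i. i \<in> A \<Longrightarrow> u i \<in> sq_int M) \<Longrightarrow> h \<in> sq_int M \<Longrightarrow>
    ip M h (\<lambda>x. \<Sum>i\<in>A. u i x) = (\<Sum>i\<in>A. ip M h (u i))"
  by (simp add: ip_def sum_distrib_left)

lemma ip_add_right: "f \<in> sq_int M \<Longrightarrow> g \<in> sq_int M \<Longrightarrow> h \<in> sq_int M \<Longrightarrow>
    ip M h (\<lambda>x. f x + g x) = ip M h f + ip M h g"
  by (simp add: ip_def distrib_left)

lemma ip_diff_right: "f \<in> sq_int M \<Longrightarrow> g \<in> sq_int M \<Longrightarrow> h \<in> sq_int M \<Longrightarrow>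
    ip M h (\<lambda>x. f x - g x) = ip M h f - ip M h g"
  by (simp add: ip_def right_diff_distrib)

lemma ip_cong_AE:
  assumes "f \<in> sq_int M" "g \<in> sq_int M" "f' \<in> sq_int M" "g' \<in> sq_int M"
    and "AE x in M. f x = f' x" "AE x in M. g x = g' x"
  shows "ip M f g = ip M f' g'"
  unfolding ip_def by (rule integral_cong_AE) (use assms in auto)

lemma ip_self_nonneg [simp]: "0 \<le> ip M f f"
  by (simp add: ip_def)

lemma nrm_nonneg [simp]: "0 \<le> nrm M f"
  by (simp add: nrm_def)

lemma nrm_sq: "(nrm M f)\<^sup>2 = ip M f f"
  by (simp add: nrm_def)

lemma nn_integral_sq_int:
  assumes "f \<in> sq_int M"
  shows "(\<integral>\<^sup>+x. ennreal ((f x)\<^sup>2) \<partial>M) = ennreal ((nrm M f)\<^sup>2)"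
  using assms by (subst nn_integral_eq_integral) (auto simp: nrm_sq ip_def simp flip: power2_eq_square)

lemma sq_intI_nn_integral:
  assumes "f \<in> borel_measurable M" "(\<integral>\<^sup>+x. ennreal ((f x)\<^sup>2) \<partial>M) < \<infinity>"
  shows "f \<in> sq_int M"
proof (rule sq_intI[OF assms(1)])
  show "integrable M (\<lambda>x. (f x)\<^sup>2)"
    by (rule integrableI_nonneg[OF _ _ assms(2)]) (use assms(1) in auto)
qed

lemma nn_integral_eq_ip: "f \<in> sq_int M \<Longrightarrow> (\<integral>\<^sup>+x. ennreal ((f x)\<^sup>2) \<partial>M) = ennreal (ip M f f)"
  by (simp add: nn_integral_sq_int nrm_sq)

text \<open>Testing against such a family, which is zero outside slot \<open>i\<close>, isolates one
  component of a family of functions; see \<open>ip_single\<close>.\<close>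

definition single :: "'i \<Rightarrow> ('a \<Rightarrow> real) \<Rightarrow> 'i \<times> 'a \<Rightarrow> real" where
  "single i f = (\<lambda>(j, x). if j = i then f x else 0)"

lemma nrm_cong_AE:
  "f \<in> sq_int M \<Longrightarrow> g \<in> sq_int M \<Longrightarrow> AE x in M. f x = g x \<Longrightarrow> nrm M f = nrm M g"
  by (simp add: nrm_def ip_cong_AE[of f M f g g])

lemma nrm_zero_imp_AE:
  assumes "f \<in> sq_int M" "nrm M f = 0"
  shows "AE x in M. f x = 0"
proof -
  have "integral\<^sup>L M (\<lambda>x. f x * f x) = 0" using assms by (simp add: nrm_def ip_def)
  then have "AE x in M. f x * f x = 0"
    by (subst (asm) integral_nonneg_eq_0_iff_AE) (use assms in auto)
  then show ?thesis by simp
qed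

lemma nrm_eq_0_iff_AE: "f \<in> sq_int M \<Longrightarrow> nrm M f = 0 \<longleftrightarrow> (AE x in M. f x = 0)"
  using nrm_zero_imp_AE[of f M] nrm_cong_AE[of f M "\<lambda>x. 0"] by (auto simp: nrm_def)

lemma nrm_scale: "nrm M (\<lambda>x. c * f x) = \<bar>c\<bar> * nrm M f"
  by (simp add: nrm_def real_sqrt_mult flip: power2_eq_square mult.assoc)

lemma nrm_minus_commute: "nrm M (\<lambda>x. f x - g x) = nrm M (\<lambda>x. g x - f x)"
  using nrm_scale[of M "-1" "\<lambda>x. f x - g x"] by simp

section \<open>Cauchy-Schwarz, completeness of L2 and orthogonal series\<close>

lemma ip_Cauchy_Schwarz:
  assumes [simp, measurable]: "f \<in> sq_int M" "g \<in> sq_int M"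
  shows "\<bar>ip M f g\<bar> \<le> nrm M f * nrm M g"
proof -
  have q: "0 \<le> ip M f f + 2 * t * ip M f g + t\<^sup>2 * ip M g g" for t
  proof -
    have "0 \<le> ip M (\<lambda>x. f x + t * g x) (\<lambda>x. f x + t * g x)" by simp
    also have "\<dots> = ip M f f + 2 * t * ip M f g + t\<^sup>2 * ip M g g"
      by (simp add: ip_add_left ip_add_right ip_commute[of M g f] power2_eq_square algebra_simps)
    finally show ?thesis .
  qed
  have "(ip M f g)\<^sup>2 \<le> ip M f f * ip M g g"
  proof (cases "ip M g g = 0")
    case True
    have "ip M f g = 0"
    proof (rule ccontr)
      assume "ip M f g \<noteq> 0"
      \<comment> \<open>Here the quadratic is affine in \<open>t\<close>, and this \<open>t\<close>
        gives it the value -1.\<close>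
      with q[of "- (ip M f f + 1) / (2 * ip M f g)"] True show False by (simp add: field_simps)
    qed
    with True show ?thesis by simp
  next
    case False
    then have "0 < ip M g g" using ip_self_nonneg[of M g] by linarith
    \<comment> \<open>The minimizer of the quadratic in \<open>t\<close>.\<close>
    with q[of "- ip M f g / ip M g g"] show ?thesis
      by (simp add: field_simps power2_eq_square)
  qed
  then have "sqrt ((ip M f g)\<^sup>2) \<le> sqrt (ip M f f * ip M g g)" by (rule real_sqrt_le_mono)
  then show ?thesis by (simp add: nrm_def real_sqrt_mult)
qed

text \<open>Riesz-Fischer for a sequence with a geometric rate. On a finite measure, Cauchy-Schwarz
  against the constant 1 turns the L2 bound on consecutive differences into an L1 bound, so these
  differences are absolutely summable almost everywhere and the sequence converges pointwise.
  Fatou's lemma then carries the rate over to the limit.\<close>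

lemma (in finite_measure) sq_int_complete:
  assumes F [simp]: "\<And>n. F n \<in> sq_int M"
    and cauchy: "\<And>n m. n \<le> m \<Longrightarrow> nrm M (\<lambda>x. F n x - F m x) \<le> (1/2) ^ n"
  obtains f where "f \<in> sq_int M" "(\<lambda>n. nrm M (\<lambda>x. F n x - f x)) \<longlonglongrightarrow> 0"
proof -
  have [measurable]: "F n \<in> borel_measurable M" for n by simp
  let ?c = "nrm M (\<lambda>x. 1)"
  have L1: "(\<integral>\<^sup>+x. ennreal \<bar>F n x - F (Suc n) x\<bar> \<partial>M) \<le> ennreal (?c * (1/2) ^ n)" for n
  proof -
    have a: "(\<lambda>x. \<bar>F n x - F (Suc n) x\<bar>) \<in> sq_int M"
      using sq_int_integrable_sq[OF sq_int_diff[OF F F, of n "Suc n"]] by (intro sq_intI) auto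
    have "nrm M (\<lambda>x. \<bar>F n x - F (Suc n) x\<bar>) = nrm M (\<lambda>x. F n x - F (Suc n) x)"
      by (simp add: nrm_def ip_def)
    then have "\<bar>ip M (\<lambda>x. \<bar>F n x - F (Suc n) x\<bar>) (\<lambda>x. 1)\<bar> \<le> (1/2) ^ n * ?c"
      using ip_Cauchy_Schwarz[OF a sq_int_const[of 1]] cauchy[of n "Suc n"]
      by (smt (verit) mult_right_mono nrm_nonneg le_add2 plus_1_eq_Suc)
    then have "(\<integral>x. \<bar>F n x - F (Suc n) x\<bar> \<partial>M) \<le> ?c * (1/2) ^ n"
      by (simp add: ip_def mult.commute)
    moreover have "integrable M (\<lambda>x. \<bar>F n x - F (Suc n) x\<bar>)"
      using sq_int_integrable[OF a] .
    ultimately show ?thesis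
      by (subst nn_integral_eq_integral) auto
  qed
  have "(\<integral>\<^sup>+x. (\<Sum>n. ennreal \<bar>F n x - F (Suc n) x\<bar>) \<partial>M)
      = (\<Sum>n. \<integral>\<^sup>+x. ennreal \<bar>F n x - F (Suc n) x\<bar> \<partial>M)"
    by (rule nn_integral_suminf) measurable
  also have "\<dots> \<le> (\<Sum>n. ennreal (?c * (1/2) ^ n))"
    by (rule suminf_le) (use L1 in auto)
  also have "\<dots> = ennreal (\<Sum>n. ?c * (1/2) ^ n)"
    by (rule suminf_ennreal2) auto
  also have "\<dots> < \<infinity>" by simp
  finally have "AE x in M. (\<Sum>n. ennreal \<bar>F n x - F (Suc n) x\<bar>) \<noteq> \<infinity>"
    by (intro nn_integral_noteq_infinite) auto
  then have conv: "AE x in M. convergent (\<lambda>n. F n x)"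
  proof eventually_elim
    case (elim x)
    have "summable (\<lambda>n. \<bar>F n x - F (Suc n) x\<bar>)"
      by (rule summable_suminf_not_top) (use elim in auto)
    then have "summable (\<lambda>n. F n x - F (Suc n) x)"
      by (rule summable_rabs_cancel)
    then have "convergent (\<lambda>n. \<Sum>i<n. F i x - F (Suc i) x)"
      by (simp add: summable_iff_convergent)
    then have "convergent (\<lambda>n. F 0 x - F n x)"
      by (simp only: sum_lessThan_telescope'[where f = "\<lambda>n. F n x"])
    from convergent_diff[OF convergent_const[of "F 0 x"] this] show ?case by simp
  qed
  define f where "f x = lim (\<lambda>n. F n x)" for x
  have [measurable]: "f \<in> borel_measurable M" unfolding f_def by measurable
  have fatou: "(\<integral>\<^sup>+x. ennreal ((F n x - f x)\<^sup>2) \<partial>M) \<le> ennreal (((1/2) ^ n)\<^sup>2)" for n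
  proof -
    have "(\<integral>\<^sup>+x. ennreal ((F n x - f x)\<^sup>2) \<partial>M)
        = (\<integral>\<^sup>+x. liminf (\<lambda>m. ennreal ((F n x - F m x)\<^sup>2)) \<partial>M)"
    proof (rule nn_integral_cong_AE)
      show "AE x in M. ennreal ((F n x - f x)\<^sup>2) = liminf (\<lambda>m. ennreal ((F n x - F m x)\<^sup>2))"
        using conv
      proof eventually_elim
        case (elim x)
        then have "(\<lambda>m. F m x) \<longlonglongrightarrow> f x" by (simp add: f_def convergent_LIMSEQ_iff)
        then have "(\<lambda>m. ennreal ((F n x - F m x)\<^sup>2)) \<longlonglongrightarrow> ennreal ((F n x - f x)\<^sup>2)"
          by (intro tendsto_intros tendsto_ennrealI)
        then show ?case by (metis lim_imp_Liminf sequentially_bot)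
      qed
    qed
    also have "\<dots> \<le> liminf (\<lambda>m. \<integral>\<^sup>+x. ennreal ((F n x - F m x)\<^sup>2) \<partial>M)"
      by (rule nn_integral_liminf) measurable
    also have "\<dots> \<le> ennreal (((1/2) ^ n)\<^sup>2)"
    proof -
      have "\<forall>\<^sub>F m in sequentially. (\<integral>\<^sup>+x. ennreal ((F n x - F m x)\<^sup>2) \<partial>M) \<le> ennreal (((1/2) ^ n)\<^sup>2)"
      proof (rule eventually_sequentiallyI[of n])
        fix m assume "n \<le> m"
        have "(\<integral>\<^sup>+x. ennreal ((F n x - F m x)\<^sup>2) \<partial>M) = ennreal ((nrm M (\<lambda>x. F n x - F m x))\<^sup>2)"
          using nn_integral_sq_int[OF sq_int_diff[OF F F]] .
        also have "\<dots> \<le> ennreal (((1/2) ^ n)\<^sup>2)"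
          by (intro ennreal_leI power_mono cauchy \<open>n \<le> m\<close>) simp
        finally show "(\<integral>\<^sup>+x. ennreal ((F n x - F m x)\<^sup>2) \<partial>M) \<le> ennreal (((1/2) ^ n)\<^sup>2)" .
      qed
      then show ?thesis by (intro Liminf_le) simp_all
    qed
    finally show ?thesis .
  qed
  have d: "(\<lambda>x. F n x - f x) \<in> sq_int M" for n
  proof -
    have "integrable M (\<lambda>x. (F n x - f x)\<^sup>2)"
    proof (rule integrableI_nonneg)
      show "(\<integral>\<^sup>+x. ennreal ((F n x - f x)\<^sup>2) \<partial>M) < \<infinity>"
        using fatou[of n] ennreal_less_top unfolding infinity_ennreal_def by (rule le_less_trans)
    qed simp_all
    then show ?thesis by (intro sq_intI) auto
  qed
  have "f \<in> sq_int M"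
    using sq_int_diff[OF F[of 0] d[of 0]] by simp
  moreover have "(\<lambda>n. nrm M (\<lambda>x. F n x - f x)) \<longlonglongrightarrow> 0"
  proof (rule tendsto_sandwich[OF _ _ tendsto_const])
    show "\<forall>\<^sub>F n in sequentially. nrm M (\<lambda>x. F n x - f x) \<le> (1/2) ^ n"
    proof (rule always_eventually, rule allI, rule power2_le_imp_le)
      fix n
      have "ennreal ((nrm M (\<lambda>x. F n x - f x))\<^sup>2) = (\<integral>\<^sup>+x. ennreal ((F n x - f x)\<^sup>2) \<partial>M)"
        using nn_integral_sq_int[OF d, symmetric] .
      also note fatou[of n]
      finally show "(nrm M (\<lambda>x. F n x - f x))\<^sup>2 \<le> ((1/2) ^ n)\<^sup>2" by simp
    qed simp
    show "(\<lambda>n. (1/2) ^ n :: real) \<longlonglongrightarrow> 0" by (rule LIMSEQ_power_zero) simp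
  qed simp
  ultimately show ?thesis by (rule that)
qed

lemma ip_tendsto:
  assumes "\<And>n. F n \<in> sq_int M" "f \<in> sq_int M" "g \<in> sq_int M"
    and "(\<lambda>n. nrm M (\<lambda>x. F n x - f x)) \<longlonglongrightarrow> 0"
  shows "(\<lambda>n. ip M (F n) g) \<longlonglongrightarrow> ip M f g"
proof (rule Lim_null_comparison[THEN LIM_zero_cancel])
  show "\<forall>\<^sub>F n in sequentially. norm (ip M (F n) g - ip M f g) \<le> nrm M (\<lambda>x. F n x - f x) * nrm M g"
    using assms ip_Cauchy_Schwarz[of "\<lambda>x. F _ x - f x" M g] by (simp add: ip_diff_left)
  show "(\<lambda>n. nrm M (\<lambda>x. F n x - f x) * nrm M g) \<longlonglongrightarrow> 0"
    using tendsto_mult_right[OF assms(4), of "nrm M g"] by simp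
qed

text \<open>Two index sets are allowed because the Cauchy estimate for orthogonal series compares
  partial sums over finite sets that need not be nested.\<close>

lemma ip_orthogonal_sums:
  assumes "finite A" "finite B"
    and u: "\<And>i. i \<in> A \<union> B \<Longrightarrow> u i \<in> sq_int M"
    and orth: "\<And>i j. i \<in> A \<union> B \<Longrightarrow> j \<in> A \<union> B \<Longrightarrow> i \<noteq> j \<Longrightarrow> ip M (u i) (u j) = 0"
  shows "ip M (\<lambda>x. \<Sum>i\<in>A. u i x) (\<lambda>x. \<Sum>i\<in>B. u i x) = (\<Sum>i\<in>A \<inter> B. ip M (u i) (u i))"
proof -
  have "ip M (\<lambda>x. \<Sum>i\<in>A. u i x) (\<lambda>x. \<Sum>i\<in>B. u i x) = (\<Sum>i\<in>A. \<Sum>j\<in>B. ip M (u i) (u j))"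
    using u by (subst ip_sum_left) (auto intro!: sum.cong ip_sum_right)
  also have "\<dots> = (\<Sum>i\<in>A. if i \<in> B then ip M (u i) (u i) else 0)"
  proof (rule sum.cong)
    fix i assume "i \<in> A"
    have "(\<Sum>j\<in>B. ip M (u i) (u j)) = (\<Sum>j\<in>B. if j = i then ip M (u i) (u i) else 0)"
      using orth[of i] \<open>i \<in> A\<close> by (intro sum.cong) auto
    also have "\<dots> = (if i \<in> B then ip M (u i) (u i) else 0)"
      using \<open>finite B\<close> by simp
    finally show "(\<Sum>j\<in>B. ip M (u i) (u j)) = (if i \<in> B then ip M (u i) (u i) else 0)" .
  qed simp
  finally show ?thesis using \<open>finite A\<close> by (simp add: sum.inter_restrict)
qed

text \<open>
  Choosing finite sets that exhaust the sum of the squared norms makes the index set irrelevant: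
  no countability is needed.
\<close>

lemma (in finite_measure) orthogonal_series:
  assumes u: "\<forall>i\<in>I. u i \<in> sq_int M"
    and orth: "\<forall>i\<in>I. \<forall>j\<in>I. i \<noteq> j \<longrightarrow> ip M (u i) (u j) = 0"
    and bound: "\<forall>A. finite A \<longrightarrow> A \<subseteq> I \<longrightarrow> (\<Sum>i\<in>A. ip M (u i) (u i)) \<le> C"
  shows "\<exists>K F. K \<in> sq_int M \<and> (\<forall>n. finite (F n)) \<and> (\<forall>n. F n \<subseteq> I) \<and>
    (\<lambda>n. nrm M (\<lambda>x. (\<Sum>i\<in>F n. u i x) - K x)) \<longlonglongrightarrow> 0 \<and>
    (\<forall>n. \<forall>i\<in>I - F n. ip M (u i) (u i) \<le> (1/4) ^ n)"
proof -
  define S where "S = (\<lambda>A. \<Sum>i\<in>A. ip M (u i) (u i)) ` {A. finite A \<and> A \<subseteq> I}"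
  have bdd: "bdd_above S" using bound by (auto simp: S_def bdd_above_def)
  have "S \<noteq> {}" by (auto simp: S_def)
  \<comment> \<open>The factor one half is spent below: since the chosen sets need not be nested,
    the difference of two partial sums has two tails, over \<open>F n - F m\<close> and over
    \<open>F m - F n\<close>.\<close>
  have "\<exists>A. finite A \<and> A \<subseteq> I \<and> Sup S - (1/4) ^ n / 2 < (\<Sum>i\<in>A. ip M (u i) (u i))" for n
  proof -
    have "Sup S - (1/4) ^ n / 2 < Sup S" by simp
    then obtain s where "s \<in> S" "Sup S - (1/4) ^ n / 2 < s"
      by (rule less_cSupE[OF _ \<open>S \<noteq> {}\<close>])
    then show ?thesis by (auto simp: S_def)
  qed
  then obtain F where F: "finite (F n)" "F n \<subseteq> I"
    "Sup S - (1/4) ^ n / 2 < (\<Sum>i\<in>F n. ip M (u i) (u i))" for n by metis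
  have tail: "(\<Sum>i\<in>A. ip M (u i) (u i)) \<le> (1/4) ^ n / 2"
    if "finite A" "A \<subseteq> I" "A \<inter> F n = {}" for A n
  proof -
    have "(\<Sum>i\<in>A. ip M (u i) (u i)) + (\<Sum>i\<in>F n. ip M (u i) (u i)) = (\<Sum>i\<in>A \<union> F n. ip M (u i) (u i))"
      using that F by (simp add: sum.union_disjoint)
    also have "\<dots> \<le> Sup S"
      by (rule cSup_upper[OF _ bdd]) (use that F in \<open>auto simp: S_def\<close>)
    finally show ?thesis using F(3)[of n] by linarith
  qed
  have uF: "u i \<in> sq_int M" if "i \<in> F n" for i n using u F(2) that by blast
  have sF [simp]: "(\<lambda>x. \<Sum>i\<in>F n. u i x) \<in> sq_int M" for n using uF by (intro sq_int_sum)
  have "nrm M (\<lambda>x. (\<Sum>i\<in>F n. u i x) - (\<Sum>i\<in>F m. u i x)) \<le> (1/2) ^ n" if "n \<le> m" for n m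
  proof (rule power2_le_imp_le)
    let ?s = "\<lambda>n x. \<Sum>i\<in>F n. u i x"
    have "(nrm M (\<lambda>x. ?s n x - ?s m x))\<^sup>2
        = ip M (?s n) (?s n) - 2 * ip M (?s n) (?s m) + ip M (?s m) (?s m)"
      by (simp add: nrm_sq ip_diff_left ip_diff_right ip_commute[of M "?s m" "?s n"])
    also have "\<dots> = (\<Sum>i\<in>F n. ip M (u i) (u i)) - 2 * (\<Sum>i\<in>F n \<inter> F m. ip M (u i) (u i))
        + (\<Sum>i\<in>F m. ip M (u i) (u i))"
      using F(1,2) u orth by (subst (1 2 3) ip_orthogonal_sums) (auto simp: subset_iff)
    also have "\<dots> = (\<Sum>i\<in>F n - F m. ip M (u i) (u i)) + (\<Sum>i\<in>F m - F n. ip M (u i) (u i))"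
      using sum.Int_Diff[OF F(1)[of n], of "\<lambda>i. ip M (u i) (u i)" "F m"]
        sum.Int_Diff[OF F(1)[of m], of "\<lambda>i. ip M (u i) (u i)" "F n"] by (simp add: Int_commute)
    also have "\<dots> \<le> (1/4) ^ m / 2 + (1/4) ^ n / 2"
      by (intro add_mono tail) (use F in auto)
    also have "\<dots> \<le> (1/4) ^ n" using power_decreasing[OF that, of "1/4 :: real"] by linarith
    also have "\<dots> = ((1/2) ^ n)\<^sup>2" by (simp add: power2_eq_square flip: power_mult_distrib)
    finally show "(nrm M (\<lambda>x. ?s n x - ?s m x))\<^sup>2 \<le> ((1/2) ^ n)\<^sup>2" .
  qed simp
  from sq_int_complete[OF sF this] obtain K where
    "K \<in> sq_int M" "(\<lambda>n. nrm M (\<lambda>x. (\<Sum>i\<in>F n. u i x) - K x)) \<longlonglongrightarrow> 0" by blast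
  \<comment> \<open>An index may be missing from infinitely many \<open>F n\<close>. Its term is
    then small for these \<open>n\<close>, which later identifies the coefficients of the
    limit.\<close>
  moreover have "ip M (u i) (u i) \<le> (1/4) ^ n" if "i \<in> I - F n" for i n
  proof -
    have "(\<Sum>i\<in>{i}. ip M (u i) (u i)) \<le> (1/4) ^ n / 2" by (rule tail) (use that in auto)
    also have "\<dots> \<le> (1/4) ^ n" by simp
    finally show ?thesis by simp
  qed
  ultimately show ?thesis using F by blast
qed

section \<open>Orthonormal families: Bessel, Parseval and projections\<close>

definition orthonormal :: "'m measure \<Rightarrow> ('i \<Rightarrow> 'm \<Rightarrow> real) \<Rightarrow> 'i set \<Rightarrow> bool" where
  "orthonormal M e I \<longleftrightarrow> (\<forall>i\<in>I. e i \<in> sq_int M) \<and>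
     (\<forall>i\<in>I. \<forall>j\<in>I. ip M (e i) (e j) = (if i = j then 1 else 0))"

lemma orthonormal_sq_int: "orthonormal M e I \<Longrightarrow> i \<in> I \<Longrightarrow> e i \<in> sq_int M"
  by (simp add: orthonormal_def)

lemma orthonormal_ip:
  "orthonormal M e I \<Longrightarrow> i \<in> I \<Longrightarrow> j \<in> I \<Longrightarrow> ip M (e i) (e j) = (if i = j then 1 else 0)"
  by (simp add: orthonormal_def)

lemma orthonormal_combination_norm:
  assumes e: "orthonormal M e I" and A: "finite A" "A \<subseteq> I"
  shows "ip M (\<lambda>x. \<Sum>i\<in>A. c i * e i x) (\<lambda>x. \<Sum>i\<in>A. c i * e i x) = (\<Sum>i\<in>A. (c i)\<^sup>2)"
proof -
  have "ip M (\<lambda>x. \<Sum>i\<in>A. c i * e i x) (\<lambda>x. \<Sum>i\<in>A. c i * e i x)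
      = (\<Sum>i\<in>A \<inter> A. ip M (\<lambda>x. c i * e i x) (\<lambda>x. c i * e i x))"
    using e A by (intro ip_orthogonal_sums) (auto simp: orthonormal_def subset_iff)
  also have "\<dots> = (\<Sum>i\<in>A. (c i)\<^sup>2)"
    using e A by (auto intro!: sum.cong simp: orthonormal_def power2_eq_square subset_iff)
  finally show ?thesis .
qed

text \<open>Completing the square in the coefficients \<open>c\<close>. With the Fourier
  coefficients it yields Bessel's inequality; with arbitrary \<open>c\<close>, discarding the last
  sum, it yields the harder half of Parseval.\<close>

lemma orthonormal_residual:
  assumes e: "orthonormal M e I" and A: "finite A" "A \<subseteq> I" and f [simp]: "f \<in> sq_int M"
  shows "(nrm M (\<lambda>x. f x - (\<Sum>i\<in>A. c i * e i x)))\<^sup>2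
    = ip M f f - (\<Sum>i\<in>A. (ip M f (e i))\<^sup>2) + (\<Sum>i\<in>A. (c i - ip M f (e i))\<^sup>2)"
proof -
  have eA: "i \<in> A \<Longrightarrow> e i \<in> sq_int M" for i using e A by (auto simp: orthonormal_def)
  let ?s = "\<lambda>x. \<Sum>i\<in>A. c i * e i x"
  have s [simp]: "?s \<in> sq_int M" using eA by (intro sq_int_sum sq_int_scale)
  have fs: "ip M f ?s = (\<Sum>i\<in>A. c i * ip M f (e i))"
    by (subst ip_sum_right) (use eA in auto)
  have "(nrm M (\<lambda>x. f x - ?s x))\<^sup>2 = ip M f f - 2 * ip M f ?s + ip M ?s ?s"
    by (simp add: nrm_sq ip_diff_left ip_diff_right ip_commute[of M ?s f])
  also have "\<dots> = ip M f f - 2 * (\<Sum>i\<in>A. c i * ip M f (e i)) + (\<Sum>i\<in>A. (c i)\<^sup>2)"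
    unfolding fs orthonormal_combination_norm[OF e A] ..
  also have "\<dots> = ip M f f - (\<Sum>i\<in>A. (ip M f (e i))\<^sup>2) + (\<Sum>i\<in>A. (c i - ip M f (e i))\<^sup>2)"
    by (simp add: power2_diff sum.distrib sum_subtractf sum_distrib_left mult.assoc)
  finally show ?thesis .
qed

lemma Bessel:
  assumes e: "orthonormal M e I" and A: "finite A" "A \<subseteq> I" and f: "f \<in> sq_int M"
  shows "(\<Sum>i\<in>A. (ip M f (e i))\<^sup>2) \<le> ip M f f"
  using orthonormal_residual[OF assms, of "\<lambda>i. ip M f (e i)"]
    zero_le_power2[of "nrm M (\<lambda>x. f x - (\<Sum>i\<in>A. ip M f (e i) * e i x))"] by simp

text \<open>Membership in the closed linear span. It is a property of one function rather than of
  the family, so that a family spanning only a subspace can be used on the functions it does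
  reach.\<close>

definition approximable :: "'m measure \<Rightarrow> ('i \<Rightarrow> 'm \<Rightarrow> real) \<Rightarrow> 'i set \<Rightarrow> ('m \<Rightarrow> real) \<Rightarrow> bool" where
  "approximable M e I f \<longleftrightarrow> (\<forall>\<epsilon>>0. \<exists>A c. finite A \<and> A \<subseteq> I \<and>
     nrm M (\<lambda>x. f x - (\<Sum>i\<in>A. c i * e i x)) < \<epsilon>)"

lemma approximable_cong_AE:
  assumes ap: "approximable M e I f" and e: "\<And>i. i \<in> I \<Longrightarrow> e i \<in> sq_int M"
    and [simp]: "f \<in> sq_int M" "g \<in> sq_int M" and eq: "AE x in M. f x = g x"
  shows "approximable M e I g"
  unfolding approximable_def
proof (intro allI impI)
  fix \<epsilon> :: real assume "\<epsilon> > 0"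
  with ap obtain A c where A: "finite A" "A \<subseteq> I"
    and less: "nrm M (\<lambda>x. f x - (\<Sum>i\<in>A. c i * e i x)) < \<epsilon>"
    unfolding approximable_def by (elim allE impE exE conjE)
  have s: "(\<lambda>x. \<Sum>i\<in>A. c i * e i x) \<in> sq_int M"
    by (intro sq_int_sum sq_int_scale e subsetD[OF A(2)])
  have "nrm M (\<lambda>x. f x - (\<Sum>i\<in>A. c i * e i x)) = nrm M (\<lambda>x. g x - (\<Sum>i\<in>A. c i * e i x))"
  proof (rule nrm_cong_AE)
    show "AE x in M. f x - (\<Sum>i\<in>A. c i * e i x) = g x - (\<Sum>i\<in>A. c i * e i x)"
      using eq by eventually_elim simp
  qed (use s in simp_all)
  with less A show "\<exists>A c. finite A \<and> A \<subseteq> I \<and> nrm M (\<lambda>x. g x - (\<Sum>i\<in>A. c i * e i x)) < \<epsilon>"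
    by (intro exI[of _ A] exI[of _ c]) simp
qed

text \<open>Both sides are extended nonnegative reals, so no summability has to be carried along and
  later sums can be exchanged freely. Bessel gives one inequality;
  \<open>orthonormal_residual\<close> bounds the defect in the other by the squared approximation
  error.\<close>

lemma nn_Parseval:
  assumes e: "orthonormal M e I" and f: "f \<in> sq_int M" and appr: "approximable M e I f"
  shows "(\<Sum>\<^sub>\<infinity>i\<in>I. ennreal ((ip M f (e i))\<^sup>2)) = ennreal (ip M f f)"
proof (rule antisym)
  have "(\<Sum>\<^sub>\<infinity>i\<in>I. ennreal ((ip M f (e i))\<^sup>2))
      = (SUP A\<in>{A. finite A \<and> A \<subseteq> I}. \<Sum>i\<in>A. ennreal ((ip M f (e i))\<^sup>2))"
    by (rule nonneg_infsum_complete) simp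
  also have "\<dots> \<le> ennreal (ip M f f)"
    by (rule SUP_least) (use Bessel[OF e _ _ f] in \<open>simp add: sum_ennreal ennreal_leI\<close>)
  finally show "(\<Sum>\<^sub>\<infinity>i\<in>I. ennreal ((ip M f (e i))\<^sup>2)) \<le> ennreal (ip M f f)" .
  show "ennreal (ip M f f) \<le> (\<Sum>\<^sub>\<infinity>i\<in>I. ennreal ((ip M f (e i))\<^sup>2))"
  proof (rule ennreal_le_epsilon)
    fix \<epsilon> :: real assume "\<epsilon> > 0"
    then obtain A c where A: "finite A" "A \<subseteq> I"
      and less: "nrm M (\<lambda>x. f x - (\<Sum>i\<in>A. c i * e i x)) < sqrt \<epsilon>"
      using appr[unfolded approximable_def, rule_format, of "sqrt \<epsilon>"] by auto
    have "(nrm M (\<lambda>x. f x - (\<Sum>i\<in>A. c i * e i x)))\<^sup>2 \<le> (sqrt \<epsilon>)\<^sup>2"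
      by (rule power_mono) (use less in auto)
    then have "(nrm M (\<lambda>x. f x - (\<Sum>i\<in>A. c i * e i x)))\<^sup>2 \<le> \<epsilon>"
      using \<open>\<epsilon> > 0\<close> by simp
    moreover have "0 \<le> (\<Sum>i\<in>A. (c i - ip M f (e i))\<^sup>2)" by (rule sum_nonneg) simp
    ultimately have "ip M f f \<le> (\<Sum>i\<in>A. (ip M f (e i))\<^sup>2) + \<epsilon>"
      using orthonormal_residual[OF e A f, of c] by linarith
    then have "ennreal (ip M f f) \<le> (\<Sum>i\<in>A. ennreal ((ip M f (e i))\<^sup>2)) + ennreal \<epsilon>"
      using \<open>\<epsilon> > 0\<close> by (simp add: sum_ennreal ennreal_plus[symmetric] sum_nonneg ennreal_leI del: ennreal_plus)
    also have "(\<Sum>i\<in>A. ennreal ((ip M f (e i))\<^sup>2)) \<le> (\<Sum>\<^sub>\<infinity>i\<in>I. ennreal ((ip M f (e i))\<^sup>2))"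
      by (subst infsum_finite[OF A(1), symmetric]) (rule infsum_mono_neutral, use A in \<open>auto intro!: nonneg_summable_on_complete\<close>)
    finally show "ennreal (ip M f f) \<le> (\<Sum>\<^sub>\<infinity>i\<in>I. ennreal ((ip M f (e i))\<^sup>2)) + ennreal \<epsilon>"
      by (simp add: add_right_mono)
  qed
qed

text \<open>The projection exists without any closedness assumption because \<open>L\<^sup>2\<close> is complete.\<close>

lemma (in finite_measure) projection_exists:
  assumes e: "orthonormal M e I" and f: "f \<in> sq_int M"
  obtains p where "p \<in> sq_int M" "approximable M e I p"
    "\<And>i. i \<in> I \<Longrightarrow> ip M p (e i) = ip M f (e i)"
proof -
  let ?u = "\<lambda>i x. ip M f (e i) * e i x"
  have eI: "e i \<in> sq_int M" if "i \<in> I" for i using e that by (simp add: orthonormal_def)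
  have u: "\<forall>i\<in>I. ?u i \<in> sq_int M" using eI by simp
  have orth: "\<forall>i\<in>I. \<forall>j\<in>I. i \<noteq> j \<longrightarrow> ip M (?u i) (?u j) = 0"
    using e by (simp add: orthonormal_ip)
  have bound: "\<forall>A. finite A \<longrightarrow> A \<subseteq> I \<longrightarrow> (\<Sum>i\<in>A. ip M (?u i) (?u i)) \<le> ip M f f"
  proof (intro allI impI)
    fix A assume that: "finite A" "A \<subseteq> I"
    have "(\<Sum>i\<in>A. ip M (?u i) (?u i)) = (\<Sum>i\<in>A. (ip M f (e i))\<^sup>2)"
      using that e by (auto intro!: sum.cong simp: orthonormal_ip subset_iff power2_eq_square)
    also note Bessel[OF e that f]
    finally show "(\<Sum>i\<in>A. ip M (?u i) (?u i)) \<le> ip M f f" .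
  qed
  obtain p F where p [simp]: "p \<in> sq_int M" and F': "\<forall>n. finite (F n)" "\<forall>n. F n \<subseteq> I"
    and lim: "(\<lambda>n. nrm M (\<lambda>x. (\<Sum>i\<in>F n. ?u i x) - p x)) \<longlonglongrightarrow> 0"
    and tail: "\<forall>n. \<forall>i\<in>I - F n. ip M (?u i) (?u i) \<le> (1/4) ^ n"
    using orthogonal_series[OF u orth bound] by (elim exE conjE) (rule that)
  note F = F'[rule_format]
  have uF: "?u i \<in> sq_int M" if "i \<in> F n" for i n using eI[OF subsetD[OF F(2) that]] by simp
  have sF [simp]: "(\<lambda>x. \<Sum>i\<in>F n. ?u i x) \<in> sq_int M" for n using uF by (intro sq_int_sum)
  have "approximable M e I p"
    unfolding approximable_def
  proof (intro allI impI)
    fix \<epsilon> :: real assume "\<epsilon> > 0"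
    with lim have "\<forall>\<^sub>F n in sequentially. nrm M (\<lambda>x. (\<Sum>i\<in>F n. ?u i x) - p x) < \<epsilon>"
      by (rule order_tendstoD(2))
    then obtain n where "nrm M (\<lambda>x. (\<Sum>i\<in>F n. ?u i x) - p x) < \<epsilon>"
      using eventually_happens'[OF sequentially_bot] by blast
    then show "\<exists>A c. finite A \<and> A \<subseteq> I \<and> nrm M (\<lambda>x. p x - (\<Sum>i\<in>A. c i * e i x)) < \<epsilon>"
      using F by (subst nrm_minus_commute) (intro exI[of _ "F n"] exI[of _ "\<lambda>i. ip M f (e i)"], simp)
  qed
  moreover have "ip M p (e i) = ip M f (e i)" if i: "i \<in> I" for i
  proof -
    have val: "ip M (\<lambda>x. \<Sum>j\<in>F n. ?u j x) (e i) = (if i \<in> F n then ip M f (e i) else 0)" for n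
    proof -
      have "ip M (\<lambda>x. \<Sum>j\<in>F n. ?u j x) (e i) = (\<Sum>j\<in>F n. if j = i then ip M f (e i) else 0)"
      proof (subst ip_sum_left[OF uF eI[OF i]])
        show "(\<Sum>j\<in>F n. ip M (?u j) (e i)) = (\<Sum>j\<in>F n. if j = i then ip M f (e i) else 0)"
          by (rule sum.cong) (use subsetD[OF F(2)] i e in \<open>auto simp: orthonormal_ip\<close>)
      qed
      then show ?thesis using F(1) by simp
    qed
    have "(\<lambda>n. ip M (\<lambda>x. \<Sum>j\<in>F n. ?u j x) (e i)) \<longlonglongrightarrow> ip M p (e i)"
      by (rule ip_tendsto[OF sF p eI[OF i] lim])
    moreover have "(\<lambda>n. ip M (\<lambda>x. \<Sum>j\<in>F n. ?u j x) (e i)) \<longlonglongrightarrow> ip M f (e i)"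
    proof (rule Lim_null_comparison[THEN LIM_zero_cancel])
      show "\<forall>\<^sub>F n in sequentially. norm (ip M (\<lambda>x. \<Sum>j\<in>F n. ?u j x) (e i) - ip M f (e i)) \<le> (1/2) ^ n"
      proof (rule always_eventually, rule allI)
        fix n
        \<comment> \<open>The partial sum has either the right coefficient at \<open>i\<close> or
          none at all; in the second case the tail bound makes the coefficient itself small.\<close>
        have "\<bar>ip M f (e i)\<bar> \<le> (1/2) ^ n" if "i \<notin> F n"
        proof (rule power2_le_imp_le)
          have "(ip M f (e i))\<^sup>2 \<le> (1/4) ^ n"
            using bspec[OF spec[OF tail, of n], of i] i that e by (simp add: orthonormal_ip power2_eq_square)
          also have "\<dots> = ((1/2) ^ n)\<^sup>2"
            by (simp add: power2_eq_square flip: power_mult_distrib)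
          finally show "\<bar>ip M f (e i)\<bar>\<^sup>2 \<le> ((1/2) ^ n)\<^sup>2" by simp
        qed simp
        then show "norm (ip M (\<lambda>x. \<Sum>j\<in>F n. ?u j x) (e i) - ip M f (e i)) \<le> (1/2) ^ n"
          unfolding val by simp
      qed
      show "(\<lambda>n. (1/2) ^ n :: real) \<longlonglongrightarrow> 0" by (rule LIMSEQ_power_zero) simp
    qed
    ultimately show ?thesis by (rule LIMSEQ_unique)
  qed
  ultimately show ?thesis using p that by blast
qed

section \<open>Closed subspaces and their orthonormal bases\<close>

text \<open>Applied to constant sequences, the limit clause also closes \<open>S\<close> under
  equality almost everywhere within L2.\<close>

definition closed_subspace :: "'m measure \<Rightarrow> ('m \<Rightarrow> real) set \<Rightarrow> bool" where
  "closed_subspace M S \<longleftrightarrow> S \<subseteq> sq_int M \<and> (\<lambda>x. 0) \<in> S \<and>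
     (\<forall>f\<in>S. \<forall>g\<in>S. (\<lambda>x. f x + g x) \<in> S) \<and> (\<forall>f\<in>S. \<forall>c. (\<lambda>x. c * f x) \<in> S) \<and>
     (\<forall>F f. (\<forall>n. F n \<in> S) \<longrightarrow> f \<in> sq_int M \<longrightarrow>
        (\<lambda>n. nrm M (\<lambda>x. F n x - f x)) \<longlonglongrightarrow> 0 \<longrightarrow> f \<in> S)"

lemma closed_subspace_add: "closed_subspace M S \<Longrightarrow> f \<in> S \<Longrightarrow> g \<in> S \<Longrightarrow> (\<lambda>x. f x + g x) \<in> S"
  unfolding closed_subspace_def by (elim conjE) (drule (1) bspec, erule (1) bspec)

lemma closed_subspace_scale: "closed_subspace M S \<Longrightarrow> f \<in> S \<Longrightarrow> (\<lambda>x. c * f x) \<in> S"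
  unfolding closed_subspace_def by (elim conjE) (drule bspec, assumption, erule spec)

lemma closed_subspace_diff: "closed_subspace M S \<Longrightarrow> f \<in> S \<Longrightarrow> g \<in> S \<Longrightarrow> (\<lambda>x. f x - g x) \<in> S"
  using closed_subspace_add[of M S f "\<lambda>x. -1 * g x"] closed_subspace_scale[of M S g "-1"] by simp

lemma closed_subspace_limit:
  assumes "closed_subspace M S" "\<And>n. F n \<in> S" "f \<in> sq_int M"
    "(\<lambda>n. nrm M (\<lambda>x. F n x - f x)) \<longlonglongrightarrow> 0"
  shows "f \<in> S"
proof -
  have "\<forall>F f. (\<forall>n. F n \<in> S) \<longrightarrow> f \<in> sq_int M \<longrightarrow>
      (\<lambda>n. nrm M (\<lambda>x. F n x - f x)) \<longlonglongrightarrow> 0 \<longrightarrow> f \<in> S"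
    using assms(1) unfolding closed_subspace_def by (elim conjE)
  from this[rule_format, of F f] assms(2-) show ?thesis by simp
qed

lemma closed_subspace_sum:
  assumes "closed_subspace M S" "\<And>i. i \<in> A \<Longrightarrow> u i \<in> S"
  shows "(\<lambda>x. \<Sum>i\<in>A. c i * u i x) \<in> S"
  using assms(2)
  by (induction A rule: infinite_finite_induct)
    (use assms(1) in \<open>simp_all add: closed_subspace_def\<close>)

lemma closed_subspace_approximable:
  assumes S: "closed_subspace M S" and e: "\<And>i. i \<in> I \<Longrightarrow> e i \<in> S"
    and f: "f \<in> sq_int M" "approximable M e I f"
  shows "f \<in> S"
proof -
  have "\<exists>A c. finite A \<and> A \<subseteq> I \<and> nrm M (\<lambda>x. f x - (\<Sum>i\<in>A. c i * e i x)) < 1 / Suc n" for n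
    using f(2) unfolding approximable_def by simp
  then obtain A c where A: "finite (A n)" "A n \<subseteq> I"
    "nrm M (\<lambda>x. f x - (\<Sum>i\<in>A n. c n i * e i x)) < 1 / Suc n" for n by metis
  have "(\<lambda>n. nrm M (\<lambda>x. (\<Sum>i\<in>A n. c n i * e i x) - f x)) \<longlonglongrightarrow> 0"
  proof (rule tendsto_sandwich[OF _ _ tendsto_const])
    show "\<forall>\<^sub>F n in sequentially. nrm M (\<lambda>x. (\<Sum>i\<in>A n. c n i * e i x) - f x) \<le> 1 / Suc n"
      using A(3) by (intro always_eventually allI) (subst nrm_minus_commute, simp add: less_imp_le)
    show "(\<lambda>n. 1 / Suc n :: real) \<longlonglongrightarrow> 0"
      using LIMSEQ_inverse_real_of_nat by (simp add: inverse_eq_divide)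
  qed simp
  moreover have "(\<lambda>x. \<Sum>i\<in>A n. c n i * e i x) \<in> S" for n
    by (rule closed_subspace_sum[OF S]) (rule e, rule subsetD[OF A(2)])
  ultimately show ?thesis by (intro closed_subspace_limit[OF S _ f(1)])
qed

text \<open>Zorn's lemma yields a maximal orthonormal subset \<open>E\<close> of \<open>S\<close>.
  The residual of \<open>f\<close> after projection onto the span of \<open>E\<close> lies in
  \<open>S\<close> because \<open>S\<close> is closed; if it were not null, normalizing it would
  enlarge \<open>E\<close>.\<close>

lemma (in finite_measure) orthonormal_basis_exists:
  assumes S: "closed_subspace M S"
  obtains E where "E \<subseteq> S" "orthonormal M (\<lambda>e. e) E" "\<And>f. f \<in> S \<Longrightarrow> approximable M (\<lambda>e. e) E f"
proof -
  have SM: "S \<subseteq> sq_int M" using S by (simp add: closed_subspace_def)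
  let ?A = "{E. E \<subseteq> S \<and> orthonormal M (\<lambda>e. e) E}"
  have "\<exists>E\<in>?A. \<forall>X\<in>?A. E \<subseteq> X \<longrightarrow> X = E"
  proof (rule subset_Zorn')
    fix C assume C: "subset.chain ?A C"
    have CA: "C \<subseteq> ?A" and lin: "\<And>X Y. X \<in> C \<Longrightarrow> Y \<in> C \<Longrightarrow> X \<subseteq> Y \<or> Y \<subseteq> X"
      using C by (auto simp only: subset_chain_def)
    have "ip M e e' = (if e = e' then 1 else 0)" if m: "X \<in> C" "e \<in> X" "Y \<in> C" "e' \<in> Y" for X Y e e'
    proof -
      from lin[OF m(1,3)] obtain Z where Z: "Z \<in> C" "e \<in> Z" "e' \<in> Z"
        using m by (elim disjE) (blast dest: subsetD)+
      with CA have "orthonormal M (\<lambda>e. e) Z" by auto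
      then show ?thesis using orthonormal_ip[of M "\<lambda>e. e" Z e e'] Z by simp
    qed
    note ip = this
    have "orthonormal M (\<lambda>e. e) (\<Union>C)"
      unfolding orthonormal_def
    proof (intro conjI ballI)
      fix e e' assume "e \<in> \<Union>C" "e' \<in> \<Union>C"
      then show "ip M e e' = (if e = e' then 1 else 0)" by (elim UnionE) (rule ip)
    next
      fix e assume "e \<in> \<Union>C"
      with CA have "e \<in> S" by auto
      with SM show "e \<in> sq_int M" by (rule subsetD)
    qed
    moreover have "\<Union>C \<subseteq> S" using CA by auto
    ultimately show "\<Union>C \<in> ?A" by simp
  qed
  then obtain E where "E \<in> ?A" and max': "\<forall>X\<in>?A. E \<subseteq> X \<longrightarrow> X = E" by (elim bexE)
  then have E: "E \<subseteq> S" "orthonormal M (\<lambda>e. e) E" by simp_all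
  have max: "X = E" if "X \<subseteq> S" "orthonormal M (\<lambda>e. e) X" "E \<subseteq> X" for X
    using max' that by simp
  have "approximable M (\<lambda>e. e) E f" if "f \<in> S" for f
  proof -
    have f [simp]: "f \<in> sq_int M" using that SM by blast
    obtain p where p: "p \<in> sq_int M" "approximable M (\<lambda>e. e) E p"
      and ip: "\<And>e. e \<in> E \<Longrightarrow> ip M p e = ip M f e"
      using projection_exists[OF E(2) f] by blast
    note [simp] = p(1)
    have "p \<in> S" by (rule closed_subspace_approximable[OF S _ p]) (use E in auto)
    then have dS: "(\<lambda>x. f x - p x) \<in> S" by (rule closed_subspace_diff[OF S that])
    let ?d = "\<lambda>x. f x - p x"
    have ipd: "ip M ?d e = 0" if "e \<in> E" for e
      using ip[OF that] E that SM by (subst ip_diff_left) auto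
    have "nrm M ?d = 0"
    proof (rule ccontr)
      assume nz: "nrm M ?d \<noteq> 0"
      let ?g = "\<lambda>x. (1 / nrm M ?d) * ?d x"
      have gS: "?g \<in> S" using closed_subspace_scale[OF S dS] .
      have ipg: "ip M ?g e = 0" if "e \<in> E" for e using ipd[OF that] by (simp only: ip_scale_left)
      have gg: "ip M ?g ?g = 1"
        using nz by (simp only: ip_scale_left ip_scale_right nrm_sq[symmetric]) (simp add: power2_eq_square)
      have "insert ?g E = E"
      proof (rule max)
        show "insert ?g E \<subseteq> S" using gS E by blast
        show "orthonormal M (\<lambda>e. e) (insert ?g E)"
          unfolding orthonormal_def
        proof (intro conjI ballI)
          fix e e' assume "e \<in> insert ?g E" "e' \<in> insert ?g E"
          then show "ip M e e' = (if e = e' then 1 else 0)"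
            using gg ipg[of e] ipg[of e'] ip_commute[of M e ?g] E(2) unfolding orthonormal_def by auto
        qed (use gS E SM in blast)
      qed (rule subset_insertI)
      \<comment> \<open>Then \<open>?g\<close> would be orthogonal to itself although it has norm
        1.\<close>
      then have "?g \<in> E" by blast
      from ipg[OF this] gg show False by simp
    qed
    then have "AE x in M. f x - p x = 0" by (intro nrm_zero_imp_AE) simp_all
    then have "AE x in M. p x = f x" by eventually_elim simp
    then show ?thesis
      using E(1) SM by (intro approximable_cong_AE[OF p(2) _ p(1) f]) auto
  qed
  from E this show ?thesis by (rule that)
qed

lemma closed_subspace_sq_int: "closed_subspace M (sq_int M)"
  by (auto simp: closed_subspace_def)

section \<open>Kernels on product spaces\<close>

text \<open>In \<open>ennreal\<close> an unordered sum is the supremum of its finite partial sums. A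
  finite subset of the product fits into a finite rectangle, which gives one inequality; the other
  adds up finitely many full rows.\<close>

lemma infsum_Times_ennreal:
  fixes f :: "'a \<times> 'b \<Rightarrow> ennreal"
  shows "(\<Sum>\<^sub>\<infinity>p\<in>A \<times> B. f p) = (\<Sum>\<^sub>\<infinity>a\<in>A. \<Sum>\<^sub>\<infinity>b\<in>B. f (a, b))"
proof (rule antisym)
  have up: "(\<Sum>a\<in>F. \<Sum>\<^sub>\<infinity>b\<in>B. f (a, b)) \<le> (\<Sum>\<^sub>\<infinity>a\<in>A. \<Sum>\<^sub>\<infinity>b\<in>B. f (a, b))"
    if "finite F" "F \<subseteq> A" for F
    by (subst infsum_finite[OF that(1), symmetric])
      (rule infsum_mono_neutral, use that in \<open>auto intro!: nonneg_summable_on_complete\<close>)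
  show "(\<Sum>\<^sub>\<infinity>p\<in>A \<times> B. f p) \<le> (\<Sum>\<^sub>\<infinity>a\<in>A. \<Sum>\<^sub>\<infinity>b\<in>B. f (a, b))"
  proof (subst nonneg_infsum_complete, simp, rule SUP_least)
    fix F assume "F \<in> {F. finite F \<and> F \<subseteq> A \<times> B}"
    then have F: "finite F" "F \<subseteq> A \<times> B" by auto
    have "sum f F \<le> sum f (fst ` F \<times> snd ` F)"
      using F by (intro sum_mono2) (auto simp: image_iff, force+)
    also have "\<dots> = (\<Sum>a\<in>fst ` F. \<Sum>b\<in>snd ` F. f (a, b))"
      by (simp add: sum.cartesian_product)
    also have "\<dots> \<le> (\<Sum>a\<in>fst ` F. \<Sum>\<^sub>\<infinity>b\<in>B. f (a, b))"
    proof (rule sum_mono)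
      fix a
      have fin: "finite (snd ` F)" using F by simp
      show "(\<Sum>b\<in>snd ` F. f (a, b)) \<le> (\<Sum>\<^sub>\<infinity>b\<in>B. f (a, b))"
        by (subst infsum_finite[OF fin, symmetric])
          (rule infsum_mono_neutral, use F in \<open>auto intro!: nonneg_summable_on_complete\<close>)
    qed
    also have "\<dots> \<le> (\<Sum>\<^sub>\<infinity>a\<in>A. \<Sum>\<^sub>\<infinity>b\<in>B. f (a, b))"
      by (rule up) (use F in auto)
    finally show "sum f F \<le> (\<Sum>\<^sub>\<infinity>a\<in>A. \<Sum>\<^sub>\<infinity>b\<in>B. f (a, b))" .
  qed
  show "(\<Sum>\<^sub>\<infinity>a\<in>A. \<Sum>\<^sub>\<infinity>b\<in>B. f (a, b)) \<le> (\<Sum>\<^sub>\<infinity>p\<in>A \<times> B. f p)"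
  proof (subst nonneg_infsum_complete, simp, rule SUP_least)
    fix F assume "F \<in> {F. finite F \<and> F \<subseteq> A}"
    then have F: "finite F" "F \<subseteq> A" by auto
    have "(\<Sum>a\<in>F. \<Sum>\<^sub>\<infinity>b\<in>B. f (a, b)) = (\<Sum>\<^sub>\<infinity>p\<in>F \<times> B. f p)"
      using F(1)
    proof induction
      case (insert a F)
      have "(\<Sum>\<^sub>\<infinity>p\<in>insert a F \<times> B. f p) = (\<Sum>\<^sub>\<infinity>p\<in>(Pair a ` B) \<union> (F \<times> B). f p)"
        by (rule arg_cong[where f = "infsum f"]) auto
      also have "\<dots> = (\<Sum>\<^sub>\<infinity>p\<in>Pair a ` B. f p) + (\<Sum>\<^sub>\<infinity>p\<in>F \<times> B. f p)"
        using insert by (intro infsum_Un_disjoint nonneg_summable_on_complete) auto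
      also have "(\<Sum>\<^sub>\<infinity>p\<in>Pair a ` B. f p) = (\<Sum>\<^sub>\<infinity>b\<in>B. f (a, b))"
        by (subst infsum_reindex) (auto simp: inj_on_def o_def)
      finally show ?case using insert by simp
    qed simp
    also have "\<dots> \<le> (\<Sum>\<^sub>\<infinity>p\<in>A \<times> B. f p)"
      by (rule infsum_mono_neutral) (use F in \<open>auto intro!: nonneg_summable_on_complete\<close>)
    finally show "(\<Sum>a\<in>F. \<Sum>\<^sub>\<infinity>b\<in>B. f (a, b)) \<le> (\<Sum>\<^sub>\<infinity>p\<in>A \<times> B. f p)" .
  qed
qed

lemma infsum_swap_ennreal:
  fixes f :: "'a \<Rightarrow> 'b \<Rightarrow> ennreal"
  shows "(\<Sum>\<^sub>\<infinity>a\<in>A. \<Sum>\<^sub>\<infinity>b\<in>B. f a b) = (\<Sum>\<^sub>\<infinity>b\<in>B. \<Sum>\<^sub>\<infinity>a\<in>A. f a b)"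
proof -
  have "(\<Sum>\<^sub>\<infinity>a\<in>A. \<Sum>\<^sub>\<infinity>b\<in>B. f a b) = (\<Sum>\<^sub>\<infinity>p\<in>A \<times> B. f (fst p) (snd p))"
    by (simp add: infsum_Times_ennreal)
  also have "\<dots> = (\<Sum>\<^sub>\<infinity>p\<in>prod.swap ` (B \<times> A). f (fst p) (snd p))"
    by (simp add: product_swap)
  also have "\<dots> = (\<Sum>\<^sub>\<infinity>p\<in>B \<times> A. f (snd p) (fst p))"
    by (subst infsum_reindex) (auto simp: o_def)
  also have "\<dots> = (\<Sum>\<^sub>\<infinity>b\<in>B. \<Sum>\<^sub>\<infinity>a\<in>A. f a b)" by (simp add: infsum_Times_ennreal)
  finally show ?thesis .
qed

text \<open>The difference of \<open>f\<close> and its projection is orthogonal to the whole family,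
  hence null. Completeness of a family thus reduces to showing that nothing nonzero is orthogonal to
  it.\<close>

lemma approximable_total:
  assumes fin: "finite_measure M" and e: "orthonormal M e I"
    and total: "\<And>g. g \<in> sq_int M \<Longrightarrow> (\<And>i. i \<in> I \<Longrightarrow> ip M g (e i) = 0) \<Longrightarrow> nrm M g = 0"
    and f [simp]: "f \<in> sq_int M"
  shows "approximable M e I f"
proof -
  obtain p where p [simp]: "p \<in> sq_int M" and ap: "approximable M e I p"
    and ip: "\<forall>i\<in>I. ip M p (e i) = ip M f (e i)"
    by (rule finite_measure.projection_exists[OF fin e f]) (rule that, assumption+, simp)
  have "nrm M (\<lambda>x. f x - p x) = 0"
  proof (rule total)
    fix i assume "i \<in> I"
    then show "ip M (\<lambda>x. f x - p x) (e i) = 0"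
      using bspec[OF ip, of i] orthonormal_sq_int[OF e] by (simp add: ip_diff_left)
  qed simp
  then have "AE x in M. f x - p x = 0" by (intro nrm_zero_imp_AE) simp_all
  then have eq: "AE x in M. p x = f x" by eventually_elim simp
  show ?thesis by (rule approximable_cong_AE[OF ap orthonormal_sq_int[OF e] p f eq])
qed

text \<open>A Dynkin argument: the sets over which \<open>f\<close> integrates to zero are closed
  under complements and disjoint countable unions. The hypothesis \<open>whole\<close> serves the
  complements, since \<open>G\<close> need not contain the whole space.\<close>

lemma (in sigma_finite_measure) AE_zero_if_generator_integrals_zero:
  fixes f :: "'a \<Rightarrow> real"
  assumes f: "integrable M f"
    and G: "Int_stable G" "G \<subseteq> Pow (space M)" "sets M = sigma_sets (space M) G"
    and whole: "(\<integral>x. f x \<partial>M) = 0"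
    and zero: "\<And>A. A \<in> G \<Longrightarrow> (\<integral>x\<in>A. f x \<partial>M) = 0"
  shows "AE x in M. f x = 0"
proof (rule density_zero[OF f])
  fix A assume "A \<in> sets M"
  then have "A \<in> sigma_sets (space M) G" using G(3) by simp
  from G(1,2) this show "(\<integral>x\<in>A. f x \<partial>M) = 0"
  proof (induction rule: sigma_sets_induct_disjoint)
    case (compl A)
    then have A: "A \<in> sets M" using G(3) by simp
    have "(\<integral>x\<in>space M - A. f x \<partial>M) = (\<integral>x. f x - indicator A x * f x \<partial>M)"
      unfolding set_lebesgue_integral_def
      by (rule Bochner_Integration.integral_cong) (auto simp: indicator_def)
    also have "\<dots> = (\<integral>x. f x \<partial>M) - (\<integral>x. indicator A x * f x \<partial>M)"
      using f integrable_mult_indicator[OF A f] by (intro Bochner_Integration.integral_diff) auto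
    finally show ?case using compl whole by (simp add: set_lebesgue_integral_def)
  next
    case (union A)
    have "(\<integral>x\<in>(\<Union>i. A i). f x \<partial>M) = (\<Sum>i. \<integral>x\<in>A i. f x \<partial>M)"
    proof (rule lebesgue_integral_countable_add)
      show m: "A i \<in> sets M" for i using union(2) G(3) by auto
      show "set_integrable M (\<Union>i. A i) f"
        unfolding set_integrable_def by (rule integrable_mult_indicator[OF _ f]) (use m in auto)
    qed (use union(1) in \<open>auto simp: disjoint_family_on_def\<close>)
    also have "\<dots> = 0" using union(3) by simp
    finally show ?case .
  qed (use zero in \<open>simp_all add: set_lebesgue_integral_def\<close>)
qed

section \<open>Tensor products and integral operators over finite measures\<close>

locale finite_measure_pair = M1: finite_measure M1 + M2: finite_measure M2
  for M1 :: "'a measure" and M2 :: "'b measure"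

sublocale finite_measure_pair \<subseteq> pair_sigma_finite M1 M2 ..

sublocale finite_measure_pair \<subseteq> P: finite_measure "M1 \<Otimes>\<^sub>M M2"
  by (rule finite_measure_pair_measure[OF M2.finite_measure_axioms M1.finite_measure_axioms])

definition tensor :: "('a \<Rightarrow> real) \<Rightarrow> ('b \<Rightarrow> real) \<Rightarrow> 'a \<times> 'b \<Rightarrow> real" where
  "tensor f g = (\<lambda>(x, y). f x * g y)"

context finite_measure_pair
begin

lemma tensor_integrable:
  assumes f: "integrable M1 f" and g: "integrable M2 g"
  shows "integrable (M1 \<Otimes>\<^sub>M M2) (tensor f g)" "(\<integral>p. tensor f g p \<partial>(M1 \<Otimes>\<^sub>M M2)) = integral\<^sup>L M1 f * integral\<^sup>L M2 g"
proof -
  have [measurable]: "f \<in> borel_measurable M1" "g \<in> borel_measurable M2" using f g by auto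
  show i: "integrable (M1 \<Otimes>\<^sub>M M2) (tensor f g)"
  proof (rule Fubini_integrable)
    show "tensor f g \<in> borel_measurable (M1 \<Otimes>\<^sub>M M2)" unfolding tensor_def by measurable
    show "integrable M1 (\<lambda>x. \<integral>y. norm (tensor f g (x, y)) \<partial>M2)"
      using f by (simp add: tensor_def abs_mult)
    show "AE x in M1. integrable M2 (\<lambda>y. tensor f g (x, y))"
      using g by (simp add: tensor_def)
  qed
  have "(\<integral>p. tensor f g p \<partial>(M1 \<Otimes>\<^sub>M M2)) = (\<integral>x. (\<integral>y. f x * g y \<partial>M2) \<partial>M1)"
    using integral_fst'[OF i] by (simp add: tensor_def)
  then show "(\<integral>p. tensor f g p \<partial>(M1 \<Otimes>\<^sub>M M2)) = integral\<^sup>L M1 f * integral\<^sup>L M2 g"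
    using f g by simp
qed

lemma tensor_sq_int [simp]:
  assumes f: "f \<in> sq_int M1" and g: "g \<in> sq_int M2"
  shows "tensor f g \<in> sq_int (M1 \<Otimes>\<^sub>M M2)"
proof (rule sq_intI)
  have [measurable]: "f \<in> borel_measurable M1" "g \<in> borel_measurable M2" using f g by auto
  show "tensor f g \<in> borel_measurable (M1 \<Otimes>\<^sub>M M2)" unfolding tensor_def by measurable
  have "(\<lambda>p. (tensor f g p)\<^sup>2) = tensor (\<lambda>x. (f x)\<^sup>2) (\<lambda>y. (g y)\<^sup>2)"
    by (auto simp: tensor_def power_mult_distrib)
  then show "integrable (M1 \<Otimes>\<^sub>M M2) (\<lambda>p. (tensor f g p)\<^sup>2)"
    using tensor_integrable(1)[of "\<lambda>x. (f x)\<^sup>2" "\<lambda>y. (g y)\<^sup>2"] f g by simp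
qed

lemma ip_tensor:
  assumes f: "f \<in> sq_int M1" "f' \<in> sq_int M1" and g: "g \<in> sq_int M2" "g' \<in> sq_int M2"
  shows "ip (M1 \<Otimes>\<^sub>M M2) (tensor f g) (tensor f' g') = ip M1 f f' * ip M2 g g'"
proof -
  have "(\<lambda>p. tensor f g p * tensor f' g' p) = tensor (\<lambda>x. f x * f' x) (\<lambda>y. g y * g' y)"
    by (auto simp: tensor_def)
  then show ?thesis
    using tensor_integrable(2)[of "\<lambda>x. f x * f' x" "\<lambda>y. g y * g' y"] f g by (simp add: ip_def)
qed

lemma nrm_tensor:
  "f \<in> sq_int M1 \<Longrightarrow> g \<in> sq_int M2 \<Longrightarrow> nrm (M1 \<Otimes>\<^sub>M M2) (tensor f g) = nrm M1 f * nrm M2 g"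
  by (simp add: nrm_def ip_tensor real_sqrt_mult)

text \<open>The integral operator with kernel \<open>K\<close>; \<open>contract2\<close> below is
  its adjoint.\<close>

definition contract1 :: "('a \<times> 'b \<Rightarrow> real) \<Rightarrow> ('a \<Rightarrow> real) \<Rightarrow> 'b \<Rightarrow> real" where
  "contract1 K f y = (\<integral>x. K (x, y) * f x \<partial>M1)"

lemma integrable_mult_tensor1:
  assumes K [simp]: "K \<in> sq_int (M1 \<Otimes>\<^sub>M M2)" and f [simp]: "f \<in> sq_int M1"
  shows "integrable (M1 \<Otimes>\<^sub>M M2) (\<lambda>(x, y). K (x, y) * f x)"
proof -
  have "(\<lambda>(x, y). K (x, y) * f x) = (\<lambda>p. K p * tensor f (\<lambda>_. 1) p)" by (auto simp: tensor_def)
  then show ?thesis using sq_int_integrable_mult[OF K tensor_sq_int[OF f M2.sq_int_const[of 1]]] by simp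
qed

lemma AE_section_sq_int1:
  assumes K: "K \<in> sq_int (M1 \<Otimes>\<^sub>M M2)"
  shows "AE y in M2. (\<lambda>x. K (x, y)) \<in> sq_int M1"
proof -
  have [measurable]: "K \<in> borel_measurable (M1 \<Otimes>\<^sub>M M2)" using K by simp
  have "integrable (M1 \<Otimes>\<^sub>M M2) (case_prod (\<lambda>x y. (K (x, y))\<^sup>2))"
    using sq_int_integrable_sq[OF K] by (simp add: case_prod_beta')
  from AE_integrable_snd[OF this] AE_space show ?thesis
    by eventually_elim (rule sq_intI, measurable)
qed

text \<open>The operator norm is bounded by the Hilbert-Schmidt norm: apply Cauchy-Schwarz in
  \<open>x\<close> on almost every section of \<open>K\<close>, then integrate over
  \<open>y\<close>.\<close>

lemma contract1_sq_int [simp]: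
  assumes K: "K \<in> sq_int (M1 \<Otimes>\<^sub>M M2)" and f: "f \<in> sq_int M1"
  shows "contract1 K f \<in> sq_int M2"
    and "nrm M2 (contract1 K f) \<le> nrm (M1 \<Otimes>\<^sub>M M2) K * nrm M1 f"
proof -
  have [measurable]: "K \<in> borel_measurable (M1 \<Otimes>\<^sub>M M2)" "f \<in> borel_measurable M1"
    using K f by auto
  have m [measurable]: "contract1 K f \<in> borel_measurable M2"
    using borel_measurable_integrable[OF integrable_snd[OF integrable_mult_tensor1[OF K f]]]
    by (simp add: contract1_def[abs_def])
  have sq: "integrable (M1 \<Otimes>\<^sub>M M2) (case_prod (\<lambda>x y. (K (x, y))\<^sup>2))"
    using sq_int_integrable_sq[OF K] by (simp add: case_prod_beta')
  have i: "integrable M2 (\<lambda>y. \<integral>x. (K (x, y))\<^sup>2 \<partial>M1)" by (rule integrable_snd[OF sq])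
  have le: "AE y in M2. (contract1 K f y)\<^sup>2 \<le> (\<integral>x. (K (x, y))\<^sup>2 \<partial>M1) * ip M1 f f"
    using AE_section_sq_int1[OF K]
  proof eventually_elim
    case (elim y)
    have "\<bar>contract1 K f y\<bar> \<le> nrm M1 (\<lambda>x. K (x, y)) * nrm M1 f"
      using ip_Cauchy_Schwarz[OF elim f] by (simp add: contract1_def ip_def)
    then have "\<bar>contract1 K f y\<bar>\<^sup>2 \<le> (nrm M1 (\<lambda>x. K (x, y)) * nrm M1 f)\<^sup>2"
      by (rule power_mono) simp
    also have "\<dots> = ip M1 (\<lambda>x. K (x, y)) (\<lambda>x. K (x, y)) * ip M1 f f"
      by (simp add: power_mult_distrib nrm_sq)
    finally show ?case by (simp add: ip_def power2_eq_square)
  qed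
  have i2: "integrable M2 (\<lambda>y. (contract1 K f y)\<^sup>2)"
  proof (rule Bochner_Integration.integrable_bound)
    show "integrable M2 (\<lambda>y. (\<integral>x. (K (x, y))\<^sup>2 \<partial>M1) * ip M1 f f)" using i by simp
    show "AE y in M2. norm ((contract1 K f y)\<^sup>2) \<le> norm ((\<integral>x. (K (x, y))\<^sup>2 \<partial>M1) * ip M1 f f)"
      using le by eventually_elim simp
  qed measurable
  show s: "contract1 K f \<in> sq_int M2" by (rule sq_intI[OF m i2])
  show "nrm M2 (contract1 K f) \<le> nrm (M1 \<Otimes>\<^sub>M M2) K * nrm M1 f"
  proof (rule power2_le_imp_le)
    have "(nrm M2 (contract1 K f))\<^sup>2 = (\<integral>y. (contract1 K f y)\<^sup>2 \<partial>M2)"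
      unfolding nrm_sq by (simp add: ip_def power2_eq_square)
    also have "\<dots> \<le> (\<integral>y. (\<integral>x. (K (x, y))\<^sup>2 \<partial>M1) * ip M1 f f \<partial>M2)"
      by (rule integral_mono_AE[OF i2 _ le]) (use i in simp)
    also have "\<dots> = (\<integral>y. (\<integral>x. (K (x, y))\<^sup>2 \<partial>M1) \<partial>M2) * ip M1 f f" by simp
    also have "(\<integral>y. (\<integral>x. (K (x, y))\<^sup>2 \<partial>M1) \<partial>M2) = ip (M1 \<Otimes>\<^sub>M M2) K K"
      using integral_snd[OF sq] by (simp add: ip_def power2_eq_square case_prod_beta')
    also have "ip (M1 \<Otimes>\<^sub>M M2) K K * ip M1 f f = (nrm (M1 \<Otimes>\<^sub>M M2) K * nrm M1 f)\<^sup>2"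
      by (simp add: power_mult_distrib nrm_sq)
    finally show "(nrm M2 (contract1 K f))\<^sup>2 \<le> (nrm (M1 \<Otimes>\<^sub>M M2) K * nrm M1 f)\<^sup>2" .
  qed simp
qed

text \<open>Fubini. Together with \<open>ip_contract2\<close> it expresses both contractions through
  pairings of \<open>K\<close> with tensors, so that they can be compared without pointwise
  formulas.\<close>

lemma ip_contract1:
  assumes K: "K \<in> sq_int (M1 \<Otimes>\<^sub>M M2)" and f: "f \<in> sq_int M1" and g: "g \<in> sq_int M2"
  shows "ip M2 (contract1 K f) g = ip (M1 \<Otimes>\<^sub>M M2) K (tensor f g)"
proof -
  have eq: "(\<lambda>p. K p * tensor f g p) = (\<lambda>(x, y). K (x, y) * f x * g y)"
    by (auto simp: tensor_def)
  have "integrable (M1 \<Otimes>\<^sub>M M2) (\<lambda>(x, y). K (x, y) * f x * g y)"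
    using sq_int_integrable_mult[OF K tensor_sq_int[OF f g]] unfolding eq .
  from integral_snd[OF this]
  show ?thesis by (simp add: ip_def contract1_def eq)
qed

definition contract2 :: "('a \<times> 'b \<Rightarrow> real) \<Rightarrow> ('b \<Rightarrow> real) \<Rightarrow> 'a \<Rightarrow> real" where
  "contract2 K g x = (\<integral>y. K (x, y) * g y \<partial>M2)"

end

sublocale finite_measure_pair \<subseteq> swap: finite_measure_pair M2 M1 ..

context finite_measure_pair
begin

lemma swap_sq_int:
  assumes K: "K \<in> sq_int (M1 \<Otimes>\<^sub>M M2)"
  shows "(\<lambda>(y, x). K (x, y)) \<in> sq_int (M2 \<Otimes>\<^sub>M M1)"
proof (rule sq_intI)
  have [measurable]: "K \<in> borel_measurable (M1 \<Otimes>\<^sub>M M2)" using K by simp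
  show "(\<lambda>(y, x). K (x, y)) \<in> borel_measurable (M2 \<Otimes>\<^sub>M M1)" by measurable
  show "integrable (M2 \<Otimes>\<^sub>M M1) (\<lambda>p. (case p of (y, x) \<Rightarrow> K (x, y))\<^sup>2)"
    using integrable_product_swap[OF sq_int_integrable_sq[OF K]] by (simp add: case_prod_beta')
qed

lemma contract2_eq_swap: "contract2 K g = swap.contract1 (\<lambda>(y, x). K (x, y)) g"
  by (simp add: fun_eq_iff contract2_def swap.contract1_def)

lemma contract2_sq_int [simp]:
  "K \<in> sq_int (M1 \<Otimes>\<^sub>M M2) \<Longrightarrow> g \<in> sq_int M2 \<Longrightarrow> contract2 K g \<in> sq_int M1"
  unfolding contract2_eq_swap by (rule swap.contract1_sq_int(1)[OF swap_sq_int])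

lemma ip_contract2:
  assumes K: "K \<in> sq_int (M1 \<Otimes>\<^sub>M M2)" and f: "f \<in> sq_int M1" and g: "g \<in> sq_int M2"
  shows "ip M1 (contract2 K g) f = ip (M1 \<Otimes>\<^sub>M M2) K (tensor f g)"
proof -
  have eq: "(\<lambda>p. K p * tensor f g p) = (\<lambda>(x, y). K (x, y) * g y * f x)"
    by (auto simp: tensor_def)
  have "integrable (M1 \<Otimes>\<^sub>M M2) (\<lambda>(x, y). K (x, y) * g y * f x)"
    using sq_int_integrable_mult[OF K tensor_sq_int[OF f g]] unfolding eq .
  from integral_fst[OF this]
  show ?thesis by (simp add: ip_def contract2_def eq)
qed

text \<open>Indicators of measurable rectangles are tensors, and rectangles form an
  intersection-stable generator of the product sigma-algebra.\<close>

lemma nrm_zero_if_tensor_orthogonal: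
  assumes R: "R \<in> sq_int (M1 \<Otimes>\<^sub>M M2)"
    and zero: "\<And>f g. f \<in> sq_int M1 \<Longrightarrow> g \<in> sq_int M2 \<Longrightarrow> ip (M1 \<Otimes>\<^sub>M M2) R (tensor f g) = 0"
  shows "nrm (M1 \<Otimes>\<^sub>M M2) R = 0"
proof -
  have rect: "(\<integral>p\<in>A \<times> B. R p \<partial>(M1 \<Otimes>\<^sub>M M2)) = 0" if "A \<in> sets M1" "B \<in> sets M2" for A B
  proof -
    have "indicator A \<in> sq_int M1" "indicator B \<in> sq_int M2"
      using that by (auto intro!: sq_intI simp: indicator_def power2_eq_square
        M1.integrable_const_bound[of _ 1] M2.integrable_const_bound[of _ 1])
    from zero[OF this] have "(\<integral>p. R p * tensor (indicator A) (indicator B) p \<partial>(M1 \<Otimes>\<^sub>M M2)) = 0"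
      by (simp add: ip_def)
    moreover have "(\<lambda>p. R p * tensor (indicator A) (indicator B) p) = (\<lambda>p. indicator (A \<times> B) p *\<^sub>R R p)"
      by (auto simp: tensor_def indicator_def)
    ultimately show ?thesis by (simp add: set_lebesgue_integral_def)
  qed
  have "AE p in M1 \<Otimes>\<^sub>M M2. R p = 0"
  proof (rule P.AE_zero_if_generator_integrals_zero)
    show "integrable (M1 \<Otimes>\<^sub>M M2) R" by (rule P.sq_int_integrable[OF R])
    show "Int_stable {a \<times> b |a b. a \<in> sets M1 \<and> b \<in> sets M2}"
      by (rule Int_stable_pair_measure_generator)
    show "{a \<times> b |a b. a \<in> sets M1 \<and> b \<in> sets M2} \<subseteq> Pow (space (M1 \<Otimes>\<^sub>M M2))"
      using pair_measure_closed[of M1 M2] by (simp add: space_pair_measure)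
    show "sets (M1 \<Otimes>\<^sub>M M2) = sigma_sets (space (M1 \<Otimes>\<^sub>M M2)) {a \<times> b |a b. a \<in> sets M1 \<and> b \<in> sets M2}"
      by (simp add: sets_pair_measure space_pair_measure)
    have "(\<integral>p\<in>space M1 \<times> space M2. R p \<partial>(M1 \<Otimes>\<^sub>M M2)) = 0" by (rule rect) auto
    then show "(\<integral>p. R p \<partial>(M1 \<Otimes>\<^sub>M M2)) = 0"
      unfolding space_pair_measure[symmetric] set_lebesgue_integral_def
      by (subst (asm) Bochner_Integration.integral_cong[OF refl, of _ _ R]) simp_all
  qed (use rect in auto)
  then show ?thesis using nrm_eq_0_iff_AE[OF R] by simp
qed

text \<open>The point is completeness of the tensor family, shown one variable at a time. If
  \<open>R\<close> is orthogonal to all of it, then \<open>contract2 R (w j)\<close> is orthogonal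
  to every \<open>v i\<close> and hence null. It follows that \<open>contract1 R f\<close> is
  orthogonal to every \<open>w j\<close> for arbitrary \<open>f\<close>, hence null as well, so
  \<open>R\<close> is orthogonal to all tensors.\<close>

lemma product_Parseval:
  assumes V: "orthonormal M1 v I" "\<And>f. f \<in> sq_int M1 \<Longrightarrow> approximable M1 v I f"
    and W: "orthonormal M2 w J" "\<And>f. f \<in> sq_int M2 \<Longrightarrow> approximable M2 w J f"
    and K: "K \<in> sq_int (M1 \<Otimes>\<^sub>M M2)"
  shows "(\<Sum>\<^sub>\<infinity>j\<in>J. \<Sum>\<^sub>\<infinity>i\<in>I. ennreal ((ip (M1 \<Otimes>\<^sub>M M2) K (tensor (v i) (w j)))\<^sup>2))
    = ennreal (ip (M1 \<Otimes>\<^sub>M M2) K K)"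
proof -
  let ?P = "M1 \<Otimes>\<^sub>M M2" and ?e = "\<lambda>(i, j). tensor (v i) (w j)"
  have v: "v i \<in> sq_int M1" if "i \<in> I" for i by (rule orthonormal_sq_int[OF V(1) that])
  have w: "w j \<in> sq_int M2" if "j \<in> J" for j by (rule orthonormal_sq_int[OF W(1) that])
  have e: "orthonormal ?P ?e (I \<times> J)"
    unfolding orthonormal_def using v w orthonormal_ip[OF V(1)] orthonormal_ip[OF W(1)]
    by (auto simp: ip_tensor)
  have "approximable ?P ?e (I \<times> J) K"
  proof (rule approximable_total[OF P.finite_measure_axioms e _ K])
    fix R assume R: "R \<in> sq_int ?P" and "\<And>i. i \<in> I \<times> J \<Longrightarrow> ip ?P R (?e i) = 0"
    then have zero: "ip ?P R (tensor (v i) (w j)) = 0" if "i \<in> I" "j \<in> J" for i j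
      using that by fastforce
    have zero1: "nrm M1 (contract2 R (w j)) = 0" if "j \<in> J" for j
    proof -
      have s: "contract2 R (w j) \<in> sq_int M1" using R w[OF that] by simp
      have "(\<Sum>\<^sub>\<infinity>i\<in>I. ennreal ((ip M1 (contract2 R (w j)) (v i))\<^sup>2)) = 0"
        using zero[OF _ that] by (intro infsum_0) (simp add: ip_contract2[OF R v w[OF that]])
      with nn_Parseval[OF V(1) s V(2)[OF s]] show ?thesis
        by (simp add: nrm_def ennreal_eq_0_iff antisym)
    qed
    have zero2: "nrm M2 (contract1 R f) = 0" if f: "f \<in> sq_int M1" for f
    proof -
      have s: "contract1 R f \<in> sq_int M2" using R f by simp
      have "ip M2 (contract1 R f) (w j) = 0" if "j \<in> J" for j
      proof -
        have "ip M2 (contract1 R f) (w j) = ip M1 (contract2 R (w j)) f"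
          using R f w[OF that] by (simp add: ip_contract1 ip_contract2)
        then show ?thesis
          using ip_Cauchy_Schwarz[of "contract2 R (w j)" M1 f] zero1[OF that] R f w[OF that] by simp
      qed
      then have "(\<Sum>\<^sub>\<infinity>j\<in>J. ennreal ((ip M2 (contract1 R f) (w j))\<^sup>2)) = 0"
        by (intro infsum_0) simp
      with nn_Parseval[OF W(1) s W(2)[OF s]] show ?thesis
        by (simp add: nrm_def ennreal_eq_0_iff antisym)
    qed
    show "nrm ?P R = 0"
    proof (rule nrm_zero_if_tensor_orthogonal[OF R])
      fix f g assume f: "f \<in> sq_int M1" and g: "g \<in> sq_int M2"
      have "ip ?P R (tensor f g) = ip M2 (contract1 R f) g" using R f g by (simp add: ip_contract1)
      then show "ip ?P R (tensor f g) = 0"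
        using ip_Cauchy_Schwarz[of "contract1 R f" M2 g] zero2[OF f] R f g by simp
    qed
  qed
  from nn_Parseval[OF e K this] show ?thesis
    by (subst infsum_swap_ennreal) (simp add: infsum_Times_ennreal)
qed

text \<open>
  The vectors \<open>contract2 K g\<close> are the columns of \<open>K\<close>; if they all lie in the closed span of an
  orthonormal family, that family already computes the norm of \<open>K\<close>.
\<close>

theorem contract1_norm_sum:
  assumes K: "K \<in> sq_int (M1 \<Otimes>\<^sub>M M2)" and e: "orthonormal M1 e I"
    and span: "\<And>g. g \<in> sq_int M2 \<Longrightarrow> approximable M1 e I (contract2 K g)"
  shows "(\<Sum>\<^sub>\<infinity>i\<in>I. ennreal ((nrm M2 (contract1 K (e i)))\<^sup>2)) = ennreal (ip (M1 \<Otimes>\<^sub>M M2) K K)"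
proof -
  \<comment> \<open>Expanding \<open>K\<close> requires a basis of the whole first space; it is
    exchanged for \<open>e\<close> column by column.\<close>
  obtain V where V: "orthonormal M1 (\<lambda>v. v) V"
    and V': "\<forall>f\<in>sq_int M1. approximable M1 (\<lambda>v. v) V f"
    by (rule M1.orthonormal_basis_exists[OF closed_subspace_sq_int]) (rule that, assumption, simp)
  note V = V V'[rule_format]
  obtain W where W: "orthonormal M2 (\<lambda>w. w) W"
    and W': "\<forall>f\<in>sq_int M2. approximable M2 (\<lambda>w. w) W f"
    by (rule M2.orthonormal_basis_exists[OF closed_subspace_sq_int]) (rule that, assumption, simp)
  note W = W W'[rule_format]
  have v: "v \<in> sq_int M1" if "v \<in> V" for v using orthonormal_sq_int[OF V(1) that] .
  have w: "w \<in> sq_int M2" if "w \<in> W" for w using orthonormal_sq_int[OF W(1) that] .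
  have ei: "e i \<in> sq_int M1" if "i \<in> I" for i by (rule orthonormal_sq_int[OF e that])
  have "ennreal (ip (M1 \<Otimes>\<^sub>M M2) K K)
      = (\<Sum>\<^sub>\<infinity>w\<in>W. \<Sum>\<^sub>\<infinity>v\<in>V. ennreal ((ip (M1 \<Otimes>\<^sub>M M2) K (tensor v w))\<^sup>2))"
    by (rule product_Parseval[OF V W K, symmetric])
  also have "\<dots> = (\<Sum>\<^sub>\<infinity>w\<in>W. \<Sum>\<^sub>\<infinity>i\<in>I. ennreal ((ip M2 (contract1 K (e i)) w)\<^sup>2))"
  proof (rule infsum_cong)
    fix w assume "w \<in> W"
    note w = w[OF this]
    have c: "contract2 K w \<in> sq_int M1" using K w by simp
    have "(\<Sum>\<^sub>\<infinity>v\<in>V. ennreal ((ip (M1 \<Otimes>\<^sub>M M2) K (tensor v w))\<^sup>2))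
        = (\<Sum>\<^sub>\<infinity>v\<in>V. ennreal ((ip M1 (contract2 K w) v)\<^sup>2))"
      using K w v by (intro infsum_cong) (simp add: ip_contract2)
    also have "\<dots> = ennreal (ip M1 (contract2 K w) (contract2 K w))"
      by (rule nn_Parseval[OF V(1) c V(2)[OF c]])
    \<comment> \<open>Here \<open>e\<close> may span only a subspace; Parseval still holds because
      this particular column lies in it.\<close>
    also have "\<dots> = (\<Sum>\<^sub>\<infinity>i\<in>I. ennreal ((ip M1 (contract2 K w) (e i))\<^sup>2))"
      by (rule nn_Parseval[OF e c span[OF w], symmetric])
    also have "\<dots> = (\<Sum>\<^sub>\<infinity>i\<in>I. ennreal ((ip M2 (contract1 K (e i)) w)\<^sup>2))"
      using K w ei by (intro infsum_cong) (simp add: ip_contract2 ip_contract1)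
    finally show "(\<Sum>\<^sub>\<infinity>v\<in>V. ennreal ((ip (M1 \<Otimes>\<^sub>M M2) K (tensor v w))\<^sup>2))
        = (\<Sum>\<^sub>\<infinity>i\<in>I. ennreal ((ip M2 (contract1 K (e i)) w)\<^sup>2))" .
  qed
  also have "\<dots> = (\<Sum>\<^sub>\<infinity>i\<in>I. \<Sum>\<^sub>\<infinity>w\<in>W. ennreal ((ip M2 (contract1 K (e i)) w)\<^sup>2))"
    by (rule infsum_swap_ennreal)
  also have "\<dots> = (\<Sum>\<^sub>\<infinity>i\<in>I. ennreal ((nrm M2 (contract1 K (e i)))\<^sup>2))"
  proof (rule infsum_cong)
    fix i assume "i \<in> I"
    have c: "contract1 K (e i) \<in> sq_int M2" using K ei[OF \<open>i \<in> I\<close>] by simp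
    show "(\<Sum>\<^sub>\<infinity>w\<in>W. ennreal ((ip M2 (contract1 K (e i)) w)\<^sup>2)) = ennreal ((nrm M2 (contract1 K (e i)))\<^sup>2)"
      unfolding nrm_sq by (rule nn_Parseval[OF W(1) c W(2)[OF c]])
  qed
  finally show ?thesis ..
qed

end

section \<open>Smooth functions and test functions\<close>

lemma zero_index_mem: "(\<lambda>_. 0) \<in> multi_indices k"
  by (simp add: multi_indices_def multi_order_def)

lemma multi_order_zero [simp]: "multi_order (\<lambda>_. 0) = 0"
  by (simp add: multi_order_def)

definition smooth :: "('a::euclidean_space \<Rightarrow> real) \<Rightarrow> bool" where
  "smooth f \<longleftrightarrow> (\<forall>bs. set bs \<subseteq> Basis \<longrightarrow> foldr partial_deriv bs f differentiable_on UNIV)"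

lemma smooth_differentiable: "smooth f \<Longrightarrow> f differentiable (at x)"
  unfolding smooth_def differentiable_on_def
  by (drule spec[of _ "[]"]) simp

lemma smooth_foldr:
  assumes "smooth f" "set cs \<subseteq> Basis"
  shows "smooth (foldr partial_deriv cs f)"
  unfolding smooth_def
proof (intro allI impI)
  fix bs :: "'a list" assume "set bs \<subseteq> Basis"
  then show "foldr partial_deriv bs (foldr partial_deriv cs f) differentiable_on UNIV"
    using assms(1)[unfolded smooth_def, rule_format, of "bs @ cs"] assms(2) by simp
qed

lemma smooth_partial_deriv: "smooth f \<Longrightarrow> b \<in> Basis \<Longrightarrow> smooth (partial_deriv b f)"
  using smooth_foldr[of f "[b]"] by simp

text \<open>Smooth functions form the largest class of differentiable functions closed under partial
  derivatives. Exhibiting a closed class replaces formulas for iterated derivatives of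
  products.\<close>

lemma smooth_coinduct:
  assumes "f \<in> S" and diff: "\<And>g x. g \<in> S \<Longrightarrow> g differentiable (at x)"
    and step: "\<And>g b. g \<in> S \<Longrightarrow> b \<in> Basis \<Longrightarrow> partial_deriv b g \<in> S"
  shows "smooth f"
proof -
  have "foldr partial_deriv bs f \<in> S" if "set bs \<subseteq> Basis" for bs
    using that by (induction bs) (use assms(1) step in auto)
  with diff show ?thesis by (simp add: smooth_def differentiable_on_def)
qed

lemma smooth_has_derivative: "smooth f \<Longrightarrow> (f has_derivative frechet_derivative f (at x)) (at x)"
  using smooth_differentiable frechet_derivative_works by blast

lemma partial_deriv_eqI: "(f has_derivative f') (at x) \<Longrightarrow> partial_deriv b f x = f' b"
  unfolding partial_deriv_def by (simp flip: frechet_derivative_at)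

lemma smooth_continuous_on: "smooth f \<Longrightarrow> continuous_on S f"
  by (meson continuous_at_imp_continuous_on differentiable_imp_continuous_within smooth_differentiable)

lemma smooth_borel_measurable [measurable_dest]: "smooth f \<Longrightarrow> f \<in> borel_measurable borel"
  by (simp add: borel_measurable_continuous_onI smooth_continuous_on)

section \<open>Symmetry of mixed partial derivatives\<close>

lemma smooth_line_derivative:
  assumes "smooth f"
  shows "((\<lambda>s. f (x + s *\<^sub>R b)) has_real_derivative partial_deriv b f (x + s *\<^sub>R b)) (at s)"
proof -
  have "((\<lambda>s. x + s *\<^sub>R b) has_derivative (\<lambda>h. h *\<^sub>R b)) (at s)"
    by (auto intro!: derivative_eq_intros)
  from diff_chain_at[OF this smooth_has_derivative[OF assms]]
  have "((\<lambda>s. f (x + s *\<^sub>R b)) has_derivative (\<lambda>h. frechet_derivative f (at (x + s *\<^sub>R b)) (h *\<^sub>R b))) (at s)"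
    by (simp add: o_def)
  moreover have "linear (frechet_derivative f (at (x + s *\<^sub>R b)))"
    using smooth_has_derivative[OF assms] has_derivative_linear by blast
  ultimately show ?thesis
    by (simp add: has_field_derivative_def linear_scale partial_deriv_def mult_commute_abs)
qed

text \<open>The left-hand side is symmetric in \<open>b\<close> and \<open>c\<close>. Exchanging
  their roles therefore makes the two mixed derivatives agree at two points close to
  \<open>x\<close>.\<close>

lemma second_difference_mean_value:
  assumes f: "smooth f" and b: "b \<in> Basis" and h: "h > 0"
  shows "\<exists>s t. 0 < s \<and> s < h \<and> 0 < t \<and> t < h \<and>
    f (x + h *\<^sub>R b + h *\<^sub>R c) - f (x + h *\<^sub>R b) - f (x + h *\<^sub>R c) + f x
      = h * (h * partial_deriv c (partial_deriv b f) (x + s *\<^sub>R b + t *\<^sub>R c))"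
proof -
  \<comment> \<open>The mean value theorem is used twice: along \<open>b\<close> on the increment in
    direction \<open>c\<close>, then along \<open>c\<close> on the derivative in direction
    \<open>b\<close>.\<close>
  let ?g = "\<lambda>s. f (x + h *\<^sub>R c + s *\<^sub>R b) - f (x + s *\<^sub>R b)"
  have "\<exists>s>0. s < h \<and> ?g h - ?g 0 = (h - 0) *
      (partial_deriv b f (x + h *\<^sub>R c + s *\<^sub>R b) - partial_deriv b f (x + s *\<^sub>R b))"
    by (rule MVT2[OF h]) (intro DERIV_diff smooth_line_derivative f)
  then obtain s where s: "0 < s" "s < h" and eq: "?g h - ?g 0 = h *
      (partial_deriv b f (x + h *\<^sub>R c + s *\<^sub>R b) - partial_deriv b f (x + s *\<^sub>R b))"
    by auto
  let ?k = "\<lambda>t. partial_deriv b f (x + s *\<^sub>R b + t *\<^sub>R c)"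
  have "\<exists>t>0. t < h \<and> ?k h - ?k 0 = (h - 0) *
      partial_deriv c (partial_deriv b f) (x + s *\<^sub>R b + t *\<^sub>R c)"
    by (rule MVT2[OF h]) (intro smooth_line_derivative smooth_partial_deriv f b)
  then obtain t where t: "0 < t" "t < h" and eq': "?k h - ?k 0 =
      h * partial_deriv c (partial_deriv b f) (x + s *\<^sub>R b + t *\<^sub>R c)" by auto
  have "f (x + h *\<^sub>R b + h *\<^sub>R c) - f (x + h *\<^sub>R b) - f (x + h *\<^sub>R c) + f x = ?g h - ?g 0"
    by (simp add: add.assoc add.commute[of "h *\<^sub>R b"])
  also have "\<dots> = h * (?k h - ?k 0)"
    unfolding eq by (simp add: add.assoc add.commute[of "h *\<^sub>R c"])
  finally show ?thesis using s t eq' by (intro exI[of _ s] exI[of _ t]) simp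
qed

lemma partial_deriv_commute:
  assumes f: "smooth f" and b: "b \<in> Basis" and c: "c \<in> Basis"
  shows "partial_deriv b (partial_deriv c f) = partial_deriv c (partial_deriv b f)"
proof (rule ext, rule ccontr)
  fix x
  let ?p = "partial_deriv b (partial_deriv c f)" and ?q = "partial_deriv c (partial_deriv b f)"
  assume ne: "?p x \<noteq> ?q x"
  \<comment> \<open>Half the gap: no single number is closer than this to both \<open>?p x\<close>
    and \<open>?q x\<close>.\<close>
  define \<epsilon> where "\<epsilon> = \<bar>?p x - ?q x\<bar> / 2"
  have \<epsilon>: "\<epsilon> > 0" using ne by (simp add: \<epsilon>_def)
  have "continuous (at x) ?p" "continuous (at x) ?q"
    by (intro differentiable_imp_continuous_within smooth_differentiable smooth_partial_deriv f b c)+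
  then obtain d1 d2 where d: "d1 > 0" "d2 > 0"
    and p: "\<And>y. dist y x < d1 \<Longrightarrow> dist (?p y) (?p x) < \<epsilon>"
    and q: "\<And>y. dist y x < d2 \<Longrightarrow> dist (?q y) (?q x) < \<epsilon>"
    using \<epsilon> unfolding continuous_at_eps_delta by metis
  \<comment> \<open>Basis vectors have norm 1, so both intermediate points are within
    \<open>2 * h\<close> of \<open>x\<close>, which stays below \<open>d1\<close> and
    \<open>d2\<close>.\<close>
  define h where "h = min d1 d2 / 4"
  have h: "h > 0" using d by (simp add: h_def)
  obtain s t where st: "0 < s" "s < h" "0 < t" "t < h"
    and 1: "f (x + h *\<^sub>R b + h *\<^sub>R c) - f (x + h *\<^sub>R b) - f (x + h *\<^sub>R c) + f x
      = h * (h * ?q (x + s *\<^sub>R b + t *\<^sub>R c))"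
    using second_difference_mean_value[OF f b h] by blast
  obtain s' t' where st': "0 < s'" "s' < h" "0 < t'" "t' < h"
    and 2: "f (x + h *\<^sub>R c + h *\<^sub>R b) - f (x + h *\<^sub>R c) - f (x + h *\<^sub>R b) + f x
      = h * (h * ?p (x + s' *\<^sub>R c + t' *\<^sub>R b))"
    using second_difference_mean_value[OF f c h] by blast
  have "h * (h * ?q (x + s *\<^sub>R b + t *\<^sub>R c)) = h * (h * ?p (x + s' *\<^sub>R c + t' *\<^sub>R b))"
  proof -
    have "x + h *\<^sub>R c + h *\<^sub>R b = x + h *\<^sub>R b + h *\<^sub>R c" by (simp add: algebra_simps)
    from 1 2[unfolded this] show ?thesis by linarith
  qed
  then have eq: "?q (x + s *\<^sub>R b + t *\<^sub>R c) = ?p (x + s' *\<^sub>R c + t' *\<^sub>R b)" using h by simp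
  have "dist (x + s *\<^sub>R b + t *\<^sub>R c) x < d2"
  proof -
    have "dist (x + s *\<^sub>R b + t *\<^sub>R c) x = norm (s *\<^sub>R b + t *\<^sub>R c)" by (simp add: dist_norm add.assoc)
    also have "\<dots> \<le> s + t" using norm_triangle_ineq[of "s *\<^sub>R b" "t *\<^sub>R c"] st b c by simp
    also have "\<dots> < d2" using st d by (simp add: h_def)
    finally show ?thesis .
  qed
  from q[OF this] have Q: "\<bar>?q (x + s *\<^sub>R b + t *\<^sub>R c) - ?q x\<bar> < \<epsilon>" by (simp add: dist_real_def)
  have "dist (x + s' *\<^sub>R c + t' *\<^sub>R b) x < d1"
  proof -
    have "dist (x + s' *\<^sub>R c + t' *\<^sub>R b) x = norm (s' *\<^sub>R c + t' *\<^sub>R b)" by (simp add: dist_norm add.assoc)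
    also have "\<dots> \<le> s' + t'" using norm_triangle_ineq[of "s' *\<^sub>R c" "t' *\<^sub>R b"] st' b c by simp
    also have "\<dots> < d1" using st' d by (simp add: h_def)
    finally show ?thesis .
  qed
  from p[OF this] have "\<bar>?p (x + s' *\<^sub>R c + t' *\<^sub>R b) - ?p x\<bar> < \<epsilon>" by (simp add: dist_real_def)
  moreover have "\<not> (\<bar>u - q\<bar> < \<bar>p - q\<bar> / 2 \<and> \<bar>u - p\<bar> < \<bar>p - q\<bar> / 2)" for u p q :: real
    using abs_triangle_ineq4[of "u - q" "u - p"] by simp
  ultimately show False using Q eq unfolding \<epsilon>_def by metis
qed

lemma foldr_partial_deriv_permute:
  assumes f: "smooth f" and bs: "set bs \<subseteq> Basis" and eq: "mset bs = mset cs"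
  shows "foldr partial_deriv bs f = foldr partial_deriv cs f"
proof -
  have "fold partial_deriv (rev bs) f = fold partial_deriv (rev cs) f"
    by (rule fold_permuted_eq[where P = smooth])
      (use f bs eq in \<open>auto intro: smooth_partial_deriv partial_deriv_commute\<close>)
  then show ?thesis by (simp add: foldr_conv_fold)
qed

text \<open>The multi-index spelled out as a list of directions, so that \<open>multi_deriv\<close>
  is a plain \<open>foldr\<close> and questions of order become questions about multisets.\<close>

definition index_list :: "('a::euclidean_space \<Rightarrow> nat) \<Rightarrow> 'a list" where
  "index_list \<alpha> = concat (map (\<lambda>b. replicate (\<alpha> b) b) basis_list)"

lemma basis_list: "set basis_list = (Basis :: 'a::euclidean_space set)" "distinct (basis_list :: 'a list)"
proof -
  have "\<exists>bs :: 'a list. set bs = Basis \<and> distinct bs"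
    using finite_distinct_list[OF finite_Basis] by blast
  then have "set (basis_list :: 'a list) = Basis \<and> distinct (basis_list :: 'a list)"
    unfolding basis_list_def by (rule someI_ex)
  then show "set basis_list = (Basis :: 'a::euclidean_space set)" "distinct (basis_list :: 'a list)" by auto
qed

lemma multi_deriv_eq_foldr: "multi_deriv \<alpha> f = foldr partial_deriv (index_list \<alpha>) f"
proof -
  have rep: "foldr partial_deriv (replicate n b) g = (partial_deriv b ^^ n) g" for n b and g :: "'a \<Rightarrow> real"
    by (induction n) auto
  have "foldr (\<lambda>b. partial_deriv b ^^ \<alpha> b) bs f = foldr partial_deriv (concat (map (\<lambda>b. replicate (\<alpha> b) b) bs)) f"
    for bs by (induction bs) (auto simp: rep)
  then show ?thesis by (simp add: multi_deriv_def index_list_def)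
qed

lemma multi_deriv_zero [simp]: "multi_deriv (\<lambda>_. 0) (\<phi> :: 'a::euclidean_space \<Rightarrow> real) = \<phi>"
proof -
  have "index_list (\<lambda>_ :: 'a. 0) = []" by (simp add: index_list_def)
  then show ?thesis by (simp add: multi_deriv_eq_foldr)
qed

lemma set_index_list: "set (index_list \<alpha>) \<subseteq> Basis"
  by (auto simp: index_list_def basis_list)

text \<open>The multiplicities do not depend on the enumeration chosen in
  \<open>basis_list\<close>.\<close>

lemma mset_map_index_list:
  "mset (map g (index_list \<alpha>)) = (\<Sum>b\<in>Basis. replicate_mset (\<alpha> b) (g b))"
proof -
  have "mset (map g (index_list \<alpha>)) = (\<Sum>b\<leftarrow>basis_list. replicate_mset (\<alpha> b) (g b))"
    by (simp add: index_list_def map_concat mset_concat o_def)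
  also have "\<dots> = (\<Sum>b\<in>set basis_list. replicate_mset (\<alpha> b) (g b))"
    by (rule sum_list_distinct_conv_sum_set[OF basis_list(2)])
  finally show ?thesis by (simp add: basis_list)
qed

lemma mset_index_list_pair:
  "mset (index_list (pair_index \<alpha> \<beta>))
    = mset (map (\<lambda>b. (b, 0)) (index_list \<alpha>) @ map (\<lambda>b. (0, b)) (index_list \<beta>))"
proof -
  let ?r = "\<lambda>b. replicate_mset (pair_index \<alpha> \<beta> b) b"
  have "mset (index_list (pair_index \<alpha> \<beta>)) = sum ?r Basis"
    using mset_map_index_list[of "\<lambda>b. b" "pair_index \<alpha> \<beta>"] by simp
  also have "\<dots> = (\<Sum>b\<in>Basis. ?r (b, 0)) + (\<Sum>b\<in>Basis. ?r (0, b))"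
    unfolding Basis_prod_def
    by (subst sum.union_disjoint) (auto simp: sum.reindex inj_on_def)
  also have "\<dots> = (\<Sum>b\<in>Basis. replicate_mset (\<alpha> b) (b, 0)) + (\<Sum>b\<in>Basis. replicate_mset (\<beta> b) (0, b))"
    by (intro arg_cong2[where f = "(+)"] sum.cong) (auto simp: pair_index_def)
  finally show ?thesis
    by (simp add: mset_map_index_list del: mset_map)
qed

section \<open>Derivatives of sections and of tensor products\<close>

lemma partial_deriv_section1:
  assumes "smooth f"
  shows "partial_deriv (b, 0) f (x, y) = partial_deriv b (\<lambda>x. f (x, y)) x"
    and "(\<lambda>x. f (x, y)) differentiable (at x)"
proof -
  have "((\<lambda>x. (x, y)) has_derivative (\<lambda>h. (h, 0))) (at x)"
    by (auto intro!: derivative_eq_intros)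
  from diff_chain_at[OF this smooth_has_derivative[OF assms]]
  have d: "((\<lambda>x. f (x, y)) has_derivative (\<lambda>h. frechet_derivative f (at (x, y)) (h, 0))) (at x)"
    by (simp add: o_def)
  show "partial_deriv (b, 0) f (x, y) = partial_deriv b (\<lambda>x. f (x, y)) x"
    using partial_deriv_eqI[OF d, of b] by (simp add: partial_deriv_def)
  show "(\<lambda>x. f (x, y)) differentiable (at x)" using d by (rule differentiableI)
qed

lemma partial_deriv_section2:
  assumes "smooth f"
  shows "partial_deriv (0, b) f (x, y) = partial_deriv b (\<lambda>y. f (x, y)) y"
    and "(\<lambda>y. f (x, y)) differentiable (at y)"
proof -
  have "((\<lambda>y. (x, y)) has_derivative (\<lambda>h. (0, h))) (at y)"
    by (auto intro!: derivative_eq_intros)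
  from diff_chain_at[OF this smooth_has_derivative[OF assms]]
  have d: "((\<lambda>y. f (x, y)) has_derivative (\<lambda>h. frechet_derivative f (at (x, y)) (0, h))) (at y)"
    by (simp add: o_def)
  show "partial_deriv (0, b) f (x, y) = partial_deriv b (\<lambda>y. f (x, y)) y"
    using partial_deriv_eqI[OF d, of b] by (simp add: partial_deriv_def)
  show "(\<lambda>y. f (x, y)) differentiable (at y)" using d by (rule differentiableI)
qed

lemma Pair_0_in_Basis: "b \<in> Basis \<Longrightarrow> (b, 0) \<in> Basis" "b \<in> Basis \<Longrightarrow> (0, b) \<in> Basis"
  by (auto simp: Basis_prod_def)

lemma foldr_partial_deriv_section1:
  assumes f: "smooth f" and bs: "set bs \<subseteq> Basis"
  shows "foldr partial_deriv (map (\<lambda>b. (b, 0)) bs) f (x, y) = foldr partial_deriv bs (\<lambda>x. f (x, y)) x"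
  using bs
proof (induction bs arbitrary: x)
  case (Cons b bs)
  let ?g = "foldr partial_deriv (map (\<lambda>b. (b, 0)) bs) f"
  have g: "smooth ?g" using Cons.prems by (intro smooth_foldr[OF f]) (auto intro: Pair_0_in_Basis)
  have IH: "(\<lambda>x. ?g (x, y)) = foldr partial_deriv bs (\<lambda>x. f (x, y))"
    using Cons by (intro ext) simp
  show ?case using partial_deriv_section1(1)[OF g, of b x y] by (simp add: IH)
qed simp

lemma foldr_partial_deriv_section2:
  assumes f: "smooth f" and bs: "set bs \<subseteq> Basis"
  shows "foldr partial_deriv (map (\<lambda>b. (0, b)) bs) f (x, y) = foldr partial_deriv bs (\<lambda>y. f (x, y)) y"
  using bs
proof (induction bs arbitrary: y)
  case (Cons b bs)
  let ?g = "foldr partial_deriv (map (\<lambda>b. (0, b)) bs) f"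
  have g: "smooth ?g" using Cons.prems by (intro smooth_foldr[OF f]) (auto intro: Pair_0_in_Basis)
  have IH: "(\<lambda>y. ?g (x, y)) = foldr partial_deriv bs (\<lambda>y. f (x, y))"
    using Cons by (intro ext) simp
  show ?case using partial_deriv_section2(1)[OF g, of b x y] by (simp add: IH)
qed simp

lemma smooth_section1:
  assumes f: "smooth f" shows "smooth (\<lambda>x. f (x, y))"
  unfolding smooth_def differentiable_on_def
proof (intro allI impI ballI)
  fix bs :: "'a list" and x assume bs: "set bs \<subseteq> Basis"
  let ?g = "foldr partial_deriv (map (\<lambda>b. (b, 0)) bs) f"
  have g: "smooth ?g" using bs by (intro smooth_foldr[OF f]) (auto intro: Pair_0_in_Basis)
  have eq: "(\<lambda>x. ?g (x, y)) = foldr partial_deriv bs (\<lambda>x. f (x, y))"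
    by (intro ext foldr_partial_deriv_section1 f bs)
  show "foldr partial_deriv bs (\<lambda>x. f (x, y)) differentiable at x"
    using partial_deriv_section1(2)[OF g, of y x] unfolding eq .
qed

lemma smooth_section2:
  assumes f: "smooth f" shows "smooth (\<lambda>y. f (x, y))"
  unfolding smooth_def differentiable_on_def
proof (intro allI impI ballI)
  fix bs :: "'b list" and y assume bs: "set bs \<subseteq> Basis"
  let ?g = "foldr partial_deriv (map (\<lambda>b. (0, b)) bs) f"
  have g: "smooth ?g" using bs by (intro smooth_foldr[OF f]) (auto intro: Pair_0_in_Basis)
  have eq: "(\<lambda>y. ?g (x, y)) = foldr partial_deriv bs (\<lambda>y. f (x, y))"
    by (intro ext foldr_partial_deriv_section2 f bs)
  show "foldr partial_deriv bs (\<lambda>y. f (x, y)) differentiable at y"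
    using partial_deriv_section2(2)[OF g, of x y] unfolding eq .
qed

text \<open>
  The fixed enumeration of the basis of the product space may interleave the two groups of
  variables; symmetry of the derivatives separates them.
\<close>

lemma multi_deriv_pair_index:
  assumes f: "smooth f"
  shows "multi_deriv (pair_index \<alpha> \<beta>) f = (\<lambda>(x, y). multi_deriv \<alpha> (\<lambda>x. multi_deriv \<beta> (\<lambda>y. f (x, y)) y) x)"
proof (intro ext, clarify)
  fix x y
  let ?g = "foldr partial_deriv (map (\<lambda>b. (0, b)) (index_list \<beta>)) f"
  have "multi_deriv (pair_index \<alpha> \<beta>) f = foldr partial_deriv (map (\<lambda>b. (b, 0)) (index_list \<alpha>)) ?g"
    unfolding multi_deriv_eq_foldr
    using foldr_partial_deriv_permute[OF f set_index_list mset_index_list_pair, of \<alpha> \<beta>] by simp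
  moreover have "smooth ?g"
    using set_index_list[of \<beta>] by (intro smooth_foldr[OF f]) (auto intro: Pair_0_in_Basis)
  ultimately have "multi_deriv (pair_index \<alpha> \<beta>) f (x, y) = multi_deriv \<alpha> (\<lambda>x. ?g (x, y)) x"
    by (simp add: foldr_partial_deriv_section1 set_index_list multi_deriv_eq_foldr)
  then show "multi_deriv (pair_index \<alpha> \<beta>) f (x, y) = multi_deriv \<alpha> (\<lambda>x. multi_deriv \<beta> (\<lambda>y. f (x, y)) y) x"
    by (simp add: foldr_partial_deriv_section2 set_index_list multi_deriv_eq_foldr f)
qed

lemma partial_deriv_scale:
  assumes "smooth f" shows "partial_deriv b (\<lambda>x. c * f x) = (\<lambda>x. c * partial_deriv b f x)"
proof
  fix x
  have "((\<lambda>x. c * f x) has_derivative (\<lambda>h. c * frechet_derivative f (at x) h)) (at x)"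
    by (intro has_derivative_mult_right smooth_has_derivative assms)
  from partial_deriv_eqI[OF this] show "partial_deriv b (\<lambda>x. c * f x) x = c * partial_deriv b f x"
    by (simp add: partial_deriv_def)
qed

lemma multi_deriv_scale:
  assumes f: "smooth f" shows "multi_deriv \<alpha> (\<lambda>x. c * f x) = (\<lambda>x. c * multi_deriv \<alpha> f x)"
proof -
  have "foldr partial_deriv bs (\<lambda>x. c * f x) = (\<lambda>x. c * foldr partial_deriv bs f x)" if "set bs \<subseteq> Basis" for bs
    using that
  proof (induction bs)
    case (Cons b bs)
    then show ?case using partial_deriv_scale[OF smooth_foldr[OF f, of bs]] by simp
  qed simp
  then show ?thesis by (simp add: multi_deriv_eq_foldr set_index_list)
qed

lemma tensor_has_derivative:
  assumes f: "smooth f" and g: "smooth g"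
  shows "(tensor f g has_derivative (\<lambda>(h, k). f x * frechet_derivative g (at y) k + frechet_derivative f (at x) h * g y))
    (at (x, y))"
proof -
  have "((\<lambda>p. f (fst p)) has_derivative (\<lambda>p. frechet_derivative f (at x) (fst p))) (at (x, y))"
    by (rule has_derivative_compose[of fst fst]) (auto intro!: derivative_eq_intros smooth_has_derivative f)
  moreover have "((\<lambda>p. g (snd p)) has_derivative (\<lambda>p. frechet_derivative g (at y) (snd p))) (at (x, y))"
    by (rule has_derivative_compose[of snd snd]) (auto intro!: derivative_eq_intros smooth_has_derivative g)
  ultimately show ?thesis
    using has_derivative_mult[of "\<lambda>p. f (fst p)" "\<lambda>p. frechet_derivative f (at x) (fst p)" "(x, y)" UNIV
        "\<lambda>p. g (snd p)" "\<lambda>p. frechet_derivative g (at y) (snd p)"]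
    by (simp add: tensor_def case_prod_beta')
qed

lemma partial_deriv_tensor:
  "smooth f \<Longrightarrow> smooth g \<Longrightarrow> partial_deriv (u, v) (tensor f g)
    = (\<lambda>(x, y). f x * partial_deriv v g y + partial_deriv u f x * g y)"
  by (auto simp: partial_deriv_eqI[OF tensor_has_derivative] partial_deriv_def[of v] partial_deriv_def[of u])

lemma partial_deriv_direction_0: "smooth f \<Longrightarrow> partial_deriv 0 f x = 0"
  unfolding partial_deriv_def
  by (rule linear_0[OF has_derivative_linear[OF smooth_has_derivative]])

text \<open>A basis direction of the product space moves only one of the two variables, so a partial
  derivative of a tensor is again a tensor, and coinduction applies.\<close>

lemma smooth_tensor:
  fixes f :: "'a::euclidean_space \<Rightarrow> real" and g :: "'b::euclidean_space \<Rightarrow> real"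
  assumes f: "smooth f" and g: "smooth g"
  shows "smooth (tensor f g)"
proof (rule smooth_coinduct)
  let ?S = "{tensor f g |(f :: 'a \<Rightarrow> real) (g :: 'b \<Rightarrow> real). smooth f \<and> smooth g}"
  show "tensor f g \<in> ?S" using f g by blast
  show "h differentiable (at p)" if "h \<in> ?S" for h p
  proof -
    obtain f :: "'a \<Rightarrow> real" and g :: "'b \<Rightarrow> real" where "h = tensor f g" "smooth f" "smooth g"
      using \<open>h \<in> ?S\<close> by blast
    then show ?thesis
      using differentiableI[OF tensor_has_derivative[of f g "fst p" "snd p"]] by simp
  qed
  show "partial_deriv b h \<in> ?S" if "h \<in> ?S" "b \<in> Basis" for h b
  proof -
    obtain f :: "'a \<Rightarrow> real" and g :: "'b \<Rightarrow> real" where h: "h = tensor f g" and f: "smooth f" and g: "smooth g"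
      using \<open>h \<in> ?S\<close> by blast
    from \<open>b \<in> Basis\<close> consider u where "u \<in> Basis" "b = (u, 0)" | u where "u \<in> Basis" "b = (0, u)"
      by (auto simp: Basis_prod_def)
    then show ?thesis
    proof cases
      case 1
      have "partial_deriv b h = tensor (partial_deriv u f) g"
        unfolding h 1(2)
        by (auto simp: partial_deriv_tensor[OF f g] partial_deriv_direction_0[OF f]
          partial_deriv_direction_0[OF g]) (simp_all add: tensor_def)
      with f g 1 show ?thesis using smooth_partial_deriv by blast
    next
      case 2
      have "partial_deriv b h = tensor f (partial_deriv u g)"
        unfolding h 2(2)
        by (auto simp: partial_deriv_tensor[OF f g] partial_deriv_direction_0[OF f]
          partial_deriv_direction_0[OF g]) (simp_all add: tensor_def)
      with f g 2 show ?thesis using smooth_partial_deriv by blast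
    qed
  qed
qed

lemma multi_deriv_tensor:
  assumes f: "smooth f" and g: "smooth g"
  shows "multi_deriv (pair_index \<alpha> \<beta>) (tensor f g) = tensor (multi_deriv \<alpha> f) (multi_deriv \<beta> g)"
proof -
  have "multi_deriv \<alpha> (\<lambda>x. f x * multi_deriv \<beta> g y) = (\<lambda>x. multi_deriv \<alpha> f x * multi_deriv \<beta> g y)" for y
    using multi_deriv_scale[OF f, of \<alpha> "multi_deriv \<beta> g y"] by (simp add: mult.commute)
  then show ?thesis
    unfolding multi_deriv_pair_index[OF smooth_tensor[OF f g]]
    by (simp add: tensor_def multi_deriv_scale[OF g])
qed

text \<open>
  \<open>t \<mapsto> t\<^sup>-\<^sup>k exp (-1/t)\<close>, extended by 0, form a family whose span is closed under differentiation.
\<close>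

definition flat_exp :: "nat \<Rightarrow> real \<Rightarrow> real" where
  "flat_exp k t = (if t > 0 then exp (- inverse t) * inverse t ^ k else 0)"

lemma flat_exp_tendsto_0: "(flat_exp k \<longlongrightarrow> 0) (at 0)"
proof -
  have "((\<lambda>t. inverse t ^ k / exp (inverse t)) \<longlongrightarrow> (0::real)) (at_right 0)"
    by (rule filterlim_compose[OF tendsto_power_div_exp_0 filterlim_inverse_at_top_right])
  then have "(flat_exp k \<longlongrightarrow> 0) (at_right 0)"
    by (rule Lim_transform_eventually)
      (auto simp: eventually_at_filter flat_exp_def exp_minus field_simps)
  moreover have "(flat_exp k \<longlongrightarrow> 0) (at_left 0)"
    by (rule Lim_transform_eventually[OF tendsto_const])
      (auto simp: eventually_at_filter flat_exp_def)
  ultimately show ?thesis by (simp add: filterlim_split_at)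
qed

lemma flat_exp_deriv:
  "(flat_exp k has_real_derivative flat_exp (k + 2) t - real k * flat_exp (k + 1) t) (at t)"
proof -
  consider "t > 0" | "t < 0" | "t = 0" by linarith
  then show ?thesis
  proof cases
    case 1
    have "((\<lambda>t. exp (- inverse t) * inverse t ^ k) has_real_derivative
        flat_exp (k + 2) t - real k * flat_exp (k + 1) t) (at t)"
    proof -
      have "t * t ^ (k - Suc 0) = t ^ k" if "k \<noteq> 0" using that by (cases k) auto
      then show ?thesis using 1
        by (cases "k = 0") (auto intro!: derivative_eq_intros simp: flat_exp_def field_simps power2_eq_square)
    qed
    then show ?thesis
      by (rule has_field_derivative_transform_within_open[of _ _ _ "{0<..}"]) (use 1 in \<open>auto simp: flat_exp_def\<close>)
  next
    case 2
    have "((\<lambda>t. 0) has_real_derivative flat_exp (k + 2) t - real k * flat_exp (k + 1) t) (at t)"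
      using 2 by (simp add: flat_exp_def)
    then show ?thesis
      by (rule has_field_derivative_transform_within_open[of _ _ _ "{..<0}"]) (use 2 in \<open>auto simp: flat_exp_def\<close>)
  next
    case 3
    \<comment> \<open>The difference quotient at 0 is \<open>flat_exp (Suc k)\<close>, which is why
      the limit at 0 was established for every exponent.\<close>
    have "((\<lambda>h. (flat_exp k (0 + h) - flat_exp k 0) / h) \<longlongrightarrow> 0) (at 0)"
      by (rule Lim_transform_eventually[OF flat_exp_tendsto_0[of "Suc k"]])
        (auto simp: eventually_at_filter flat_exp_def divide_inverse)
    then show ?thesis by (simp add: 3 DERIV_def flat_exp_def)
  qed
qed

text \<open>By \<open>flat_exp_deriv\<close> this algebra is closed under partial derivatives, hence
  consists of smooth functions. It contains the products of one-dimensional profiles that make up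
  bump functions on boxes.\<close>

inductive_set flat_algebra :: "('a::euclidean_space \<Rightarrow> real) set" where
  const: "(\<lambda>x. c) \<in> flat_algebra"
| flat: "(\<lambda>x. flat_exp k (s * (x \<bullet> v) + a)) \<in> flat_algebra"
| add: "f \<in> flat_algebra \<Longrightarrow> g \<in> flat_algebra \<Longrightarrow> (\<lambda>x. f x + g x) \<in> flat_algebra"
| mult: "f \<in> flat_algebra \<Longrightarrow> g \<in> flat_algebra \<Longrightarrow> (\<lambda>x. f x * g x) \<in> flat_algebra"

lemma flat_algebra_derivative:
  "f \<in> flat_algebra \<Longrightarrow> (\<forall>x. f differentiable (at x)) \<and> (\<forall>b. partial_deriv b f \<in> flat_algebra)"
proof (induction rule: flat_algebra.induct)
  case (const c)
  have "partial_deriv b (\<lambda>x. c) = (\<lambda>x. 0)" for b :: 'a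
    by (auto simp: partial_deriv_def)
  then show ?case by (simp add: flat_algebra.const)
next
  case (flat k s v a)
  have d: "((\<lambda>x. flat_exp k (s * (x \<bullet> v) + a)) has_derivative
      (\<lambda>h. s * (h \<bullet> v) * (flat_exp (k + 2) (s * (x \<bullet> v) + a) - real k * flat_exp (k + 1) (s * (x \<bullet> v) + a)))) (at x)" for x
  proof -
    have "((\<lambda>x. s * (x \<bullet> v) + a) has_derivative (\<lambda>h. s * (h \<bullet> v))) (at x)"
      by (auto intro!: derivative_eq_intros)
    from has_derivative_compose[OF this flat_exp_deriv[unfolded has_field_derivative_def]]
    show ?thesis by (simp add: mult.commute)
  qed
  have "partial_deriv b (\<lambda>x. flat_exp k (s * (x \<bullet> v) + a)) = (\<lambda>x. s * (b \<bullet> v) *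
      (flat_exp (k + 2) (s * (x \<bullet> v) + a) + (- real k) * flat_exp (k + 1) (s * (x \<bullet> v) + a)))" for b
    by (intro ext) (simp add: partial_deriv_eqI[OF d])
  then have "partial_deriv b (\<lambda>x. flat_exp k (s * (x \<bullet> v) + a)) \<in> flat_algebra" for b
    by (simp only:) (intro flat_algebra.intros)
  with d show ?case by (blast intro: differentiableI)
next
  case (add f g)
  then have d: "((\<lambda>x. f x + g x) has_derivative
      (\<lambda>h. frechet_derivative f (at x) h + frechet_derivative g (at x) h)) (at x)" for x
    by (intro has_derivative_add) (simp_all add: frechet_derivative_works[symmetric])
  have "partial_deriv b (\<lambda>x. f x + g x) = (\<lambda>x. partial_deriv b f x + partial_deriv b g x)" for b
    by (intro ext) (simp add: partial_deriv_eqI[OF d], simp add: partial_deriv_def)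
  moreover have "(\<lambda>x. partial_deriv b f x + partial_deriv b g x) \<in> flat_algebra" for b
    using add by (intro flat_algebra.add) auto
  ultimately show ?case using differentiableI[OF d] by simp
next
  case (mult f g)
  then have d: "((\<lambda>x. f x * g x) has_derivative
      (\<lambda>h. f x * frechet_derivative g (at x) h + frechet_derivative f (at x) h * g x)) (at x)" for x
    by (intro has_derivative_mult) (simp_all add: frechet_derivative_works[symmetric])
  have "partial_deriv b (\<lambda>x. f x * g x) = (\<lambda>x. f x * partial_deriv b g x + partial_deriv b f x * g x)" for b
    by (intro ext) (simp add: partial_deriv_eqI[OF d], simp add: partial_deriv_def)
  moreover have "(\<lambda>x. f x * partial_deriv b g x + partial_deriv b f x * g x) \<in> flat_algebra" for b
    using mult by (intro flat_algebra.add flat_algebra.mult) auto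
  ultimately show ?case using differentiableI[OF d] by simp
qed

lemma flat_algebra_smooth: "f \<in> flat_algebra \<Longrightarrow> smooth f"
  by (rule smooth_coinduct[of f flat_algebra]) (use flat_algebra_derivative in blast)+

text \<open>The scale steepens the edges, so that the bumps converge to the indicator of the open
  box while staying below 1. With \<open>Suc n\<close> the scale is never 0, and every bump is
  nonzero exactly on the box.\<close>

definition box_bump :: "'a::euclidean_space \<Rightarrow> 'a \<Rightarrow> nat \<Rightarrow> 'a \<Rightarrow> real" where
  "box_bump a b n x = (\<Prod>i\<in>Basis. flat_exp 0 (real (Suc n) * (x \<bullet> i - a \<bullet> i)) *
     flat_exp 0 (real (Suc n) * (b \<bullet> i - x \<bullet> i)))"

lemma flat_exp_0_bounds: "0 \<le> flat_exp 0 t" "flat_exp 0 t \<le> 1"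
  by (auto simp: flat_exp_def)

lemma box_bump_bounds: "0 \<le> box_bump a b n x" "box_bump a b n x \<le> 1"
  unfolding box_bump_def
  by (auto intro!: prod_nonneg prod_le_1 mult_le_one simp: flat_exp_0_bounds)

lemma box_bump_nonzero: "box_bump a b n x \<noteq> 0 \<longleftrightarrow> x \<in> box a b"
  by (auto simp: box_bump_def mem_box flat_exp_def zero_less_mult_iff)

lemma box_bump_tendsto: "(\<lambda>n. box_bump a b n x) \<longlonglongrightarrow> indicator (box a b) x"
proof (cases "x \<in> box a b")
  case True
  have lim: "(\<lambda>n. flat_exp 0 (real (Suc n) * c)) \<longlonglongrightarrow> 1" if "c > 0" for c
  proof -
    have "(\<lambda>n. inverse (real (Suc n)) * inverse c) \<longlonglongrightarrow> 0"
      using tendsto_mult_right[OF LIMSEQ_inverse_real_of_nat, of "inverse c"] by simp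
    then have "(\<lambda>n. exp (- (inverse (real (Suc n)) * inverse c))) \<longlonglongrightarrow> exp (- 0)"
      by (intro tendsto_intros)
    then show ?thesis using that by (simp add: flat_exp_def zero_less_mult_iff del: of_nat_Suc)
  qed
  have "(\<lambda>n. box_bump a b n x) \<longlonglongrightarrow> (\<Prod>i\<in>(Basis::'a set). 1 * 1)"
    unfolding box_bump_def using True
    by (intro tendsto_prod tendsto_mult lim) (auto simp: mem_box)
  with True show ?thesis by simp
next
  case False
  then have "(\<lambda>n. box_bump a b n x) = (\<lambda>n. 0)" using box_bump_nonzero[of a b _ x] by auto
  with False show ?thesis by simp
qed

lemma smooth_box_bump: "smooth (box_bump a b n)"
proof -
  have "(\<lambda>x. \<Prod>i\<in>A. flat_exp 0 (real (Suc n) * (x \<bullet> i - a \<bullet> i)) *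
     flat_exp 0 (real (Suc n) * (b \<bullet> i - x \<bullet> i))) \<in> flat_algebra" if "finite A" for A
    using that
  proof induction
    case empty
    then show ?case by (simp add: flat_algebra.const)
  next
    case (insert i A)
    have "(\<lambda>x. flat_exp 0 (real (Suc n) * (x \<bullet> i) + (- real (Suc n) * (a \<bullet> i)))) \<in> flat_algebra"
      "(\<lambda>x. flat_exp 0 (- real (Suc n) * (x \<bullet> i) + real (Suc n) * (b \<bullet> i))) \<in> flat_algebra"
      by (rule flat_algebra.flat)+
    then have "(\<lambda>x. flat_exp 0 (real (Suc n) * (x \<bullet> i - a \<bullet> i))) \<in> flat_algebra"
      "(\<lambda>x. flat_exp 0 (real (Suc n) * (b \<bullet> i - x \<bullet> i))) \<in> flat_algebra"
      by (simp_all only: right_diff_distrib) (simp_all add: algebra_simps del: of_nat_Suc)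
    with insert.IH show ?case
      unfolding prod.insert[OF insert.hyps] by (intro flat_algebra.mult)
  qed
  then show ?thesis
    unfolding box_bump_def[abs_def] by (intro flat_algebra_smooth) simp
qed

section \<open>Operations on test functions\<close>

lemma test_fun_smooth: "test_fun \<Omega> f \<Longrightarrow> smooth f"
  by (simp add: test_fun_def smooth_def)

lemma test_funI:
  assumes "smooth f" "{x. f x \<noteq> 0} \<subseteq> K" "compact K" "K \<subseteq> \<Omega>"
  shows "test_fun \<Omega> f"
proof -
  have "closure {x. f x \<noteq> 0} \<subseteq> K"
    using assms by (intro closure_minimal compact_imp_closed)
  moreover have "bounded {x. f x \<noteq> 0}" using assms bounded_subset compact_imp_bounded by blast
  ultimately show ?thesis using assms by (auto simp: test_fun_def smooth_def)
qed

lemma test_fun_support: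
  assumes "test_fun \<Omega> f"
  obtains K where "compact K" "K \<subseteq> \<Omega>" "{x. f x \<noteq> 0} \<subseteq> K"
  using assms closure_subset[of "{x. f x \<noteq> 0}"] unfolding test_fun_def by blast

lemma test_fun_box_bump: "cbox a b \<subseteq> \<Omega> \<Longrightarrow> test_fun \<Omega> (box_bump a b n)"
  by (rule test_funI[of _ "cbox a b"])
    (use box_subset_cbox[of a b] in \<open>auto simp: smooth_box_bump box_bump_nonzero\<close>)

text \<open>Off a compact set containing the support, the function vanishes on an open set, so its
  derivatives vanish there too and the same compact set works.\<close>

lemma test_fun_partial_deriv:
  assumes f: "test_fun \<Omega> f" and b: "b \<in> Basis"
  shows "test_fun \<Omega> (partial_deriv b f)"
proof -
  obtain K where K: "compact K" "K \<subseteq> \<Omega>" "{x. f x \<noteq> 0} \<subseteq> K" by (rule test_fun_support[OF f])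
  have "partial_deriv b f x = 0" if "x \<notin> K" for x
  proof -
    have "open (- K)" using K(1) by (simp add: compact_imp_closed open_Compl)
    moreover have "((\<lambda>x. 0) has_derivative (\<lambda>h. 0)) (at x)" by simp
    ultimately have "(f has_derivative (\<lambda>h. 0)) (at x)"
      using that K(3) by (intro has_derivative_transform_within_open[of "\<lambda>x. 0" _ x UNIV "- K" f]) auto
    from partial_deriv_eqI[OF this] show ?thesis .
  qed
  then show ?thesis
    using K by (intro test_funI[of _ K] smooth_partial_deriv test_fun_smooth[OF f] b) auto
qed

lemma test_fun_multi_deriv:
  assumes "test_fun \<Omega> f" shows "test_fun \<Omega> (multi_deriv \<alpha> f)"
proof -
  have "test_fun \<Omega> (foldr partial_deriv bs f)" if "set bs \<subseteq> Basis" for bs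
    using that by (induction bs) (auto intro: assms test_fun_partial_deriv)
  then show ?thesis by (simp add: multi_deriv_eq_foldr set_index_list)
qed

lemma test_fun_tensor:
  assumes f: "test_fun A f" and g: "test_fun B g"
  shows "test_fun (A \<times> B) (tensor f g)"
proof -
  obtain K where K: "compact K" "K \<subseteq> A" "{x. f x \<noteq> 0} \<subseteq> K" by (rule test_fun_support[OF f])
  obtain L where L: "compact L" "L \<subseteq> B" "{x. g x \<noteq> 0} \<subseteq> L" by (rule test_fun_support[OF g])
  show ?thesis
  proof (rule test_funI)
    show "smooth (tensor f g)" by (intro smooth_tensor test_fun_smooth[OF f] test_fun_smooth[OF g])
    show "compact (K \<times> L)" by (intro compact_Times K L)
  qed (use K L in \<open>auto simp: tensor_def\<close>)
qed

lemma test_fun_section1: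
  assumes f: "test_fun (A \<times> B) f" shows "test_fun A (\<lambda>x. f (x, y))"
proof -
  obtain K where K: "compact K" "K \<subseteq> A \<times> B" "{x. f x \<noteq> 0} \<subseteq> K" by (rule test_fun_support[OF f])
  have "compact (fst ` K)" by (intro compact_continuous_image continuous_intros K)
  with K show ?thesis
    by (intro test_funI[of _ "fst ` K"] smooth_section1 test_fun_smooth[OF f]) force+
qed

lemma test_fun_section2:
  assumes f: "test_fun (A \<times> B) f" shows "test_fun B (\<lambda>y. f (x, y))"
proof -
  obtain K where K: "compact K" "K \<subseteq> A \<times> B" "{x. f x \<noteq> 0} \<subseteq> K" by (rule test_fun_support[OF f])
  have "compact (snd ` K)" by (intro compact_continuous_image continuous_intros K)
  with K show ?thesis
    by (intro test_funI[of _ "snd ` K"] smooth_section2 test_fun_smooth[OF f]) force+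
qed

lemma test_fun_bounded:
  assumes f: "test_fun \<Omega> f"
  shows "\<exists>C. \<forall>x. \<bar>f x\<bar> \<le> C"
proof -
  obtain K where K: "compact K" "K \<subseteq> \<Omega>" "{x. f x \<noteq> 0} \<subseteq> K" by (rule test_fun_support[OF f])
  have "compact (f ` K)"
    by (intro compact_continuous_image smooth_continuous_on test_fun_smooth[OF f] K)
  then obtain C where C: "\<And>y. y \<in> f ` K \<Longrightarrow> \<bar>y\<bar> \<le> C"
    using compact_imp_bounded bounded_real by metis
  have "\<bar>f x\<bar> \<le> \<bar>C\<bar>" for x
    using C[of "f x"] K(3) by (cases "f x = 0") force+
  then show ?thesis by blast
qed

section \<open>Weak derivatives on bounded domains\<close>

text \<open>The closed boxes have to lie inside as well: local integrability and the bump functions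
  speak about compact subsets of the domain.\<close>

lemma open_countable_box_cover:
  fixes \<Omega> :: "'a::euclidean_space set"
  assumes "open \<Omega>"
  obtains F where "countable F" "\<Union>F = \<Omega>" "\<forall>X\<in>F. \<exists>a b. X = box a b \<and> cbox a b \<subseteq> \<Omega>"
proof -
  let ?G = "{X. \<exists>a b. X = box a b \<and> cbox a b \<subseteq> \<Omega>}"
  obtain F where F: "F \<subseteq> ?G" "countable F" "\<Union>F = \<Union>?G"
  proof (rule Lindelof)
    show "open X" if "X \<in> ?G" for X using that by auto
  qed
  have "\<Omega> \<subseteq> \<Union>?G"
  proof
    fix x assume "x \<in> \<Omega>"
    then obtain a b where "cbox a b \<subseteq> \<Omega>" "x \<in> box a b"
      by (rule open_contains_cbox[OF assms])
    then show "x \<in> \<Union>?G" by blast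
  qed
  moreover have "\<Union>?G \<subseteq> \<Omega>" using box_subset_cbox by blast
  ultimately have "\<Union>F = \<Omega>" using F(3) by simp
  with F show ?thesis by (intro that[of F]) auto
qed

lemma integrable_lborel_on:
  fixes f :: "'a::euclidean_space \<Rightarrow> real"
  shows "open \<Omega> \<Longrightarrow> integrable (lborel_on \<Omega>) f \<longleftrightarrow> set_integrable lborel \<Omega> f"
  by (simp add: integrable_restrict_space set_integrable_def)

lemma integral_lborel_on:
  fixes f :: "'a::euclidean_space \<Rightarrow> real"
  shows "open \<Omega> \<Longrightarrow> (\<integral>x. f x \<partial>lborel_on \<Omega>) = (\<integral>x. indicator \<Omega> x * f x \<partial>lborel)"
  by (simp add: integral_restrict_space)

text \<open>Local integrability gives measurability only on compact sets; a countable cover by boxes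
  glues these pieces. The lemma is needed for the representatives selected by
  \<open>weak_deriv\<close>.\<close>

lemma locally_integrable_measurable:
  fixes f :: "'a::euclidean_space \<Rightarrow> real"
  assumes \<Omega>: "open \<Omega>" and f: "locally_integrable \<Omega> f"
  shows "f \<in> borel_measurable (lborel_on \<Omega>)"
proof -
  obtain F where F: "countable F" "\<Union>F = \<Omega>" "\<forall>X\<in>F. \<exists>a b. X = box a b \<and> cbox a b \<subseteq> \<Omega>"
    by (rule open_countable_box_cover[OF \<Omega>])
  show ?thesis
  proof (rule measurable_piecewise_restrict[OF F(1)])
    show "space (lborel_on \<Omega>) \<subseteq> \<Union>F" using F(2) by (simp add: space_restrict_space)
    fix X assume X: "X \<in> F"
    then obtain a b where ab: "X = box a b" "cbox a b \<subseteq> \<Omega>" using F(3) by blast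
    show "X \<inter> space (lborel_on \<Omega>) \<in> sets (lborel_on \<Omega>)"
      using ab box_subset_cbox[of a b] \<Omega> by (auto simp: space_restrict_space sets_restrict_space_iff)
    have "set_integrable lborel (cbox a b) f"
      using f ab unfolding locally_integrable_def by (simp add: compact_cbox)
    then have "set_integrable lborel (box a b) f"
      by (rule set_integrable_subset) (auto simp: box_subset_cbox)
    then have "(\<lambda>x. indicator X x *\<^sub>R f x) \<in> borel_measurable lborel"
      unfolding set_integrable_def ab by (rule borel_measurable_integrable)
    then have "f \<in> borel_measurable (restrict_space lborel X)"
      by (subst borel_measurable_restrict_space_iff) (auto simp: ab)
    moreover have "restrict_space (lborel_on \<Omega>) X = restrict_space lborel X"
      using ab box_subset_cbox[of a b] \<Omega> by (subst restrict_restrict_space) (auto simp: Int_absorb1)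
    ultimately show "f \<in> borel_measurable (restrict_space (lborel_on \<Omega>) X)" by simp
  qed
qed

lemma locally_integrable_mult_test_fun:
  assumes \<Omega>: "open \<Omega>" and f: "locally_integrable \<Omega> f" and \<phi>: "test_fun \<Omega> \<phi>"
  shows "integrable (lborel_on \<Omega>) (\<lambda>x. f x * \<phi> x)"
proof -
  obtain K where K: "compact K" "K \<subseteq> \<Omega>" "{x. \<phi> x \<noteq> 0} \<subseteq> K" by (rule test_fun_support[OF \<phi>])
  obtain C where C: "\<forall>x. \<bar>\<phi> x\<bar> \<le> C" using test_fun_bounded[OF \<phi>] by blast
  have [measurable]: "\<phi> \<in> borel_measurable borel" by (rule smooth_borel_measurable[OF test_fun_smooth[OF \<phi>]])
  have i: "integrable lborel (\<lambda>x. indicator K x * f x)"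
    using f K unfolding locally_integrable_def set_integrable_def by simp
  have eq: "(\<lambda>x. indicator \<Omega> x *\<^sub>R (f x * \<phi> x)) = (\<lambda>x. \<phi> x * (indicator K x * f x))"
    using K(2,3) by (intro ext) (auto simp: indicator_def)
  have "integrable lborel (\<lambda>x. \<phi> x * (indicator K x * f x))"
  proof (rule Bochner_Integration.integrable_bound)
    show "integrable lborel (\<lambda>x. C * (indicator K x * f x))" using i by simp
    have [measurable]: "(\<lambda>x. indicator K x * f x) \<in> borel_measurable lborel" using i by auto
    show "(\<lambda>x. \<phi> x * (indicator K x * f x)) \<in> borel_measurable lborel" by measurable
    have "\<bar>\<phi> x\<bar> * \<bar>indicator K x * f x\<bar> \<le> \<bar>C\<bar> * \<bar>indicator K x * f x\<bar>" for x
      using C by (intro mult_right_mono) (auto intro: order_trans)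
    then show "AE x in lborel. norm (\<phi> x * (indicator K x * f x)) \<le> norm (C * (indicator K x * f x))"
      by (simp add: abs_mult)
  qed
  moreover have "integrable (lborel_on \<Omega>) (\<lambda>x. f x * \<phi> x)
      \<longleftrightarrow> integrable lborel (\<lambda>x. indicator \<Omega> x *\<^sub>R (f x * \<phi> x))"
    by (rule integrable_restrict_space) (use \<Omega> in simp)
  ultimately show ?thesis unfolding eq by simp
qed

text \<open>The fundamental lemma of the calculus of variations. Bumps converge dominatedly to
  indicators of boxes, so the integrals of \<open>g\<close> over boxes vanish; boxes form an
  intersection-stable generator of the Borel sets.\<close>

lemma test_fun_orthogonal_AE_zero:
  fixes g :: "'a::euclidean_space \<Rightarrow> real"
  assumes \<Omega>: "open \<Omega>" and g: "locally_integrable \<Omega> g"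
    and zero: "\<And>\<phi>. test_fun \<Omega> \<phi> \<Longrightarrow> (\<integral>x. g x * \<phi> x \<partial>lborel_on \<Omega>) = 0"
  shows "AE x in lborel_on \<Omega>. g x = 0"
proof -
  have int: "integrable lborel (\<lambda>x. indicator (cbox c d) x * g x)" if "cbox c d \<subseteq> \<Omega>" for c d
    using g that unfolding locally_integrable_def set_integrable_def by (simp add: compact_cbox)
  have int_box: "integrable lborel (\<lambda>x. indicator (box c d) x * g x)" if "cbox c d \<subseteq> \<Omega>" for c d
  proof -
    have "set_integrable lborel (cbox c d) g" using int[OF that] by (simp add: set_integrable_def)
    then have "set_integrable lborel (box c d) g"
      by (rule set_integrable_subset) (auto simp: box_subset_cbox)
    then show ?thesis by (simp add: set_integrable_def)
  qed
  have box0: "(\<integral>x. indicator (box c d) x * g x \<partial>lborel) = 0" if "cbox c d \<subseteq> \<Omega>" for c d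
  proof -
    have "(\<lambda>n. \<integral>x. indicator \<Omega> x * (g x * box_bump c d n x) \<partial>lborel)
        \<longlonglongrightarrow> (\<integral>x. indicator (box c d) x * g x \<partial>lborel)"
    proof (rule integral_dominated_convergence)
      show m: "(\<lambda>x. indicator (box c d) x * g x) \<in> borel_measurable lborel"
        by (rule borel_measurable_integrable[OF int_box[OF that]])
      show "(\<lambda>x. indicator \<Omega> x * (g x * box_bump c d n x)) \<in> borel_measurable lborel" for n
        using locally_integrable_mult_test_fun[OF \<Omega> g test_fun_box_bump[OF that, of n]] \<Omega>
        by (simp add: integrable_restrict_space borel_measurable_integrable)
      show "integrable lborel (\<lambda>x. \<bar>indicator (box c d) x * g x\<bar>)" using int_box[OF that] by simp
      show "AE x in lborel. (\<lambda>n. indicator \<Omega> x * (g x * box_bump c d n x)) \<longlonglongrightarrow> indicator (box c d) x * g x"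
      proof (rule AE_I2)
        fix x
        have "(\<lambda>n. indicator \<Omega> x * (g x * box_bump c d n x)) \<longlonglongrightarrow> indicator \<Omega> x * (g x * indicator (box c d) x)"
          by (intro tendsto_intros box_bump_tendsto)
        moreover have "indicator \<Omega> x * (g x * indicator (box c d) x) = indicator (box c d) x * g x"
          using that box_subset_cbox[of c d] by (auto simp: indicator_def)
        ultimately show "(\<lambda>n. indicator \<Omega> x * (g x * box_bump c d n x)) \<longlonglongrightarrow> indicator (box c d) x * g x"
          by simp
      qed
      have "\<bar>indicator \<Omega> x * (g x * box_bump c d n x)\<bar> \<le> \<bar>indicator (box c d) x * g x\<bar>" for n x
      proof (cases "x \<in> box c d")
        case True
        have "\<bar>g x\<bar> * box_bump c d n x \<le> \<bar>g x\<bar> * 1"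
          using box_bump_bounds by (intro mult_left_mono) auto
        with True show ?thesis by (auto simp: indicator_def abs_mult box_bump_bounds)
      next
        case False
        then have "box_bump c d n x = 0" using box_bump_nonzero[of c d n x] by simp
        then show ?thesis by simp
      qed
      then show "AE x in lborel. norm (indicator \<Omega> x * (g x * box_bump c d n x)) \<le> \<bar>indicator (box c d) x * g x\<bar>" for n
        by simp
    qed
    moreover have "(\<integral>x. indicator \<Omega> x * (g x * box_bump c d n x) \<partial>lborel) = 0" for n
      using zero[OF test_fun_box_bump[OF that, of n]] \<Omega> by (simp add: integral_lborel_on)
    ultimately have "(\<lambda>n. 0) \<longlonglongrightarrow> (\<integral>x. indicator (box c d) x * g x \<partial>lborel)" by simp
    from LIMSEQ_unique[OF this tendsto_const] show ?thesis .
  qed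
  \<comment> \<open>The generator argument needs an integrable function, so it is run on one box
    with compact closure in the domain at a time.\<close>
  have local: "AE x in lborel. indicator (box a b) x * g x = 0" if ab: "cbox a b \<subseteq> \<Omega>" for a b
  proof (rule lborel.AE_zero_if_generator_integrals_zero)
    let ?E = "range (\<lambda>(c, d). box c d :: 'a set)"
    show "integrable lborel (\<lambda>x. indicator (box a b) x * g x)" by (rule int_box[OF ab])
    show "Int_stable ?E" by (auto simp: Int_stable_def box_Int_box)
    show "?E \<subseteq> Pow (space lborel)" "sets lborel = sigma_sets (space lborel) ?E"
      by (simp_all add: borel_eq_box)
    show "(\<integral>x. indicator (box a b) x * g x \<partial>lborel) = 0" by (rule box0[OF ab])
    fix A assume "A \<in> ?E"
    then obtain c d where "A = box c d" by auto
    then obtain c' d' where cd: "A \<inter> box a b = box c' d'" by (auto simp: box_Int_box)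
    have "(\<integral>x\<in>A. indicator (box a b) x * g x \<partial>lborel) = (\<integral>x. indicator (box c' d') x * g x \<partial>lborel)"
      unfolding set_lebesgue_integral_def cd[symmetric]
      by (rule Bochner_Integration.integral_cong) (auto simp: indicator_def)
    also have "\<dots> = 0"
    \<comment> \<open>An empty open box may still have a nonempty closed box outside the domain;
      only for a nonempty one is \<open>cbox c' d'\<close> its closure.\<close>
    proof (cases "box c' d' = {}")
      case False
      have "box c' d' \<subseteq> cbox a b" using cd box_subset_cbox[of a b] by blast
      then have "closure (box c' d') \<subseteq> cbox a b" by (intro closure_minimal) auto
      then have "cbox c' d' \<subseteq> \<Omega>" using closure_box[OF False] ab by simp
      then show ?thesis by (rule box0)
    qed simp
    finally show "(\<integral>x\<in>A. indicator (box a b) x * g x \<partial>lborel) = 0" .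
  qed
  obtain F where F: "countable F" "\<Union>F = \<Omega>" "\<forall>X\<in>F. \<exists>a b. X = box a b \<and> cbox a b \<subseteq> \<Omega>"
    by (rule open_countable_box_cover[OF \<Omega>])
  have "\<forall>X\<in>F. AE x in lborel. indicator X x * g x = 0"
  proof
    fix X assume "X \<in> F"
    then obtain a b where "X = box a b" "cbox a b \<subseteq> \<Omega>" using F(3) by blast
    then show "AE x in lborel. indicator X x * g x = 0" using local[of a b] by simp
  qed
  then have "AE x in lborel. \<forall>X\<in>F. indicator X x * g x = 0"
    by (subst AE_ball_countable[OF F(1)])
  then have "AE x in lborel. x \<in> \<Omega> \<longrightarrow> g x = 0"
    by eventually_elim (use F(2) in \<open>auto simp: indicator_def\<close>)
  then show ?thesis using \<Omega> by (subst AE_restrict_space_iff) auto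
qed

lemma has_weak_deriv_unique:
  assumes \<Omega>: "open \<Omega>" and g: "has_weak_deriv \<Omega> \<alpha> f g" and g': "has_weak_deriv \<Omega> \<alpha> f g'"
  shows "AE x in lborel_on \<Omega>. g x = g' x"
proof -
  have loc: "locally_integrable \<Omega> g" "locally_integrable \<Omega> g'" using g g' by (auto simp: has_weak_deriv_def)
  have "AE x in lborel_on \<Omega>. g x - g' x = 0"
  proof (rule test_fun_orthogonal_AE_zero[OF \<Omega>])
    show "locally_integrable \<Omega> (\<lambda>x. g x - g' x)"
      using loc unfolding locally_integrable_def by (auto intro: set_integral_diff(1))
    fix \<phi> assume \<phi>: "test_fun \<Omega> \<phi>"
    have "(-1) ^ multi_order \<alpha> * (\<integral>x. g x * \<phi> x \<partial>lborel_on \<Omega>) = (-1) ^ multi_order \<alpha> * (\<integral>x. g' x * \<phi> x \<partial>lborel_on \<Omega>)"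
      using g g' \<phi> unfolding has_weak_deriv_def by metis
    then have "(\<integral>x. g x * \<phi> x \<partial>lborel_on \<Omega>) = (\<integral>x. g' x * \<phi> x \<partial>lborel_on \<Omega>)" by simp
    then show "(\<integral>x. (g x - g' x) * \<phi> x \<partial>lborel_on \<Omega>) = 0"
      using locally_integrable_mult_test_fun[OF \<Omega> loc(1) \<phi>] locally_integrable_mult_test_fun[OF \<Omega> loc(2) \<phi>]
      by (simp add: left_diff_distrib)
  qed
  then show ?thesis by eventually_elim simp
qed

section \<open>Weak derivatives of L2 functions on a bounded domain\<close>

locale bounded_domain =
  fixes \<Omega> :: "'a::euclidean_space set"
  assumes open_dom: "open \<Omega>" and bounded_dom: "bounded \<Omega>"

sublocale bounded_domain \<subseteq> D: finite_measure "lborel_on \<Omega>"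
proof
  have "emeasure lborel \<Omega> < \<infinity>" using bounded_dom by (rule emeasure_bounded_finite)
  then show "emeasure (lborel_on \<Omega>) (space (lborel_on \<Omega>)) \<noteq> \<infinity>"
    using open_dom by (simp add: space_restrict_space emeasure_restrict_space)
qed

context bounded_domain
begin

abbreviation "M \<equiv> lborel_on \<Omega>"

lemma L2_eq: "L2 \<Omega> = sq_int M"
  by (auto simp: L2_def L2_norm_sq_def nn_integral_eq_ip intro: sq_intI_nn_integral)

lemma L2_norm_sq_eq: "f \<in> sq_int M \<Longrightarrow> L2_norm_sq \<Omega> f = ennreal (ip M f f)"
  by (simp add: L2_norm_sq_def nn_integral_eq_ip)

lemma sq_int_locally_integrable:
  assumes "f \<in> sq_int M" shows "locally_integrable \<Omega> f"
  unfolding locally_integrable_def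
proof (intro allI impI)
  fix K assume K: "compact K \<and> K \<subseteq> \<Omega>"
  have "set_integrable lborel \<Omega> f"
    using D.sq_int_integrable[OF assms] integrable_lborel_on[OF open_dom] by simp
  then show "set_integrable lborel K f"
    by (rule set_integrable_subset) (use K in \<open>auto intro: borel_compact\<close>)
qed

lemma test_fun_sq_int:
  assumes \<phi>: "test_fun \<Omega> \<phi>" shows "\<phi> \<in> sq_int M"
proof (rule sq_intI)
  obtain C where C: "\<forall>x. \<bar>\<phi> x\<bar> \<le> C" using test_fun_bounded[OF \<phi>] by blast
  have m: "\<phi> \<in> borel_measurable borel" by (rule smooth_borel_measurable[OF test_fun_smooth[OF \<phi>]])
  then show m': "\<phi> \<in> borel_measurable M" by (simp add: measurable_restrict_space1)
  have "(\<phi> x)\<^sup>2 \<le> C\<^sup>2" for x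
    using power_mono[OF C[rule_format, of x], of 2] by simp
  then show "integrable M (\<lambda>x. (\<phi> x)\<^sup>2)"
    using m' by (intro D.integrable_const_bound[of _ "C\<^sup>2"]) auto
qed

lemma test_fun_multi_deriv_sq_int: "test_fun \<Omega> \<phi> \<Longrightarrow> multi_deriv \<alpha> \<phi> \<in> sq_int M"
  by (intro test_fun_sq_int test_fun_multi_deriv)

text \<open>On a bounded domain L2 functions are integrable, so the local integrability clauses are
  automatic and only an identity between inner products remains.\<close>

lemma has_weak_deriv_iff:
  assumes "f \<in> sq_int M" "g \<in> sq_int M"
  shows "has_weak_deriv \<Omega> \<alpha> f g \<longleftrightarrow> (\<forall>\<phi>. test_fun \<Omega> \<phi> \<longrightarrow>
    ip M f (multi_deriv \<alpha> \<phi>) = (-1) ^ multi_order \<alpha> * ip M g \<phi>)"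
  using assms by (simp add: has_weak_deriv_def ip_def sq_int_locally_integrable)

lemma has_weak_deriv_zero_index:
  "f \<in> sq_int M \<Longrightarrow> has_weak_deriv \<Omega> (\<lambda>_. 0) f f"
  by (simp add: has_weak_deriv_iff)

lemma has_weak_deriv_combination:
  assumes "f \<in> sq_int M" "g \<in> sq_int M"
    "f' \<in> sq_int M" "g' \<in> sq_int M"
    "has_weak_deriv \<Omega> \<alpha> f f'" "has_weak_deriv \<Omega> \<alpha> g g'"
  shows "has_weak_deriv \<Omega> \<alpha> (\<lambda>x. a * f x + b * g x) (\<lambda>x. a * f' x + b * g' x)"
proof (subst has_weak_deriv_iff)
  show "\<forall>\<phi>. test_fun \<Omega> \<phi> \<longrightarrow> ip M (\<lambda>x. a * f x + b * g x) (multi_deriv \<alpha> \<phi>)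
      = (-1) ^ multi_order \<alpha> * ip M (\<lambda>x. a * f' x + b * g' x) \<phi>"
  proof (intro allI impI)
    fix \<phi> assume \<phi>: "test_fun \<Omega> \<phi>"
    show "ip M (\<lambda>x. a * f x + b * g x) (multi_deriv \<alpha> \<phi>)
      = (-1) ^ multi_order \<alpha> * ip M (\<lambda>x. a * f' x + b * g' x) \<phi>"
      using assms \<phi> test_fun_sq_int[OF \<phi>] test_fun_multi_deriv_sq_int[OF \<phi>, of \<alpha>]
      by (simp add: has_weak_deriv_iff ip_add_left algebra_simps)
  qed
qed (use assms in simp_all)

lemma has_weak_deriv_cong_AE:
  assumes "f \<in> sq_int M" "g \<in> sq_int M"
    "f' \<in> sq_int M" "g' \<in> sq_int M"
    "AE x in M. f x = g x" "AE x in M. f' x = g' x"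
    and d: "has_weak_deriv \<Omega> \<alpha> f f'"
  shows "has_weak_deriv \<Omega> \<alpha> g g'"
proof -
  have "ip M f (multi_deriv \<alpha> \<phi>) = ip M g (multi_deriv \<alpha> \<phi>)"
    "ip M f' \<phi> = ip M g' \<phi>" if \<phi>: "test_fun \<Omega> \<phi>" for \<phi>
    using assms test_fun_sq_int[OF \<phi>] test_fun_multi_deriv_sq_int[OF \<phi>, of \<alpha>]
    by (intro ip_cong_AE; simp)+
  with d show ?thesis using assms(1-4) by (simp add: has_weak_deriv_iff)
qed

text \<open>Weak differentiation is a closed operation: for a fixed test function both sides of the
  defining identity are continuous in L2.\<close>

lemma has_weak_deriv_limit:
  assumes F: "\<And>n. F n \<in> sq_int M" and F': "\<And>n. F' n \<in> sq_int M"
    and f: "f \<in> sq_int M" and f': "f' \<in> sq_int M"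
    and d: "\<And>n. has_weak_deriv \<Omega> \<alpha> (F n) (F' n)"
    and lim: "(\<lambda>n. nrm M (\<lambda>x. F n x - f x)) \<longlonglongrightarrow> 0"
    and lim': "(\<lambda>n. nrm M (\<lambda>x. F' n x - f' x)) \<longlonglongrightarrow> 0"
  shows "has_weak_deriv \<Omega> \<alpha> f f'"
  unfolding has_weak_deriv_iff[OF f f']
proof (intro allI impI)
  fix \<phi> assume \<phi>: "test_fun \<Omega> \<phi>"
  have "(\<lambda>n. ip M (F n) (multi_deriv \<alpha> \<phi>)) \<longlonglongrightarrow> ip M f (multi_deriv \<alpha> \<phi>)"
    by (rule ip_tendsto[OF F f test_fun_multi_deriv_sq_int[OF \<phi>] lim])
  moreover have "ip M (F n) (multi_deriv \<alpha> \<phi>) = (-1) ^ multi_order \<alpha> * ip M (F' n) \<phi>" for n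
    using d[of n] \<phi> unfolding has_weak_deriv_iff[OF F F'] by simp
  moreover have "(\<lambda>n. (-1) ^ multi_order \<alpha> * ip M (F' n) \<phi>)
      \<longlonglongrightarrow> (-1) ^ multi_order \<alpha> * ip M f' \<phi>"
    by (intro tendsto_intros ip_tendsto[OF F' f' test_fun_sq_int[OF \<phi>] lim'])
  ultimately show "ip M f (multi_deriv \<alpha> \<phi>) = (-1) ^ multi_order \<alpha> * ip M f' \<phi>"
    by (simp add: LIMSEQ_unique)
qed

lemma weak_deriv_eq:
  assumes g: "has_weak_deriv \<Omega> \<alpha> f g"
  shows "has_weak_deriv \<Omega> \<alpha> f (weak_deriv \<Omega> \<alpha> f)" "AE x in M. weak_deriv \<Omega> \<alpha> f x = g x"
proof -
  show w: "has_weak_deriv \<Omega> \<alpha> f (weak_deriv \<Omega> \<alpha> f)"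
    unfolding weak_deriv_def by (rule someI[of "has_weak_deriv \<Omega> \<alpha> f", OF g])
  show "AE x in M. weak_deriv \<Omega> \<alpha> f x = g x"
    by (rule has_weak_deriv_unique[OF open_dom w g])
qed

text \<open>The selected representative is known only to be some weak derivative. Its measurability
  comes from local integrability, and its square-integrability from agreeing almost everywhere with
  \<open>g\<close>.\<close>

lemma weak_deriv_sq_int:
  assumes g: "has_weak_deriv \<Omega> \<alpha> f g" and "g \<in> sq_int M"
  shows "weak_deriv \<Omega> \<alpha> f \<in> sq_int M"
proof (rule sq_int_AE_eq[OF assms(2)])
  show "weak_deriv \<Omega> \<alpha> f \<in> borel_measurable M"
    using weak_deriv_eq(1)[OF g] by (intro locally_integrable_measurable open_dom) (simp add: has_weak_deriv_def)
  show "AE x in M. g x = weak_deriv \<Omega> \<alpha> f x"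
    using weak_deriv_eq(2)[OF g] by eventually_elim simp
qed

end

text \<open>Identifies the measure in which Fubini's theorem is used with the one in which weak
  derivatives on the product domain are defined.\<close>

lemma lborel_on_Times:
  fixes A :: "'a::euclidean_space set" and B :: "'b::euclidean_space set"
  assumes A: "open A" and B: "open B"
  shows "lborel_on A \<Otimes>\<^sub>M lborel_on B = lborel_on (A \<times> B)"
proof (rule pair_measure_eqI)
  show "sigma_finite_measure (lborel_on A)" "sigma_finite_measure (lborel_on B)"
    using A B by (auto intro!: sigma_finite_measure_restrict_space lborel.sigma_finite_measure_axioms)
  have AB: "A \<times> B \<in> sets lborel" using open_Times[OF A B] by simp
  show eq: "sets (lborel_on A \<Otimes>\<^sub>M lborel_on B) = sets (lborel_on (A \<times> B))"
  proof
    have "{a \<times> b |a b. a \<in> sets (lborel_on A) \<and> b \<in> sets (lborel_on B)} \<subseteq> sets (lborel_on (A \<times> B))"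
    proof clarify
      fix a b assume "a \<in> sets (lborel_on A)" "b \<in> sets (lborel_on B)"
      then have "a \<subseteq> A" "a \<in> sets lborel" "b \<subseteq> B" "b \<in> sets lborel"
        using A B by (auto simp: sets_restrict_space_iff)
      then have "a \<times> b \<in> sets lborel" "a \<times> b \<subseteq> A \<times> B"
        using pair_measureI[of a lborel b lborel, unfolded lborel_prod] Sigma_mono[of a A "\<lambda>_. b" "\<lambda>_. B"]
        by simp_all
      then show "a \<times> b \<in> sets (lborel_on (A \<times> B))"
        using AB by (subst sets_restrict_space_iff) simp_all
    qed
    then show "sets (lborel_on A \<Otimes>\<^sub>M lborel_on B) \<subseteq> sets (lborel_on (A \<times> B))"
      unfolding sets_pair_measure
      using sets.sigma_sets_subset[of _ "lborel_on (A \<times> B)"]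
      by (simp add: space_restrict_space)
    show "sets (lborel_on (A \<times> B)) \<subseteq> sets (lborel_on A \<Otimes>\<^sub>M lborel_on B)"
    proof
      fix X assume "X \<in> sets (lborel_on (A \<times> B))"
      then have X: "X \<subseteq> A \<times> B" and "X \<in> sets lborel"
        using AB by (auto simp: sets_restrict_space_iff)
      from this(2) have XP: "X \<in> sets (lborel \<Otimes>\<^sub>M lborel)"
        unfolding lborel_prod .
      have idm: "(\<lambda>x. x) \<in> lborel_on C \<rightarrow>\<^sub>M lborel" for C :: "'c::euclidean_space set"
        by (rule measurable_restrict_space1) simp
      have "(\<lambda>p. (fst p, snd p)) \<in> lborel_on A \<Otimes>\<^sub>M lborel_on B \<rightarrow>\<^sub>M lborel \<Otimes>\<^sub>M lborel"
        using measurable_compose[OF measurable_fst[of "lborel_on A" "lborel_on B"] idm[of A]]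
          measurable_compose[OF measurable_snd[of "lborel_on A" "lborel_on B"] idm[of B]]
        by (rule measurable_Pair)
      from measurable_sets[OF this XP] X
      show "X \<in> sets (lborel_on A \<Otimes>\<^sub>M lborel_on B)"
        by (simp add: space_pair_measure space_restrict_space Int_absorb2 vimage_def)
    qed
  qed
  fix a b assume "a \<in> sets (lborel_on A)" "b \<in> sets (lborel_on B)"
  then have ab: "a \<subseteq> A" "a \<in> sets lborel" "b \<subseteq> B" "b \<in> sets lborel"
    using A B by (auto simp: sets_restrict_space_iff)
  have "emeasure (lborel_on (A \<times> B)) (a \<times> b) = emeasure lborel (a \<times> b)"
    using AB ab by (intro emeasure_restrict_space) auto
  also have "\<dots> = emeasure lborel a * emeasure lborel b"
    unfolding lborel_prod[symmetric] using ab by (intro lborel.emeasure_pair_measure_Times) auto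
  finally show "emeasure (lborel_on A) a * emeasure (lborel_on B) b = emeasure (lborel_on (A \<times> B)) (a \<times> b)"
    using A B ab by (simp add: emeasure_restrict_space)
qed

section \<open>Finite families of functions on a measure space\<close>

text \<open>A finite family of functions on \<open>M\<close>, viewed as one function on \<open>A \<times> M\<close>.\<close>

definition stack :: "'i set \<Rightarrow> 'a measure \<Rightarrow> ('i \<times> 'a) measure" where
  "stack A M = count_space A \<Otimes>\<^sub>M M"

text \<open>Reduces inner products of families and of block kernels to squared norms, which are
  nonnegative integrals and split into components without integrability conditions.\<close>

lemma ip_polarization:
  assumes [simp]: "f \<in> sq_int M" "g \<in> sq_int M"
  shows "4 * ip M f g = ip M (\<lambda>x. f x + g x) (\<lambda>x. f x + g x) - ip M (\<lambda>x. f x - g x) (\<lambda>x. f x - g x)"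
  by (simp add: ip_add_left ip_add_right ip_diff_left ip_diff_right ip_commute[of M g f])

lemma finite_measure_stack:
  assumes "finite A" "finite_measure M"
  shows "finite_measure (stack A M)"
  unfolding stack_def
  by (rule finite_measure_pair_measure[OF assms(2) finite_measure_count_space[OF assms(1)]])

lemma measurable_stack:
  assumes "finite A" "\<And>i. i \<in> A \<Longrightarrow> (\<lambda>x. F (i, x)) \<in> borel_measurable M"
  shows "F \<in> borel_measurable (stack A M)"
  unfolding stack_def
  by (rule measurable_pair_measure_countable1) (use assms in \<open>auto intro: countable_finite\<close>)

lemma measurable_stack_component:
  assumes "F \<in> borel_measurable (stack A M)" "i \<in> A"
  shows "(\<lambda>x. F (i, x)) \<in> borel_measurable M"
  by (rule measurable_compose[OF measurable_Pair1' assms(1)[unfolded stack_def]]) (use assms(2) in simp)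

lemma nn_integral_stack:
  assumes A: "finite A" and M: "finite_measure M" and F: "F \<in> borel_measurable (stack A M)"
  shows "(\<integral>\<^sup>+p. F p \<partial>stack A M) = (\<Sum>i\<in>A. \<integral>\<^sup>+x. F (i, x) \<partial>M)"
proof -
  interpret M: finite_measure M by (rule M)
  have "(\<integral>\<^sup>+p. F p \<partial>stack A M) = (\<integral>\<^sup>+i. (\<integral>\<^sup>+x. F (i, x) \<partial>M) \<partial>count_space A)"
    unfolding stack_def by (rule M.nn_integral_fst[symmetric]) (use F in \<open>simp add: stack_def\<close>)
  then show ?thesis using A by (simp add: nn_integral_count_space_finite)
qed

context
  fixes A :: "'i set" and M :: "'a measure"
  assumes A: "finite A" and M: "finite_measure M"
begin

lemma nn_integral_sq_stack:
  assumes "F \<in> borel_measurable (stack A M)"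
  shows "(\<integral>\<^sup>+p. ennreal ((F p)\<^sup>2) \<partial>stack A M) = (\<Sum>i\<in>A. \<integral>\<^sup>+x. ennreal ((F (i, x))\<^sup>2) \<partial>M)"
  by (rule nn_integral_stack[OF A M]) (use assms in measurable)

lemma sq_int_stackI:
  assumes F: "\<And>i. i \<in> A \<Longrightarrow> (\<lambda>x. F (i, x)) \<in> sq_int M"
  shows "F \<in> sq_int (stack A M)"
proof (rule sq_intI_nn_integral)
  show m: "F \<in> borel_measurable (stack A M)" using A F by (intro measurable_stack) auto
  show "(\<integral>\<^sup>+p. ennreal ((F p)\<^sup>2) \<partial>stack A M) < \<infinity>"
    unfolding nn_integral_sq_stack[OF m] using A F by (simp add: nn_integral_eq_ip)
qed

lemma sq_int_stackD:
  assumes F: "F \<in> sq_int (stack A M)" and i: "i \<in> A"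
  shows "(\<lambda>x. F (i, x)) \<in> sq_int M"
proof (rule sq_intI_nn_integral)
  have m: "F \<in> borel_measurable (stack A M)" using F by simp
  show "(\<lambda>x. F (i, x)) \<in> borel_measurable M" by (rule measurable_stack_component[OF m i])
  have "(\<integral>\<^sup>+x. ennreal ((F (i, x))\<^sup>2) \<partial>M) \<le> (\<integral>\<^sup>+p. ennreal ((F p)\<^sup>2) \<partial>stack A M)"
    unfolding nn_integral_sq_stack[OF m] using A i by (intro member_le_sum) auto
  also have "\<dots> < \<infinity>" using F by (simp add: nn_integral_eq_ip)
  finally show "(\<integral>\<^sup>+x. ennreal ((F (i, x))\<^sup>2) \<partial>M) < \<infinity>" .
qed

lemma ip_stack_self:
  assumes F: "F \<in> sq_int (stack A M)"
  shows "ip (stack A M) F F = (\<Sum>i\<in>A. ip M (\<lambda>x. F (i, x)) (\<lambda>x. F (i, x)))"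
proof -
  have "ennreal (ip (stack A M) F F) = (\<Sum>i\<in>A. \<integral>\<^sup>+x. ennreal ((F (i, x))\<^sup>2) \<partial>M)"
    using nn_integral_sq_stack[of F] F by (simp add: nn_integral_eq_ip)
  also have "\<dots> = (\<Sum>i\<in>A. ennreal (ip M (\<lambda>x. F (i, x)) (\<lambda>x. F (i, x))))"
    using sq_int_stackD[OF F] by (intro sum.cong) (simp_all add: nn_integral_eq_ip)
  finally show ?thesis by (simp add: sum_nonneg)
qed

lemma ip_stack:
  assumes F: "F \<in> sq_int (stack A M)" and G: "G \<in> sq_int (stack A M)"
  shows "ip (stack A M) F G = (\<Sum>i\<in>A. ip M (\<lambda>x. F (i, x)) (\<lambda>x. G (i, x)))"
proof -
  have "4 * ip (stack A M) F G = (\<Sum>i\<in>A. ip M (\<lambda>x. F (i, x) + G (i, x)) (\<lambda>x. F (i, x) + G (i, x))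
      - ip M (\<lambda>x. F (i, x) - G (i, x)) (\<lambda>x. F (i, x) - G (i, x)))"
    using F G by (simp add: ip_polarization ip_stack_self sum_subtractf)
  also have "\<dots> = (\<Sum>i\<in>A. 4 * ip M (\<lambda>x. F (i, x)) (\<lambda>x. G (i, x)))"
    using sq_int_stackD[OF F] sq_int_stackD[OF G] by (intro sum.cong) (simp_all add: ip_polarization)
  finally show ?thesis by (simp add: sum_distrib_left[symmetric])
qed

lemma nrm_stack_component:
  assumes F: "F \<in> sq_int (stack A M)" and i: "i \<in> A"
  shows "nrm M (\<lambda>x. F (i, x)) \<le> nrm (stack A M) F"
  unfolding nrm_def ip_stack_self[OF F] using A i
  by (intro real_sqrt_le_mono member_le_sum) auto

lemma nrm_stack_zero_iff:
  assumes F: "F \<in> sq_int (stack A M)"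
  shows "nrm (stack A M) F = 0 \<longleftrightarrow> (\<forall>i\<in>A. AE x in M. F (i, x) = 0)"
proof -
  have "nrm (stack A M) F = 0 \<longleftrightarrow> (\<forall>i\<in>A. nrm M (\<lambda>x. F (i, x)) = 0)"
    unfolding nrm_def ip_stack_self[OF F] using A by (simp add: sum_nonneg_eq_0_iff)
  also have "\<dots> \<longleftrightarrow> (\<forall>i\<in>A. AE x in M. F (i, x) = 0)"
    using sq_int_stackD[OF F] by (simp add: nrm_eq_0_iff_AE)
  finally show ?thesis .
qed

lemma single_sq_int:
  assumes "f \<in> sq_int M"
  shows "single i f \<in> sq_int (stack A M)"
proof (rule sq_int_stackI)
  fix j
  show "(\<lambda>x. single i f (j, x)) \<in> sq_int M"
    using assms by (cases "j = i") (simp_all add: single_def)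
qed

lemma ip_single:
  assumes F: "F \<in> sq_int (stack A M)" and f: "f \<in> sq_int M" and i: "i \<in> A"
  shows "ip (stack A M) F (single i f) = ip M (\<lambda>x. F (i, x)) f"
proof -
  have "ip M (\<lambda>x. F (j, x)) (\<lambda>x. single i f (j, x)) = (if j = i then ip M (\<lambda>x. F (i, x)) f else 0)" for j
    by (simp add: single_def ip_commute[of M _ "\<lambda>x. 0"])
  then show ?thesis
    using A i by (simp add: ip_stack[OF F single_sq_int[OF f]])
qed

end

section \<open>Block kernels on the product of two stacks\<close>

context
  fixes A :: "'i set" and B :: "'j set" and M :: "'a measure" and N :: "'b measure"
  assumes A: "finite A" and B: "finite B" and M: "finite_measure M" and N: "finite_measure N"
begin

interpretation M: finite_measure M by (rule M)
interpretation N: finite_measure N by (rule N)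
interpretation SM: finite_measure "stack A M" by (rule finite_measure_stack[OF A M])
interpretation SN: finite_measure "stack B N" by (rule finite_measure_stack[OF B N])
interpretation S: finite_measure_pair "stack A M" "stack B N" ..
interpretation MN: finite_measure_pair M N ..

text \<open>The two indices range over finite discrete spaces, so measurability may be checked for
  each fixed pair and glued over one index after the other.\<close>

lemma measurable_block:
  assumes "\<And>i j. i \<in> A \<Longrightarrow> j \<in> B \<Longrightarrow> (\<lambda>(x, y). F ((i, x), (j, y))) \<in> borel_measurable (M \<Otimes>\<^sub>M N)"
  shows "F \<in> borel_measurable (stack A M \<Otimes>\<^sub>M stack B N)"
proof -
  let ?P = "stack A M \<Otimes>\<^sub>M stack B N"
  have i: "(\<lambda>p. fst (fst p)) \<in> ?P \<rightarrow>\<^sub>M count_space A" and x: "(\<lambda>p. snd (fst p)) \<in> ?P \<rightarrow>\<^sub>M M"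
    and j: "(\<lambda>p. fst (snd p)) \<in> ?P \<rightarrow>\<^sub>M count_space B" and y: "(\<lambda>p. snd (snd p)) \<in> ?P \<rightarrow>\<^sub>M N"
    unfolding stack_def by measurable
  have "(\<lambda>p. F ((i, snd (fst p)), (j, snd (snd p)))) \<in> borel_measurable ?P" if "i \<in> A" "j \<in> B" for i j
    using measurable_compose[OF measurable_Pair[OF x y] assms[OF that]] by simp
  then have "(\<lambda>p. F ((i, snd (fst p)), (fst (snd p), snd (snd p)))) \<in> borel_measurable ?P" if "i \<in> A" for i
    using that by (intro measurable_compose_countable'[OF _ j countable_finite[OF B],
      of "\<lambda>j p. F ((i, snd (fst p)), (j, snd (snd p)))"]) auto
  then have "(\<lambda>p. F ((fst (fst p), snd (fst p)), (fst (snd p), snd (snd p)))) \<in> borel_measurable ?P"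
    by (intro measurable_compose_countable'[OF _ i countable_finite[OF A],
      of "\<lambda>i p. F ((i, snd (fst p)), (fst (snd p), snd (snd p)))"]) auto
  then show ?thesis by simp
qed

lemma measurable_block_component:
  assumes F: "F \<in> borel_measurable (stack A M \<Otimes>\<^sub>M stack B N)" and "i \<in> A" "j \<in> B"
  shows "(\<lambda>(x, y). F ((i, x), (j, y))) \<in> borel_measurable (M \<Otimes>\<^sub>M N)"
proof -
  have "(\<lambda>p. ((i, fst p), (j, snd p))) \<in> M \<Otimes>\<^sub>M N \<rightarrow>\<^sub>M stack A M \<Otimes>\<^sub>M stack B N"
    unfolding stack_def using assms(2,3)
    by (intro measurable_Pair measurable_const measurable_fst measurable_snd) auto
  from measurable_compose[OF this F] show ?thesis by (simp add: case_prod_beta')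
qed

text \<open>Tonelli's theorem on the two stacks, followed by Tonelli's theorem back on
  \<open>M\<close> and \<open>N\<close> for each pair of indices.\<close>

lemma nn_integral_block:
  assumes F: "F \<in> borel_measurable (stack A M \<Otimes>\<^sub>M stack B N)"
  shows "(\<integral>\<^sup>+p. ennreal ((F p)\<^sup>2) \<partial>(stack A M \<Otimes>\<^sub>M stack B N))
    = (\<Sum>i\<in>A. \<Sum>j\<in>B. \<integral>\<^sup>+p. ennreal (((\<lambda>(x, y). F ((i, x), (j, y))) p)\<^sup>2) \<partial>(M \<Otimes>\<^sub>M N))"
proof -
  note [measurable] = F
  have "(\<integral>\<^sup>+p. ennreal ((F p)\<^sup>2) \<partial>(stack A M \<Otimes>\<^sub>M stack B N))
      = (\<integral>\<^sup>+p. (\<integral>\<^sup>+q. ennreal ((F (p, q))\<^sup>2) \<partial>stack B N) \<partial>stack A M)"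
    by (rule SN.nn_integral_fst[symmetric]) measurable
  also have "\<dots> = (\<Sum>i\<in>A. \<integral>\<^sup>+x. (\<integral>\<^sup>+q. ennreal ((F ((i, x), q))\<^sup>2) \<partial>stack B N) \<partial>M)"
    by (rule nn_integral_stack[OF A M]) measurable
  also have "\<dots> = (\<Sum>i\<in>A. \<Sum>j\<in>B. \<integral>\<^sup>+p. ennreal (((\<lambda>(x, y). F ((i, x), (j, y))) p)\<^sup>2) \<partial>(M \<Otimes>\<^sub>M N))"
  proof (rule sum.cong)
    fix i assume i: "i \<in> A"
    have [measurable]: "(\<lambda>(x, y). F ((i, x), (j, y))) \<in> borel_measurable (M \<Otimes>\<^sub>M N)" if "j \<in> B" for j
      by (rule measurable_block_component[OF F i that])
    have sec: "(\<lambda>q. F ((i, x), q)) \<in> borel_measurable (stack B N)" if "x \<in> space M" for x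
      by (rule measurable_compose[OF measurable_Pair1' F]) (use that i in \<open>simp add: stack_def space_pair_measure\<close>)
    have "(\<integral>\<^sup>+x. (\<integral>\<^sup>+q. ennreal ((F ((i, x), q))\<^sup>2) \<partial>stack B N) \<partial>M)
        = (\<integral>\<^sup>+x. (\<Sum>j\<in>B. \<integral>\<^sup>+y. ennreal ((F ((i, x), (j, y)))\<^sup>2) \<partial>N) \<partial>M)"
      by (intro nn_integral_cong nn_integral_sq_stack[OF B N] sec)
    also have "\<dots> = (\<Sum>j\<in>B. \<integral>\<^sup>+x. (\<integral>\<^sup>+y. ennreal ((F ((i, x), (j, y)))\<^sup>2) \<partial>N) \<partial>M)"
    proof (rule nn_integral_sum)
      fix j assume "j \<in> B"
      have "(\<lambda>x. \<integral>\<^sup>+y. ennreal (((\<lambda>(x, y). F ((i, x), (j, y))) (x, y))\<^sup>2) \<partial>N) \<in> borel_measurable M"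
        using \<open>j \<in> B\<close> by (intro N.borel_measurable_nn_integral_fst) measurable
      then show "(\<lambda>x. \<integral>\<^sup>+y. ennreal ((F ((i, x), (j, y)))\<^sup>2) \<partial>N) \<in> borel_measurable M" by simp
    qed
    also have "\<dots> = (\<Sum>j\<in>B. \<integral>\<^sup>+p. ennreal (((\<lambda>(x, y). F ((i, x), (j, y))) p)\<^sup>2) \<partial>(M \<Otimes>\<^sub>M N))"
    proof (rule sum.cong)
      fix j assume "j \<in> B"
      have "(\<integral>\<^sup>+x. (\<integral>\<^sup>+y. ennreal (((\<lambda>(x, y). F ((i, x), (j, y))) (x, y))\<^sup>2) \<partial>N) \<partial>M)
          = (\<integral>\<^sup>+p. ennreal (((\<lambda>(x, y). F ((i, x), (j, y))) p)\<^sup>2) \<partial>(M \<Otimes>\<^sub>M N))"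
        using \<open>j \<in> B\<close> by (intro N.nn_integral_fst) measurable
      then show "(\<integral>\<^sup>+x. (\<integral>\<^sup>+y. ennreal ((F ((i, x), (j, y)))\<^sup>2) \<partial>N) \<partial>M)
          = (\<integral>\<^sup>+p. ennreal (((\<lambda>(x, y). F ((i, x), (j, y))) p)\<^sup>2) \<partial>(M \<Otimes>\<^sub>M N))" by simp
    qed simp
    finally show "(\<integral>\<^sup>+x. (\<integral>\<^sup>+q. ennreal ((F ((i, x), q))\<^sup>2) \<partial>stack B N) \<partial>M)
        = (\<Sum>j\<in>B. \<integral>\<^sup>+p. ennreal (((\<lambda>(x, y). F ((i, x), (j, y))) p)\<^sup>2) \<partial>(M \<Otimes>\<^sub>M N))" .
  qed simp
  finally show ?thesis .
qed

lemma sq_int_blockI: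
  assumes F: "\<And>i j. i \<in> A \<Longrightarrow> j \<in> B \<Longrightarrow> (\<lambda>(x, y). F ((i, x), (j, y))) \<in> sq_int (M \<Otimes>\<^sub>M N)"
  shows "F \<in> sq_int (stack A M \<Otimes>\<^sub>M stack B N)"
proof (rule sq_intI_nn_integral)
  show m: "F \<in> borel_measurable (stack A M \<Otimes>\<^sub>M stack B N)"
    by (rule measurable_block) (rule sq_int_measurable[OF F])
  show "(\<integral>\<^sup>+p. ennreal ((F p)\<^sup>2) \<partial>(stack A M \<Otimes>\<^sub>M stack B N)) < \<infinity>"
    unfolding nn_integral_block[OF m] using A B nn_integral_eq_ip[OF F] by simp
qed

lemma sq_int_blockD:
  assumes F: "F \<in> sq_int (stack A M \<Otimes>\<^sub>M stack B N)" and i: "i \<in> A" and j: "j \<in> B"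
  shows "(\<lambda>(x, y). F ((i, x), (j, y))) \<in> sq_int (M \<Otimes>\<^sub>M N)"
proof (rule sq_intI_nn_integral)
  have m: "F \<in> borel_measurable (stack A M \<Otimes>\<^sub>M stack B N)" using F by simp
  show "(\<lambda>(x, y). F ((i, x), (j, y))) \<in> borel_measurable (M \<Otimes>\<^sub>M N)"
    by (rule measurable_block_component[OF m i j])
  let ?I = "\<lambda>i j. \<integral>\<^sup>+p. ennreal (((\<lambda>(x, y). F ((i, x), (j, y))) p)\<^sup>2) \<partial>(M \<Otimes>\<^sub>M N)"
  have "?I i j \<le> (\<Sum>j\<in>B. ?I i j)" using B j by (intro member_le_sum) auto
  also have "\<dots> \<le> (\<Sum>i\<in>A. \<Sum>j\<in>B. ?I i j)" using A i by (intro member_le_sum) auto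
  also have "\<dots> < \<infinity>" using F unfolding nn_integral_block[OF m, symmetric] by (simp add: nn_integral_eq_ip)
  finally show "?I i j < \<infinity>" .
qed

lemma ip_block_self:
  assumes F: "F \<in> sq_int (stack A M \<Otimes>\<^sub>M stack B N)"
  shows "ip (stack A M \<Otimes>\<^sub>M stack B N) F F = (\<Sum>i\<in>A. \<Sum>j\<in>B.
    ip (M \<Otimes>\<^sub>M N) (\<lambda>(x, y). F ((i, x), (j, y))) (\<lambda>(x, y). F ((i, x), (j, y))))"
proof -
  have "ennreal (ip (stack A M \<Otimes>\<^sub>M stack B N) F F)
      = (\<Sum>i\<in>A. \<Sum>j\<in>B. \<integral>\<^sup>+p. ennreal (((\<lambda>(x, y). F ((i, x), (j, y))) p)\<^sup>2) \<partial>(M \<Otimes>\<^sub>M N))"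
    using nn_integral_block[of F] F by (simp add: nn_integral_eq_ip)
  also have "\<dots> = (\<Sum>i\<in>A. \<Sum>j\<in>B.
    ennreal (ip (M \<Otimes>\<^sub>M N) (\<lambda>(x, y). F ((i, x), (j, y))) (\<lambda>(x, y). F ((i, x), (j, y)))))"
    by (intro sum.cong refl nn_integral_eq_ip sq_int_blockD[OF F])
  finally show ?thesis by (simp add: sum_nonneg)
qed

lemma ip_block:
  assumes F: "F \<in> sq_int (stack A M \<Otimes>\<^sub>M stack B N)" and G: "G \<in> sq_int (stack A M \<Otimes>\<^sub>M stack B N)"
  shows "ip (stack A M \<Otimes>\<^sub>M stack B N) F G = (\<Sum>i\<in>A. \<Sum>j\<in>B.
    ip (M \<Otimes>\<^sub>M N) (\<lambda>(x, y). F ((i, x), (j, y))) (\<lambda>(x, y). G ((i, x), (j, y))))"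
proof -
  let ?c = "\<lambda>F i j. (\<lambda>(x, y). F ((i, x), (j, y)))"
  have "4 * ip (stack A M \<Otimes>\<^sub>M stack B N) F G
      = (\<Sum>i\<in>A. \<Sum>j\<in>B. ip (M \<Otimes>\<^sub>M N) (?c (\<lambda>p. F p + G p) i j) (?c (\<lambda>p. F p + G p) i j)
      - ip (M \<Otimes>\<^sub>M N) (?c (\<lambda>p. F p - G p) i j) (?c (\<lambda>p. F p - G p) i j))"
    using F G by (simp add: ip_polarization ip_block_self sum_subtractf)
  also have "\<dots> = (\<Sum>i\<in>A. \<Sum>j\<in>B. 4 * ip (M \<Otimes>\<^sub>M N) (?c F i j) (?c G i j))"
  proof (intro sum.cong refl)
    fix i j assume "i \<in> A" "j \<in> B"
    have "?c (\<lambda>p. F p + G p) i j = (\<lambda>p. ?c F i j p + ?c G i j p)"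
      "?c (\<lambda>p. F p - G p) i j = (\<lambda>p. ?c F i j p - ?c G i j p)" by auto
    then show "ip (M \<Otimes>\<^sub>M N) (?c (\<lambda>p. F p + G p) i j) (?c (\<lambda>p. F p + G p) i j)
      - ip (M \<Otimes>\<^sub>M N) (?c (\<lambda>p. F p - G p) i j) (?c (\<lambda>p. F p - G p) i j) = 4 * ip (M \<Otimes>\<^sub>M N) (?c F i j) (?c G i j)"
      using ip_polarization[OF sq_int_blockD[OF F \<open>i \<in> A\<close> \<open>j \<in> B\<close>] sq_int_blockD[OF G \<open>i \<in> A\<close> \<open>j \<in> B\<close>]]
      by (simp only:)
  qed
  finally show ?thesis by (simp add: sum_distrib_left[symmetric])
qed

lemma nrm_block_component:
  assumes F: "F \<in> sq_int (stack A M \<Otimes>\<^sub>M stack B N)" and i: "i \<in> A" and j: "j \<in> B"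
  shows "nrm (M \<Otimes>\<^sub>M N) (\<lambda>(x, y). F ((i, x), (j, y))) \<le> nrm (stack A M \<Otimes>\<^sub>M stack B N) F"
proof -
  let ?I = "\<lambda>i j. ip (M \<Otimes>\<^sub>M N) (\<lambda>(x, y). F ((i, x), (j, y))) (\<lambda>(x, y). F ((i, x), (j, y)))"
  have "?I i j \<le> (\<Sum>j\<in>B. ?I i j)" using B j by (intro member_le_sum) auto
  also have "\<dots> \<le> (\<Sum>i\<in>A. \<Sum>j\<in>B. ?I i j)" using A i by (intro member_le_sum) (auto simp: sum_nonneg)
  finally show ?thesis unfolding nrm_def ip_block_self[OF F] by (rule real_sqrt_le_mono)
qed

end

section \<open>Sobolev functions as jets\<close>

lemma nrm_diff_zero_iff_AE:
  "f \<in> sq_int M \<Longrightarrow> g \<in> sq_int M \<Longrightarrow> nrm M (\<lambda>x. f x - g x) = 0 \<longleftrightarrow> (AE x in M. f x = g x)"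
  by (subst nrm_eq_0_iff_AE) simp_all

lemma sq_int_AE_eqI:
  assumes [simp]: "f \<in> sq_int M" "g \<in> sq_int M" and eq: "\<And>u. u \<in> sq_int M \<Longrightarrow> ip M f u = ip M g u"
  shows "AE x in M. f x = g x"
proof -
  have "ip M (\<lambda>x. f x - g x) (\<lambda>x. f x - g x) = 0"
    using eq[of "\<lambda>x. f x - g x"] by (simp add: ip_diff_left)
  then show ?thesis by (simp add: nrm_diff_zero_iff_AE[symmetric] nrm_def)
qed

lemma tensor_zero [simp]: "tensor (\<lambda>_. 0) g = (\<lambda>_. 0)" "tensor f (\<lambda>_. 0) = (\<lambda>_. 0)"
  by (auto simp: tensor_def)

lemma ip_zero_right [simp]: "ip M h (\<lambda>x. 0) = 0"
  by (simp add: ip_def)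

context bounded_domain
begin

abbreviation P :: "nat \<Rightarrow> (('a \<Rightarrow> nat) \<times> 'a) measure" where
  "P k \<equiv> stack (multi_indices k) M"

lemma finite_measure_P: "finite_measure (P k)"
  by (rule finite_measure_stack[OF finite_multi_indices D.finite_measure_axioms])

lemmas sq_int_PI = sq_int_stackI[OF finite_multi_indices D.finite_measure_axioms]
lemmas sq_int_PD = sq_int_stackD[OF finite_multi_indices D.finite_measure_axioms]
lemmas ip_P = ip_stack[OF finite_multi_indices D.finite_measure_axioms]
lemmas single_sq_int_P = single_sq_int[OF finite_multi_indices D.finite_measure_axioms]
lemmas ip_single_P = ip_single[OF finite_multi_indices D.finite_measure_axioms]
lemmas nrm_P_component = nrm_stack_component[OF finite_multi_indices D.finite_measure_axioms]
lemmas nrm_P_zero_iff = nrm_stack_zero_iff[OF finite_multi_indices D.finite_measure_axioms]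

lemma test_fun_AE_eq:
  assumes f: "f \<in> sq_int M" and g: "g \<in> sq_int M"
    and eq: "\<And>\<phi>. test_fun \<Omega> \<phi> \<Longrightarrow> ip M f \<phi> = ip M g \<phi>"
  shows "AE x in M. f x = g x"
proof -
  have "AE x in M. f x - g x = 0"
  proof (rule test_fun_orthogonal_AE_zero[OF open_dom])
    show "locally_integrable \<Omega> (\<lambda>x. f x - g x)"
      using f g by (intro sq_int_locally_integrable) simp
    fix \<phi> assume \<phi>: "test_fun \<Omega> \<phi>"
    have "ip M (\<lambda>x. f x - g x) \<phi> = 0"
      using f g eq[OF \<phi>] test_fun_sq_int[OF \<phi>] by (simp add: ip_diff_left)
    then show "(\<integral>x. (f x - g x) * \<phi> x \<partial>M) = 0" by (simp add: ip_def)
  qed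
  then show ?thesis by eventually_elim simp
qed

text \<open>
  \<open>jet f\<close> collects all weak derivatives of \<open>f\<close>; it embeds \<open>H\<^sup>k\<close> isometrically into
  \<open>L\<^sup>2\<close> with range \<open>jets k\<close> (up to null sets).
\<close>

definition jet :: "('a \<Rightarrow> real) \<Rightarrow> ('a \<Rightarrow> nat) \<times> 'a \<Rightarrow> real" where
  "jet f = (\<lambda>(\<alpha>, x). weak_deriv \<Omega> \<alpha> f x)"

definition jets :: "nat \<Rightarrow> (('a \<Rightarrow> nat) \<times> 'a \<Rightarrow> real) set" where
  "jets k = {G \<in> sq_int (P k). \<forall>\<alpha>\<in>multi_indices k.
     has_weak_deriv \<Omega> \<alpha> (\<lambda>x. G (\<lambda>_. 0, x)) (\<lambda>x. G (\<alpha>, x))}"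

lemma sobolev_sq_int: "f \<in> sobolev \<Omega> k \<Longrightarrow> f \<in> sq_int M"
  by (simp add: sobolev_def L2_eq)

lemma sobolev_weak_deriv:
  assumes f: "f \<in> sobolev \<Omega> k" and \<alpha>: "\<alpha> \<in> multi_indices k"
  shows "has_weak_deriv \<Omega> \<alpha> f (weak_deriv \<Omega> \<alpha> f)" "weak_deriv \<Omega> \<alpha> f \<in> sq_int M"
proof -
  obtain g where "has_weak_deriv \<Omega> \<alpha> f g" "g \<in> sq_int M"
    using f \<alpha> by (auto simp: sobolev_def L2_eq)
  then show "has_weak_deriv \<Omega> \<alpha> f (weak_deriv \<Omega> \<alpha> f)" "weak_deriv \<Omega> \<alpha> f \<in> sq_int M"
    using weak_deriv_eq(1) weak_deriv_sq_int by auto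
qed

lemma jet_sq_int: "f \<in> sobolev \<Omega> k \<Longrightarrow> jet f \<in> sq_int (P k)"
  by (rule sq_int_PI) (simp add: jet_def sobolev_weak_deriv)

lemma jet_zero_AE: "f \<in> sobolev \<Omega> k \<Longrightarrow> AE x in M. jet f (\<lambda>_. 0, x) = f x"
  using weak_deriv_eq(2)[OF has_weak_deriv_zero_index[OF sobolev_sq_int]] by (simp add: jet_def)

lemma jet_in_jets:
  assumes f: "f \<in> sobolev \<Omega> k" shows "jet f \<in> jets k"
  unfolding jets_def mem_Collect_eq
proof (intro conjI ballI)
  show J: "jet f \<in> sq_int (P k)" by (rule jet_sq_int[OF f])
  fix \<alpha> :: "'a \<Rightarrow> nat" assume \<alpha>: "\<alpha> \<in> multi_indices k"
  show "has_weak_deriv \<Omega> \<alpha> (\<lambda>x. jet f (\<lambda>_. 0, x)) (\<lambda>x. jet f (\<alpha>, x))"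
  proof (rule has_weak_deriv_cong_AE[OF sobolev_sq_int[OF f] _ sobolev_weak_deriv(2)[OF f \<alpha>] _ _ _
        sobolev_weak_deriv(1)[OF f \<alpha>]])
    show "AE x in M. f x = jet f (\<lambda>_. 0, x)" using jet_zero_AE[OF f] by eventually_elim simp
  qed (use sq_int_PD[OF J zero_index_mem] sq_int_PD[OF J \<alpha>] in \<open>simp_all add: jet_def\<close>)
qed

text \<open>By uniqueness of weak derivatives a jet is determined by its entry at index 0. Finding a
  member of \<open>jets k\<close> above \<open>f\<close> therefore proves that \<open>f\<close> is a
  Sobolev function and computes all its derivatives.\<close>

lemma jets_AE:
  assumes f: "f \<in> sq_int M" and G: "G \<in> jets k" and eq: "AE x in M. f x = G (\<lambda>_. 0, x)"
  shows "f \<in> sobolev \<Omega> k" "AE p in P k. jet f p = G p"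
proof -
  have Gs: "G \<in> sq_int (P k)" using G by (simp add: jets_def)
  have d: "has_weak_deriv \<Omega> \<alpha> f (\<lambda>x. G (\<alpha>, x))" if \<alpha>: "\<alpha> \<in> multi_indices k" for \<alpha>
  proof (rule has_weak_deriv_cong_AE[of "\<lambda>x. G (\<lambda>_. 0, x)" f "\<lambda>x. G (\<alpha>, x)" "\<lambda>x. G (\<alpha>, x)"])
    show "AE x in M. G (\<lambda>_. 0, x) = f x" using eq by eventually_elim simp
    show "has_weak_deriv \<Omega> \<alpha> (\<lambda>x. G (\<lambda>_. 0, x)) (\<lambda>x. G (\<alpha>, x))" using G \<alpha> by (simp add: jets_def)
  qed (use f sq_int_PD[OF Gs zero_index_mem] sq_int_PD[OF Gs \<alpha>] in simp_all)
  show f': "f \<in> sobolev \<Omega> k"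
    using f d sq_int_PD[OF Gs] by (auto simp: sobolev_def L2_eq)
  have "nrm (P k) (\<lambda>p. jet f p - G p) = 0"
  proof (subst nrm_P_zero_iff)
    show "(\<lambda>p. jet f p - G p) \<in> sq_int (P k)" using jet_sq_int[OF f'] Gs by simp
    show "\<forall>\<alpha>\<in>multi_indices k. AE x in M. jet f (\<alpha>, x) - G (\<alpha>, x) = 0"
    proof
      fix \<alpha> :: "'a \<Rightarrow> nat" assume "\<alpha> \<in> multi_indices k"
      from weak_deriv_eq(2)[OF d[OF this]] show "AE x in M. jet f (\<alpha>, x) - G (\<alpha>, x) = 0"
        by eventually_elim (simp add: jet_def)
    qed
  qed
  then show "AE p in P k. jet f p = G p"
    using jet_sq_int[OF f'] Gs by (simp add: nrm_diff_zero_iff_AE)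
qed

lemma jets_sq_int: "G \<in> jets k \<Longrightarrow> G \<in> sq_int (P k)"
  by (simp add: jets_def)

lemma jets_zero_section:
  assumes G: "G \<in> jets k"
  shows "(\<lambda>x. G (\<lambda>_. 0, x)) \<in> sobolev \<Omega> k" "AE p in P k. jet (\<lambda>x. G (\<lambda>_. 0, x)) p = G p"
  using jets_AE[OF sq_int_PD[OF jets_sq_int[OF G] zero_index_mem] G] by auto

lemma jets_combination:
  assumes F: "F \<in> jets k" and G: "G \<in> jets k"
  shows "(\<lambda>p. a * F p + b * G p) \<in> jets k"
  unfolding jets_def mem_Collect_eq
proof (intro conjI ballI)
  fix \<alpha> :: "'a \<Rightarrow> nat" assume \<alpha>: "\<alpha> \<in> multi_indices k"
  show "has_weak_deriv \<Omega> \<alpha> (\<lambda>x. a * F (\<lambda>_. 0, x) + b * G (\<lambda>_. 0, x)) (\<lambda>x. a * F (\<alpha>, x) + b * G (\<alpha>, x))"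
    using F G \<alpha> by (intro has_weak_deriv_combination sq_int_PD[OF jets_sq_int] zero_index_mem)
      (simp_all add: jets_def)
qed (use F G in \<open>simp add: jets_sq_int\<close>)

text \<open>This is the completeness of H^k. L2 convergence of families is convergence of every
  component, and weak derivatives pass to L2 limits.\<close>

lemma closed_subspace_jets: "closed_subspace (P k) (jets k)"
  unfolding closed_subspace_def
proof (intro conjI ballI allI impI)
  show "jets k \<subseteq> sq_int (P k)" by (auto simp: jets_def)
  show "(\<lambda>p. 0) \<in> jets k" by (auto simp: jets_def has_weak_deriv_iff)
  show "(\<lambda>p. F p + G p) \<in> jets k" if "F \<in> jets k" "G \<in> jets k" for F G
    using jets_combination[OF that, of 1 1] by simp
  show "(\<lambda>p. c * F p) \<in> jets k" if "F \<in> jets k" for F c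
    using jets_combination[OF that that, of c 0] by simp
  fix F G
  assume F: "\<forall>n. F n \<in> jets k" and G: "G \<in> sq_int (P k)"
    and lim: "(\<lambda>n. nrm (P k) (\<lambda>p. F n p - G p)) \<longlonglongrightarrow> 0"
  have Fs: "F n \<in> sq_int (P k)" for n using F by (simp add: jets_sq_int)
  have comp: "(\<lambda>n. nrm M (\<lambda>x. F n (\<alpha>, x) - G (\<alpha>, x))) \<longlonglongrightarrow> 0" if "\<alpha> \<in> multi_indices k" for \<alpha>
  proof (rule tendsto_sandwich[OF _ _ tendsto_const lim])
    show "\<forall>\<^sub>F n in sequentially. nrm M (\<lambda>x. F n (\<alpha>, x) - G (\<alpha>, x)) \<le> nrm (P k) (\<lambda>p. F n p - G p)"
      using nrm_P_component[OF sq_int_diff[OF Fs G] that] by simp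
  qed simp
  show "G \<in> jets k"
    unfolding jets_def mem_Collect_eq
  proof (intro conjI ballI G)
    fix \<alpha> :: "'a \<Rightarrow> nat" assume \<alpha>: "\<alpha> \<in> multi_indices k"
    show "has_weak_deriv \<Omega> \<alpha> (\<lambda>x. G (\<lambda>_. 0, x)) (\<lambda>x. G (\<alpha>, x))"
    proof (rule has_weak_deriv_limit[where F = "\<lambda>n x. F n (\<lambda>_. 0, x)" and F' = "\<lambda>n x. F n (\<alpha>, x)"])
      show "has_weak_deriv \<Omega> \<alpha> (\<lambda>x. F n (\<lambda>_. 0, x)) (\<lambda>x. F n (\<alpha>, x))" for n
        using F \<alpha> by (simp add: jets_def)
    qed (rule sq_int_PD[OF Fs] sq_int_PD[OF G] comp, rule \<alpha> zero_index_mem)+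
  qed
qed

lemma sobolev_inner_eq:
  "f \<in> sobolev \<Omega> k \<Longrightarrow> g \<in> sobolev \<Omega> k \<Longrightarrow> sobolev_inner \<Omega> k f g = ip (P k) (jet f) (jet g)"
  by (simp add: ip_P jet_sq_int) (simp add: sobolev_inner_def L2_inner_def jet_def ip_def)

lemma sobolev_norm_eq: "f \<in> sobolev \<Omega> k \<Longrightarrow> sobolev_norm \<Omega> k f = nrm (P k) (jet f)"
  by (simp add: sobolev_norm_def sobolev_inner_eq nrm_def)

lemma jet_cong_AE:
  assumes f: "f \<in> sobolev \<Omega> k" and g: "g \<in> sobolev \<Omega> k" and eq: "AE x in M. f x = g x"
  shows "AE p in P k. jet f p = jet g p"
proof (rule jets_AE(2)[OF sobolev_sq_int[OF f] jet_in_jets[OF g]])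
  show "AE x in M. f x = jet g (\<lambda>_. 0, x)"
    using eq jet_zero_AE[OF g] by eventually_elim simp
qed

text \<open>Since \<open>weak_deriv\<close> selects representatives, \<open>jet\<close> is linear
  only up to null sets. The family \<open>u\<close> is kept general because the lemma is applied to
  basis elements as well as to their images under an operator.\<close>

lemma jet_residual:
  assumes f: "f \<in> sobolev \<Omega> k" and u: "\<And>e. e \<in> A \<Longrightarrow> u e \<in> sobolev \<Omega> k" and A: "finite A"
  shows "(\<lambda>x. f x - (\<Sum>e\<in>A. c e * u e x)) \<in> sobolev \<Omega> k"
    and "AE p in P k. jet (\<lambda>x. f x - (\<Sum>e\<in>A. c e * u e x)) p = jet f p - (\<Sum>e\<in>A. c e * jet (u e) p)"
proof -
  let ?f = "\<lambda>x. f x - (\<Sum>e\<in>A. c e * u e x)" and ?G = "\<lambda>p. jet f p - (\<Sum>e\<in>A. c e * jet (u e) p)"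
  have s: "?f \<in> sq_int M"
    using f u sobolev_sq_int by (intro sq_int_diff sq_int_sum sq_int_scale) blast+
  have G: "?G \<in> jets k"
    by (intro closed_subspace_diff[OF closed_subspace_jets] closed_subspace_sum[OF closed_subspace_jets]
        jet_in_jets f u)
  have "AE x in M. \<forall>e\<in>A. jet (u e) (\<lambda>_. 0, x) = u e x"
    by (intro AE_finite_allI[OF A] jet_zero_AE[OF u])
  then have eq: "AE x in M. ?f x = ?G (\<lambda>_. 0, x)"
    using jet_zero_AE[OF f] by eventually_elim simp
  show "?f \<in> sobolev \<Omega> k" "AE p in P k. jet ?f p = ?G p"
    by (rule jets_AE[OF s G eq])+
qed

lemma sobolev_norm_residual:
  assumes f: "f \<in> sobolev \<Omega> k" and u: "\<And>e. e \<in> A \<Longrightarrow> u e \<in> sobolev \<Omega> k" and A: "finite A"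
  shows "sobolev_norm \<Omega> k (\<lambda>x. f x - (\<Sum>e\<in>A. c e * u e x))
    = nrm (P k) (\<lambda>p. jet f p - (\<Sum>e\<in>A. c e * jet (u e) p))"
proof -
  let ?f = "\<lambda>x. f x - (\<Sum>e\<in>A. c e * u e x)" and ?G = "\<lambda>p. jet f p - (\<Sum>e\<in>A. c e * jet (u e) p)"
  have s: "?f \<in> sobolev \<Omega> k" by (rule jet_residual(1)[OF f _ A]) (rule u)
  have eq: "AE p in P k. jet ?f p = ?G p" by (rule jet_residual(2)[OF f _ A]) (rule u)
  have G: "?G \<in> sq_int (P k)" by (intro sq_int_diff sq_int_sum sq_int_scale jet_sq_int f u)
  show ?thesis
    unfolding sobolev_norm_eq[OF s] by (rule nrm_cong_AE[OF jet_sq_int[OF s] G eq])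
qed

lemma sobolev_onb_jet:
  assumes E: "sobolev_onb \<Omega> k E"
  shows "orthonormal (P k) jet E" "G \<in> jets k \<Longrightarrow> approximable (P k) jet E G"
proof -
  have ES: "e \<in> sobolev \<Omega> k" if "e \<in> E" for e using E that by (auto simp: sobolev_onb_def)
  show o: "orthonormal (P k) jet E"
    using E ES by (auto simp: orthonormal_def sobolev_onb_def jet_sq_int sobolev_inner_eq[symmetric])
  assume G: "G \<in> jets k"
  let ?f = "\<lambda>x. G (\<lambda>_. 0, x)"
  have f: "?f \<in> sobolev \<Omega> k" by (rule jets_zero_section(1)[OF G])
  have "approximable (P k) jet E (jet ?f)"
    unfolding approximable_def
  proof (intro allI impI)
    fix \<epsilon> :: real assume "\<epsilon> > 0"
    have "\<forall>f\<in>sobolev \<Omega> k. \<forall>\<epsilon>>0. \<exists>F c. finite F \<and> F \<subseteq> E \<and>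
        sobolev_norm \<Omega> k (\<lambda>x. f x - (\<Sum>e\<in>F. c e * e x)) < \<epsilon>"
      using E unfolding sobolev_onb_def by (elim conjE)
    from this[rule_format, OF f \<open>\<epsilon> > 0\<close>] obtain F c where F: "finite F" "F \<subseteq> E"
      and less: "sobolev_norm \<Omega> k (\<lambda>x. ?f x - (\<Sum>e\<in>F. c e * e x)) < \<epsilon>"
      by (elim exE conjE)
    have "sobolev_norm \<Omega> k (\<lambda>x. ?f x - (\<Sum>e\<in>F. c e * e x))
        = nrm (P k) (\<lambda>p. jet ?f p - (\<Sum>e\<in>F. c e * jet e p))"
      by (rule sobolev_norm_residual[OF f _ F(1)]) (rule ES, rule subsetD[OF F(2)])
    with F less show "\<exists>A c. finite A \<and> A \<subseteq> E \<and> nrm (P k) (\<lambda>p. jet ?f p - (\<Sum>e\<in>A. c e * jet e p)) < \<epsilon>"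
      by (intro exI[of _ F] exI[of _ c]) simp
  qed
  then show "approximable (P k) jet E G"
    by (rule approximable_cong_AE[OF _ jet_sq_int[OF ES] jet_sq_int[OF f] jets_sq_int[OF G] jets_zero_section(2)[OF G]])
qed

text \<open>Without a basis, the definite description in \<open>hs_norm_sq\<close> would not be
  determined and no basis could witness the Hilbert-Schmidt property. One is obtained from a basis
  of \<open>jets k\<close> by keeping the entries at index 0.\<close>

lemma sobolev_onb_exists: "\<exists>E. sobolev_onb \<Omega> k E"
proof -
  obtain B where B: "B \<subseteq> jets k" and o: "orthonormal (P k) (\<lambda>b. b) B"
    and ap: "\<forall>G\<in>jets k. approximable (P k) (\<lambda>b. b) B G"
    by (rule finite_measure.orthonormal_basis_exists[OF finite_measure_P closed_subspace_jets[of k]])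
      (rule that, assumption+, simp)
  define z :: "(('a \<Rightarrow> nat) \<times> 'a \<Rightarrow> real) \<Rightarrow> 'a \<Rightarrow> real" where "z b = (\<lambda>x. b (\<lambda>_. 0, x))" for b
  have zs: "z b \<in> sobolev \<Omega> k" and zj: "AE p in P k. jet (z b) p = b p" if "b \<in> B" for b
    using jets_zero_section[of b k] that B by (auto simp: z_def)
  have Bs: "b \<in> sq_int (P k)" if "b \<in> B" for b using that B jets_sq_int by blast
  have inner: "sobolev_inner \<Omega> k (z b) (z b') = (if b = b' then 1 else 0)" if "b \<in> B" "b' \<in> B" for b b'
  proof -
    have "ip (P k) (jet (z b)) (jet (z b')) = ip (P k) b b'"
      by (intro ip_cong_AE jet_sq_int zs zj Bs that)
    then show ?thesis
      using orthonormal_ip[OF o that] sobolev_inner_eq[OF zs[OF that(1)] zs[OF that(2)]] by simp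
  qed
  \<comment> \<open>Two jets with the same entry at index 0 have inner product 1 after passing to
    \<open>z\<close>, so orthonormality forces them to coincide.\<close>
  have inj: "inj_on z B"
  proof (rule inj_onI)
    fix b b' assume b: "b \<in> B" "b' \<in> B" "z b = z b'"
    then have "(if b = b' then 1 else 0 :: real) = (if b = b then 1 else 0)"
      using inner[of b b'] inner[of b b] by simp
    then show "b = b'" by (simp split: if_splits)
  qed
  have "sobolev_onb \<Omega> k (z ` B)"
    unfolding sobolev_onb_def
  proof (intro conjI ballI allI impI)
    show "z ` B \<subseteq> sobolev \<Omega> k" using zs by blast
    show "sobolev_inner \<Omega> k e e' = (if e = e' then 1 else 0)" if "e \<in> z ` B" "e' \<in> z ` B" for e e'
      using that inner inj by (auto simp: inj_on_eq_iff)
    fix f \<epsilon> assume f: "f \<in> sobolev \<Omega> k" and "\<epsilon> > (0::real)"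
    have "approximable (P k) (\<lambda>b. b) B (jet f)" using ap jet_in_jets[OF f] by (rule bspec)
    with \<open>\<epsilon> > 0\<close> obtain A c where A: "finite A" "A \<subseteq> B"
      and less: "nrm (P k) (\<lambda>p. jet f p - (\<Sum>b\<in>A. c b * b p)) < \<epsilon>"
      unfolding approximable_def by (elim allE impE exE conjE)
    define c' where "c' = c \<circ> inv_into B z"
    have sum_eq: "(\<Sum>e\<in>z ` A. c' e * e x) = (\<Sum>b\<in>A. c b * z b x)" for x
      using A inj by (subst sum.reindex)
        (auto simp: c'_def inv_into_f_f subset_iff intro: inj_on_subset intro!: sum.cong)
    have "AE p in P k. \<forall>b\<in>A. jet (z b) p = b p"
      using A zj by (intro AE_finite_allI) auto
    then have "AE p in P k. jet f p - (\<Sum>b\<in>A. c b * jet (z b) p) = jet f p - (\<Sum>b\<in>A. c b * b p)"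
      by eventually_elim simp
    then have "nrm (P k) (\<lambda>p. jet f p - (\<Sum>b\<in>A. c b * jet (z b) p)) = nrm (P k) (\<lambda>p. jet f p - (\<Sum>b\<in>A. c b * b p))"
      by (intro nrm_cong_AE sq_int_diff sq_int_sum sq_int_scale jet_sq_int[OF f] jet_sq_int[OF zs] Bs
          subsetD[OF A(2)])
    then have "sobolev_norm \<Omega> k (\<lambda>x. f x - (\<Sum>e\<in>z ` A. c' e * e x)) < \<epsilon>"
      unfolding sum_eq using less
      by (subst sobolev_norm_residual[OF f _ A(1)]) (rule zs, rule subsetD[OF A(2)], assumption, simp)
    with A show "\<exists>F c. finite F \<and> F \<subseteq> z ` B \<and> sobolev_norm \<Omega> k (\<lambda>x. f x - (\<Sum>e\<in>F. c e * e x)) < \<epsilon>"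
      by (intro exI[of _ "z ` A"] exI[of _ c']) auto
  qed
  then show ?thesis by blast
qed

end

section \<open>Kernels of mixed Sobolev regularity\<close>

locale kernel_domain = bounded_domain \<Omega> for \<Omega> :: "'a::euclidean_space set" +
  fixes k l :: nat

sublocale kernel_domain \<subseteq> PD: bounded_domain "\<Omega> \<times> \<Omega>"
  by unfold_locales (use open_dom bounded_dom in \<open>auto intro: open_Times bounded_Times\<close>)

sublocale kernel_domain \<subseteq> MM: finite_measure_pair "lborel_on \<Omega>" "lborel_on \<Omega>" ..

sublocale kernel_domain \<subseteq> PP: finite_measure_pair "stack (multi_indices k :: ('a \<Rightarrow> nat) set) (lborel_on \<Omega>)"
    "stack (multi_indices l :: ('a \<Rightarrow> nat) set) (lborel_on \<Omega>)"
  by (intro finite_measure_pair.intro finite_measure_P)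

context kernel_domain
begin

abbreviation "Q \<equiv> lborel_on \<Omega> \<Otimes>\<^sub>M lborel_on \<Omega>"
abbreviation "R \<equiv> P k \<Otimes>\<^sub>M P l"

lemma Q_eq: "Q = lborel_on (\<Omega> \<times> \<Omega>)"
  by (rule lborel_on_Times[OF open_dom open_dom])

lemmas has_weak_deriv_Q_iff = PD.has_weak_deriv_iff[folded Q_eq]
lemmas test_fun_sq_int_Q = PD.test_fun_sq_int[folded Q_eq]
lemmas L2_Q_eq = PD.L2_eq[folded Q_eq]

lemmas sq_int_RI = sq_int_blockI[OF finite_multi_indices finite_multi_indices
  D.finite_measure_axioms D.finite_measure_axioms]
lemmas sq_int_RD = sq_int_blockD[OF finite_multi_indices finite_multi_indices
  D.finite_measure_axioms D.finite_measure_axioms]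
lemmas ip_R = ip_block[OF finite_multi_indices finite_multi_indices
  D.finite_measure_axioms D.finite_measure_axioms]
lemmas nrm_R_component = nrm_block_component[OF finite_multi_indices finite_multi_indices
  D.finite_measure_axioms D.finite_measure_axioms]

text \<open>The test function on the product need not be a tensor, but its sections are test
  functions. The derivatives can thus be moved in one variable while the other is frozen, with
  Fubini switching between the variables.\<close>

lemma has_weak_deriv_tensor:
  assumes f: "f \<in> sq_int M" "f' \<in> sq_int M" and g: "g \<in> sq_int M" "g' \<in> sq_int M"
    and df: "has_weak_deriv \<Omega> \<alpha> f f'" and dg: "has_weak_deriv \<Omega> \<beta> g g'"
  shows "has_weak_deriv (\<Omega> \<times> \<Omega>) (pair_index \<alpha> \<beta>) (tensor f g) (tensor f' g')"
  unfolding has_weak_deriv_Q_iff[OF MM.tensor_sq_int[OF f(1) g(1)] MM.tensor_sq_int[OF f(2) g(2)]]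
proof (intro allI impI)
  fix \<phi> assume \<phi>: "test_fun (\<Omega> \<times> \<Omega>) \<phi>"
  \<comment> \<open>\<open>?L\<close> keeps only the derivative in the second variable: passing from
    \<open>?K\<close> to \<open>?L\<close> uses the weak derivative of \<open>f\<close>, and passing
    from \<open>?L\<close> to \<phi> uses that of \<open>g\<close>.\<close>
  let ?K = "multi_deriv (pair_index \<alpha> \<beta>) \<phi>" and ?L = "multi_deriv (pair_index (\<lambda>_. 0) \<beta>) \<phi>"
  have L: "?L (x, y) = multi_deriv \<beta> (\<lambda>y. \<phi> (x, y)) y" for x y
    by (simp add: multi_deriv_pair_index[OF test_fun_smooth[OF \<phi>]])
  have K: "?K (x, y) = multi_deriv \<alpha> (\<lambda>x. ?L (x, y)) x" for x y
    by (simp add: L) (simp add: multi_deriv_pair_index[OF test_fun_smooth[OF \<phi>]])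
  have Ks: "?K \<in> sq_int Q" and Ls: "?L \<in> sq_int Q" and \<phi>s: "\<phi> \<in> sq_int Q"
    by (intro test_fun_sq_int_Q test_fun_multi_deriv \<phi>)+
  have 1: "MM.contract1 ?K f = (\<lambda>y. (-1) ^ multi_order \<alpha> * MM.contract1 ?L f' y)"
  proof
    fix y
    have t: "test_fun \<Omega> (\<lambda>x. ?L (x, y))" by (rule test_fun_section1[OF test_fun_multi_deriv[OF \<phi>]])
    have "MM.contract1 ?K f y = ip M f (multi_deriv \<alpha> (\<lambda>x. ?L (x, y)))"
      by (simp only: MM.contract1_def ip_def K mult.commute)
    also have "\<dots> = (-1) ^ multi_order \<alpha> * ip M f' (\<lambda>x. ?L (x, y))"
      using df t unfolding has_weak_deriv_iff[OF f] by simp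
    also have "ip M f' (\<lambda>x. ?L (x, y)) = MM.contract1 ?L f' y"
      by (simp only: MM.contract1_def ip_def mult.commute)
    finally show "MM.contract1 ?K f y = (-1) ^ multi_order \<alpha> * MM.contract1 ?L f' y" .
  qed
  have 2: "MM.contract2 ?L g = (\<lambda>x. (-1) ^ multi_order \<beta> * MM.contract2 \<phi> g' x)"
  proof
    fix x
    have t: "test_fun \<Omega> (\<lambda>y. \<phi> (x, y))" by (rule test_fun_section2[OF \<phi>])
    have "MM.contract2 ?L g x = ip M g (multi_deriv \<beta> (\<lambda>y. \<phi> (x, y)))"
      by (simp only: MM.contract2_def ip_def L mult.commute)
    also have "\<dots> = (-1) ^ multi_order \<beta> * ip M g' (\<lambda>y. \<phi> (x, y))"
      using dg t unfolding has_weak_deriv_iff[OF g] by simp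
    also have "ip M g' (\<lambda>y. \<phi> (x, y)) = MM.contract2 \<phi> g' x"
      by (simp only: MM.contract2_def ip_def mult.commute)
    finally show "MM.contract2 ?L g x = (-1) ^ multi_order \<beta> * MM.contract2 \<phi> g' x" .
  qed
  have "ip Q (tensor f g) ?K = ip M (MM.contract1 ?K f) g"
    unfolding MM.ip_contract1[OF Ks f(1) g(1)] by (rule ip_commute)
  also have "\<dots> = (-1) ^ multi_order \<alpha> * ip M (MM.contract1 ?L f') g"
    unfolding 1 by simp
  also have "ip M (MM.contract1 ?L f') g = ip M (MM.contract2 ?L g) f'"
    by (simp only: MM.ip_contract1[OF Ls f(2) g(1)] MM.ip_contract2[OF Ls f(2) g(1)])
  also have "\<dots> = (-1) ^ multi_order \<beta> * ip M (MM.contract2 \<phi> g') f'"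
    unfolding 2 by simp
  also have "ip M (MM.contract2 \<phi> g') f' = ip Q (tensor f' g') \<phi>"
    unfolding MM.ip_contract2[OF \<phi>s f(2) g(2)] by (rule ip_commute)
  finally show "ip Q (tensor f g) ?K = (-1) ^ multi_order (pair_index \<alpha> \<beta>) * ip Q (tensor f' g') \<phi>"
    by (simp add: multi_order_pair_index power_add)
qed

definition block :: "('a \<times> 'a \<Rightarrow> real) \<Rightarrow> ('a \<Rightarrow> nat) \<Rightarrow> ('a \<Rightarrow> nat) \<Rightarrow> 'a \<times> 'a \<Rightarrow> real" where
  "block h \<alpha> \<beta> = weak_deriv (\<Omega> \<times> \<Omega>) (pair_index \<alpha> \<beta>) h"

definition kernel :: "('a \<times> 'a \<Rightarrow> real) \<Rightarrow> (('a \<Rightarrow> nat) \<times> 'a) \<times> (('a \<Rightarrow> nat) \<times> 'a) \<Rightarrow> real" where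
  "kernel h = (\<lambda>((\<alpha>, x), (\<beta>, y)). block h \<alpha> \<beta> (x, y))"

context
  fixes h assumes h: "h \<in> mixed_sobolev \<Omega> k l"
begin

lemma mixed_sq_int: "h \<in> sq_int Q"
  using h by (simp add: mixed_sobolev_def L2_Q_eq)

lemma block_props:
  assumes "\<alpha> \<in> multi_indices k" "\<beta> \<in> multi_indices l"
  shows "has_weak_deriv (\<Omega> \<times> \<Omega>) (pair_index \<alpha> \<beta>) h (block h \<alpha> \<beta>)" "block h \<alpha> \<beta> \<in> sq_int Q"
proof -
  obtain g where "has_weak_deriv (\<Omega> \<times> \<Omega>) (pair_index \<alpha> \<beta>) h g" "g \<in> sq_int Q"
    using h assms unfolding mixed_sobolev_def L2_Q_eq by blast
  then show "has_weak_deriv (\<Omega> \<times> \<Omega>) (pair_index \<alpha> \<beta>) h (block h \<alpha> \<beta>)" "block h \<alpha> \<beta> \<in> sq_int Q"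
    unfolding block_def Q_eq using PD.weak_deriv_eq(1) PD.weak_deriv_sq_int by blast+
qed

lemma block_test_tensor:
  assumes \<alpha>: "\<alpha> \<in> multi_indices k" and \<beta>: "\<beta> \<in> multi_indices l"
    and \<psi>: "test_fun \<Omega> \<psi>" and \<phi>: "test_fun \<Omega> \<phi>"
  shows "ip Q h (tensor (multi_deriv \<alpha> \<psi>) (multi_deriv \<beta> \<phi>))
    = (-1) ^ multi_order \<alpha> * (-1) ^ multi_order \<beta> * ip Q (block h \<alpha> \<beta>) (tensor \<psi> \<phi>)"
proof -
  have "ip Q h (multi_deriv (pair_index \<alpha> \<beta>) (tensor \<psi> \<phi>))
      = (-1) ^ multi_order (pair_index \<alpha> \<beta>) * ip Q (block h \<alpha> \<beta>) (tensor \<psi> \<phi>)"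
    using block_props(1)[OF \<alpha> \<beta>] test_fun_tensor[OF \<psi> \<phi>]
    unfolding has_weak_deriv_Q_iff[OF mixed_sq_int block_props(2)[OF \<alpha> \<beta>]] by simp
  then show ?thesis
    by (simp add: multi_deriv_tensor[OF test_fun_smooth[OF \<psi>] test_fun_smooth[OF \<phi>]]
        multi_order_pair_index power_add)
qed

text \<open>
  The defining identity of the weak derivatives of \<open>h\<close> only allows test functions; by the
  fundamental lemma one of the two factors may be an arbitrary square-integrable function.
\<close>

lemma block_deriv1:
  assumes \<alpha>: "\<alpha> \<in> multi_indices k" and \<beta>: "\<beta> \<in> multi_indices l"
    and \<psi>: "test_fun \<Omega> \<psi>" and u: "u \<in> sq_int M"
  shows "ip Q (block h (\<lambda>_. 0) \<beta>) (tensor (multi_deriv \<alpha> \<psi>) u)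
    = (-1) ^ multi_order \<alpha> * ip Q (block h \<alpha> \<beta>) (tensor \<psi> u)"
proof -
  let ?F = "MM.contract1 (block h (\<lambda>_. 0) \<beta>) (multi_deriv \<alpha> \<psi>)"
  let ?G = "\<lambda>y. (-1) ^ multi_order \<alpha> * MM.contract1 (block h \<alpha> \<beta>) \<psi> y"
  note d0 = block_props(2)[OF zero_index_mem \<beta>] and d = block_props(2)[OF \<alpha> \<beta>]
  note s = test_fun_multi_deriv_sq_int[OF \<psi>, of \<alpha>] test_fun_sq_int[OF \<psi>]
  have F: "?F \<in> sq_int M" by (rule MM.contract1_sq_int(1)[OF d0 s(1)])
  have G: "?G \<in> sq_int M" by (intro sq_int_scale MM.contract1_sq_int(1)[OF d s(2)])
  have "AE y in M. ?F y = ?G y"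
  proof (rule test_fun_AE_eq[OF F G])
    fix \<phi> assume \<phi>: "test_fun \<Omega> \<phi>"
    \<comment> \<open>A derivative of a test function is again a test function, so both orders of
      differentiation can be traced back to the same pairing with \<open>h\<close>; the common sign
      cancels.\<close>
    have "(-1) ^ multi_order \<beta> * ip Q (block h (\<lambda>_. 0) \<beta>) (tensor (multi_deriv \<alpha> \<psi>) \<phi>)
        = ip Q h (tensor (multi_deriv \<alpha> \<psi>) (multi_deriv \<beta> \<phi>))"
      using block_test_tensor[OF zero_index_mem \<beta> test_fun_multi_deriv[OF \<psi>, of \<alpha>] \<phi>] by simp
    also have "\<dots> = (-1) ^ multi_order \<beta> * ((-1) ^ multi_order \<alpha> * ip Q (block h \<alpha> \<beta>) (tensor \<psi> \<phi>))"
      using block_test_tensor[OF \<alpha> \<beta> \<psi> \<phi>] by simp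
    finally show "ip M ?F \<phi> = ip M ?G \<phi>"
      using MM.ip_contract1[OF d0 s(1) test_fun_sq_int[OF \<phi>]] MM.ip_contract1[OF d s(2) test_fun_sq_int[OF \<phi>]]
      by simp
  qed
  then have "ip M ?F u = ip M ?G u" using F G u by (intro ip_cong_AE) auto
  then show ?thesis using MM.ip_contract1[OF d0 s(1) u] MM.ip_contract1[OF d s(2) u] by simp
qed

lemma block_deriv2:
  assumes \<alpha>: "\<alpha> \<in> multi_indices k" and \<beta>: "\<beta> \<in> multi_indices l"
    and \<phi>: "test_fun \<Omega> \<phi>" and u: "u \<in> sq_int M"
  shows "ip Q (block h \<alpha> (\<lambda>_. 0)) (tensor u (multi_deriv \<beta> \<phi>))
    = (-1) ^ multi_order \<beta> * ip Q (block h \<alpha> \<beta>) (tensor u \<phi>)"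
proof -
  let ?F = "MM.contract2 (block h \<alpha> (\<lambda>_. 0)) (multi_deriv \<beta> \<phi>)"
  let ?G = "\<lambda>x. (-1) ^ multi_order \<beta> * MM.contract2 (block h \<alpha> \<beta>) \<phi> x"
  note d0 = block_props(2)[OF \<alpha> zero_index_mem] and d = block_props(2)[OF \<alpha> \<beta>]
  note s = test_fun_multi_deriv_sq_int[OF \<phi>, of \<beta>] test_fun_sq_int[OF \<phi>]
  have F: "?F \<in> sq_int M" by (rule MM.contract2_sq_int[OF d0 s(1)])
  have G: "?G \<in> sq_int M" by (intro sq_int_scale MM.contract2_sq_int[OF d s(2)])
  have "AE x in M. ?F x = ?G x"
  proof (rule test_fun_AE_eq[OF F G])
    fix \<psi> assume \<psi>: "test_fun \<Omega> \<psi>"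
    have "(-1) ^ multi_order \<alpha> * ip Q (block h \<alpha> (\<lambda>_. 0)) (tensor \<psi> (multi_deriv \<beta> \<phi>))
        = ip Q h (tensor (multi_deriv \<alpha> \<psi>) (multi_deriv \<beta> \<phi>))"
      using block_test_tensor[OF \<alpha> zero_index_mem \<psi> test_fun_multi_deriv[OF \<phi>, of \<beta>]] by simp
    also have "\<dots> = (-1) ^ multi_order \<alpha> * ((-1) ^ multi_order \<beta> * ip Q (block h \<alpha> \<beta>) (tensor \<psi> \<phi>))"
      using block_test_tensor[OF \<alpha> \<beta> \<psi> \<phi>] by simp
    finally show "ip M ?F \<psi> = ip M ?G \<psi>"
      using MM.ip_contract2[OF d0 test_fun_sq_int[OF \<psi>] s(1)] MM.ip_contract2[OF d test_fun_sq_int[OF \<psi>] s(2)]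
      by simp
  qed
  then have "ip M ?F u = ip M ?G u" using F G u by (intro ip_cong_AE) auto
  then show ?thesis using MM.ip_contract2[OF d0 u s(1)] MM.ip_contract2[OF d u s(2)] by simp
qed

lemma kernel_sq_int: "kernel h \<in> sq_int R"
proof (rule sq_int_RI)
  fix \<alpha> \<beta> :: "'a \<Rightarrow> nat" assume "\<alpha> \<in> multi_indices k" "\<beta> \<in> multi_indices l"
  then show "(\<lambda>(x, y). kernel h ((\<alpha>, x), (\<beta>, y))) \<in> sq_int Q"
    using block_props(2) by (simp add: kernel_def)
qed

lemma ip_kernel_tensor:
  assumes F: "F \<in> sq_int (P k)" and G: "G \<in> sq_int (P l)"
  shows "ip R (kernel h) (tensor F G) = (\<Sum>\<alpha>\<in>multi_indices k. \<Sum>\<beta>\<in>multi_indices l.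
    ip Q (block h \<alpha> \<beta>) (tensor (\<lambda>x. F (\<alpha>, x)) (\<lambda>y. G (\<beta>, y))))"
  unfolding ip_R[OF kernel_sq_int PP.tensor_sq_int[OF F G]]
  by (simp add: kernel_def tensor_def)

lemma ip_kernel_single1:
  assumes \<alpha>: "\<alpha> \<in> multi_indices k" and \<psi>: "\<psi> \<in> sq_int M" and G: "G \<in> sq_int (P l)"
  shows "ip R (kernel h) (tensor (single \<alpha> \<psi>) G)
    = (\<Sum>\<beta>\<in>multi_indices l. ip Q (block h \<alpha> \<beta>) (tensor \<psi> (\<lambda>y. G (\<beta>, y))))"
proof -
  have "(\<Sum>\<beta>\<in>multi_indices l. ip Q (block h \<alpha>' \<beta>) (tensor (\<lambda>x. single \<alpha> \<psi> (\<alpha>', x)) (\<lambda>y. G (\<beta>, y))))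
      = (if \<alpha>' = \<alpha> then \<Sum>\<beta>\<in>multi_indices l. ip Q (block h \<alpha> \<beta>) (tensor \<psi> (\<lambda>y. G (\<beta>, y))) else 0)" for \<alpha>'
    by (simp add: single_def)
  then show ?thesis
    using \<alpha> by (simp add: ip_kernel_tensor[OF single_sq_int_P[OF \<psi>] G] finite_multi_indices)
qed

lemma ip_kernel_single2:
  assumes \<beta>: "\<beta> \<in> multi_indices l" and \<phi>: "\<phi> \<in> sq_int M" and F: "F \<in> sq_int (P k)"
  shows "ip R (kernel h) (tensor F (single \<beta> \<phi>))
    = (\<Sum>\<alpha>\<in>multi_indices k. ip Q (block h \<alpha> \<beta>) (tensor (\<lambda>x. F (\<alpha>, x)) \<phi>))"
proof -
  have "ip Q (block h \<alpha> \<beta>') (tensor (\<lambda>x. F (\<alpha>, x)) (\<lambda>y. single \<beta> \<phi> (\<beta>', y)))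
      = (if \<beta>' = \<beta> then ip Q (block h \<alpha> \<beta>) (tensor (\<lambda>x. F (\<alpha>, x)) \<phi>) else 0)" for \<alpha> \<beta>'
    by (simp add: single_def)
  then show ?thesis
    using \<beta> by (simp add: ip_kernel_tensor[OF F single_sq_int_P[OF \<phi>]] finite_multi_indices)
qed

text \<open>Supplies the span hypothesis of \<open>contract1_norm_sum\<close>. Tested against
  \<psi>, a component of the column is a sum of pairings of blocks with \<psi> and an entry of
  \<open>G\<close>, and \<open>block_deriv1\<close> moves the derivative in each summand although
  \<open>G\<close> is arbitrary.\<close>

lemma contract2_kernel_jets:
  assumes G: "G \<in> sq_int (P l)"
  shows "PP.contract2 (kernel h) G \<in> jets k"
  unfolding jets_def mem_Collect_eq
proof (intro conjI ballI)
  let ?C = "PP.contract2 (kernel h) G"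
  show C: "?C \<in> sq_int (P k)" by (rule PP.contract2_sq_int[OF kernel_sq_int G])
  fix \<alpha> :: "'a \<Rightarrow> nat" assume \<alpha>: "\<alpha> \<in> multi_indices k"
  have ipC: "ip M (\<lambda>x. ?C (\<alpha>', x)) \<psi> = (\<Sum>\<beta>\<in>multi_indices l. ip Q (block h \<alpha>' \<beta>) (tensor \<psi> (\<lambda>y. G (\<beta>, y))))"
    if \<alpha>': "\<alpha>' \<in> multi_indices k" and \<psi>: "\<psi> \<in> sq_int M" for \<alpha>' \<psi>
    using ip_single_P[OF C \<psi> \<alpha>'] PP.ip_contract2[OF kernel_sq_int single_sq_int_P[OF \<psi>] G]
      ip_kernel_single1[OF \<alpha>' \<psi> G] by simp
  show "has_weak_deriv \<Omega> \<alpha> (\<lambda>x. ?C (\<lambda>_. 0, x)) (\<lambda>x. ?C (\<alpha>, x))"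
    unfolding has_weak_deriv_iff[OF sq_int_PD[OF C zero_index_mem] sq_int_PD[OF C \<alpha>]]
  proof (intro allI impI)
    fix \<psi> assume \<psi>: "test_fun \<Omega> \<psi>"
    show "ip M (\<lambda>x. ?C (\<lambda>_. 0, x)) (multi_deriv \<alpha> \<psi>) = (-1) ^ multi_order \<alpha> * ip M (\<lambda>x. ?C (\<alpha>, x)) \<psi>"
      unfolding ipC[OF zero_index_mem test_fun_multi_deriv_sq_int[OF \<psi>]] ipC[OF \<alpha> test_fun_sq_int[OF \<psi>]]
        sum_distrib_left
      by (intro sum.cong refl block_deriv1 \<alpha> \<psi> sq_int_PD[OF G])
  qed
qed

text \<open>The components of the contraction are the weak derivatives of its entry at index 0. Its
  L2 norm is therefore the full H^l norm of the image function.\<close>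

lemma contract1_kernel_jets:
  assumes F: "F \<in> sq_int (P k)"
  shows "PP.contract1 (kernel h) F \<in> jets l"
  unfolding jets_def mem_Collect_eq
proof (intro conjI ballI)
  let ?C = "PP.contract1 (kernel h) F"
  show C: "?C \<in> sq_int (P l)" by (rule PP.contract1_sq_int(1)[OF kernel_sq_int F])
  fix \<beta> :: "'a \<Rightarrow> nat" assume \<beta>: "\<beta> \<in> multi_indices l"
  have ipC: "ip M (\<lambda>y. ?C (\<beta>', y)) \<phi> = (\<Sum>\<alpha>\<in>multi_indices k. ip Q (block h \<alpha> \<beta>') (tensor (\<lambda>x. F (\<alpha>, x)) \<phi>))"
    if \<beta>': "\<beta>' \<in> multi_indices l" and \<phi>: "\<phi> \<in> sq_int M" for \<beta>' \<phi>
    using ip_single_P[OF C \<phi> \<beta>'] PP.ip_contract1[OF kernel_sq_int F single_sq_int_P[OF \<phi>]]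
      ip_kernel_single2[OF \<beta>' \<phi> F] by simp
  show "has_weak_deriv \<Omega> \<beta> (\<lambda>y. ?C (\<lambda>_. 0, y)) (\<lambda>y. ?C (\<beta>, y))"
    unfolding has_weak_deriv_iff[OF sq_int_PD[OF C zero_index_mem] sq_int_PD[OF C \<beta>]]
  proof (intro allI impI)
    fix \<phi> assume \<phi>: "test_fun \<Omega> \<phi>"
    show "ip M (\<lambda>y. ?C (\<lambda>_. 0, y)) (multi_deriv \<beta> \<phi>) = (-1) ^ multi_order \<beta> * ip M (\<lambda>y. ?C (\<beta>, y)) \<phi>"
      unfolding ipC[OF zero_index_mem test_fun_multi_deriv_sq_int[OF \<phi>]] ipC[OF \<beta> test_fun_sq_int[OF \<phi>]]
        sum_distrib_left
      by (intro sum.cong refl block_deriv2 \<beta> \<phi> sq_int_PD[OF F])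
  qed
qed

text \<open>\<open>kernel_operator\<close> has the sum inside the integral. Pulling it out needs
  square-integrable sections of every block, which exist for almost every \<open>y\<close> only;
  \<kappa> is the version with the sum outside.\<close>

lemma kernel_operator_weak:
  assumes f: "f \<in> sobolev \<Omega> k"
  obtains \<kappa> where "\<kappa> \<in> sq_int M" "AE y in M. kernel_operator \<Omega> k h f y = \<kappa> y"
    "\<forall>u\<in>sq_int M. ip M \<kappa> u
      = (\<Sum>\<alpha>\<in>multi_indices k. ip Q (block h \<alpha> (\<lambda>_. 0)) (tensor (weak_deriv \<Omega> \<alpha> f) u))"
proof -
  let ?c = "\<lambda>\<alpha>. MM.contract1 (block h \<alpha> (\<lambda>_. 0)) (weak_deriv \<Omega> \<alpha> f)"
  let ?\<kappa> = "\<lambda>y. \<Sum>\<alpha>\<in>multi_indices k. ?c \<alpha> y"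
  have d: "block h \<alpha> (\<lambda>_. 0) \<in> sq_int Q" if "\<alpha> \<in> multi_indices k" for \<alpha>
    by (rule block_props(2)[OF that zero_index_mem])
  have w: "weak_deriv \<Omega> \<alpha> f \<in> sq_int M" if "\<alpha> \<in> multi_indices k" for \<alpha>
    by (rule sobolev_weak_deriv(2)[OF f that])
  have c: "?c \<alpha> \<in> sq_int M" if "\<alpha> \<in> multi_indices k" for \<alpha>
    by (rule MM.contract1_sq_int(1)[OF d[OF that] w[OF that]])
  have "AE y in M. \<forall>\<alpha>\<in>multi_indices k. (\<lambda>x. block h \<alpha> (\<lambda>_. 0) (x, y)) \<in> sq_int M"
    by (intro AE_finite_allI[OF finite_multi_indices] MM.AE_section_sq_int1 d)
  then have "AE y in M. kernel_operator \<Omega> k h f y = ?\<kappa> y"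
  proof eventually_elim
    case (elim y)
    show ?case
      unfolding kernel_operator_def MM.contract1_def block_def[symmetric]
      using elim w by (intro Bochner_Integration.integral_sum sq_int_integrable_mult) auto
  qed
  moreover have "?\<kappa> \<in> sq_int M" using c by (rule sq_int_sum)
  moreover have "ip M ?\<kappa> u = (\<Sum>\<alpha>\<in>multi_indices k. ip Q (block h \<alpha> (\<lambda>_. 0)) (tensor (weak_deriv \<Omega> \<alpha> f) u))"
    if u: "u \<in> sq_int M" for u
  proof -
    have "ip M ?\<kappa> u = (\<Sum>\<alpha>\<in>multi_indices k. ip M (?c \<alpha>) u)" by (rule ip_sum_left[OF c u])
    then show ?thesis using MM.ip_contract1[OF d w u] by simp
  qed
  ultimately show ?thesis by (intro that[of ?\<kappa>]) blast+
qed

lemma kernel_operator_AE: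
  assumes f: "f \<in> sobolev \<Omega> k"
  shows "AE y in M. kernel_operator \<Omega> k h f y = PP.contract1 (kernel h) (jet f) (\<lambda>_. 0, y)"
proof -
  obtain \<kappa> where \<kappa>: "\<kappa> \<in> sq_int M" and eq: "AE y in M. kernel_operator \<Omega> k h f y = \<kappa> y"
    and ip: "\<forall>u\<in>sq_int M. ip M \<kappa> u
      = (\<Sum>\<alpha>\<in>multi_indices k. ip Q (block h \<alpha> (\<lambda>_. 0)) (tensor (weak_deriv \<Omega> \<alpha> f) u))"
    by (rule kernel_operator_weak[OF f])
  let ?C = "PP.contract1 (kernel h) (jet f)"
  have C: "?C \<in> sq_int (P l)" by (rule PP.contract1_sq_int(1)[OF kernel_sq_int jet_sq_int[OF f]])
  have "AE y in M. \<kappa> y = ?C (\<lambda>_. 0, y)"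
  proof (rule sq_int_AE_eqI[OF \<kappa> sq_int_PD[OF C zero_index_mem]])
    fix u assume u: "u \<in> sq_int M"
    have "ip M (\<lambda>y. ?C (\<lambda>_. 0, y)) u = (\<Sum>\<alpha>\<in>multi_indices k. ip Q (block h \<alpha> (\<lambda>_. 0)) (tensor (\<lambda>x. jet f (\<alpha>, x)) u))"
      using ip_single_P[OF C u zero_index_mem] PP.ip_contract1[OF kernel_sq_int jet_sq_int[OF f] single_sq_int_P[OF u]]
        ip_kernel_single2[OF zero_index_mem u jet_sq_int[OF f]] by simp
    then show "ip M \<kappa> u = ip M (\<lambda>y. ?C (\<lambda>_. 0, y)) u" using bspec[OF ip u] by (simp add: jet_def)
  qed
  with eq show ?thesis by eventually_elim simp
qed

lemma ip_kernel_self: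
  "ennreal (ip R (kernel h) (kernel h)) = (\<Sum>\<alpha>\<in>multi_indices k. \<Sum>\<beta>\<in>multi_indices l.
     L2_norm_sq (\<Omega> \<times> \<Omega>) (weak_deriv (\<Omega> \<times> \<Omega>) (pair_index \<alpha> \<beta>) h))"
proof -
  have "L2_norm_sq (\<Omega> \<times> \<Omega>) (weak_deriv (\<Omega> \<times> \<Omega>) (pair_index \<alpha> \<beta>) h)
      = ennreal (ip Q (block h \<alpha> \<beta>) (block h \<alpha> \<beta>))" if "\<alpha> \<in> multi_indices k" "\<beta> \<in> multi_indices l" for \<alpha> \<beta>
    using PD.L2_norm_sq_eq[folded Q_eq, OF block_props(2)[OF that]] by (simp add: block_def)
  moreover have "ip R (kernel h) (kernel h)
      = (\<Sum>\<alpha>\<in>multi_indices k. \<Sum>\<beta>\<in>multi_indices l. ip Q (block h \<alpha> \<beta>) (block h \<alpha> \<beta>))"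
    unfolding ip_R[OF kernel_sq_int kernel_sq_int] by (simp add: kernel_def)
  ultimately show ?thesis by (simp add: sum_nonneg)
qed

text \<open>The value does not involve \<open>E\<close>, which makes the Hilbert-Schmidt norm well
  defined and finite.\<close>

lemma hs_sum_kernel_operator:
  assumes T: "sobolev_bounded_linear \<Omega> k l T" and op: "is_kernel_operator \<Omega> k T h"
    and E: "sobolev_onb \<Omega> k E"
  shows "hs_sum \<Omega> l T E = ennreal (ip R (kernel h) (kernel h))"
proof -
  have norm: "sobolev_norm \<Omega> l (T e) = nrm (P l) (PP.contract1 (kernel h) (jet e))" if "e \<in> E" for e
  proof -
    have e: "e \<in> sobolev \<Omega> k" using E that by (auto simp: sobolev_onb_def)
    have Te: "T e \<in> sobolev \<Omega> l" using T e by (simp add: sobolev_bounded_linear_def)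
    have "AE y in M. T e y = kernel_operator \<Omega> k h e y" using op e by (simp add: is_kernel_operator_def)
    then have "AE y in M. T e y = PP.contract1 (kernel h) (jet e) (\<lambda>_. 0, y)"
      using kernel_operator_AE[OF e] by eventually_elim simp
    note jets_AE(2)[OF sobolev_sq_int[OF Te] contract1_kernel_jets[OF jet_sq_int[OF e]] this]
    then show ?thesis
      unfolding sobolev_norm_eq[OF Te]
      by (intro nrm_cong_AE jet_sq_int[OF Te] PP.contract1_sq_int(1)[OF kernel_sq_int jet_sq_int[OF e]])
  qed
  have "hs_sum \<Omega> l T E = (\<Sum>\<^sub>\<infinity>e\<in>E. ennreal ((nrm (P l) (PP.contract1 (kernel h) (jet e)))\<^sup>2))"
    unfolding hs_sum_def by (rule infsum_cong) (simp add: norm)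
  also have "\<dots> = ennreal (ip R (kernel h) (kernel h))"
    by (rule PP.contract1_norm_sum[OF kernel_sq_int sobolev_onb_jet(1)[OF E]])
      (rule sobolev_onb_jet(2)[OF E contract2_kernel_jets])
  finally show ?thesis .
qed

end

end

section \<open>Hilbert--Schmidt operators\<close>

context bounded_domain
begin

lemma has_weak_deriv_sum:
  assumes "finite A" "\<And>i. i \<in> A \<Longrightarrow> f i \<in> sq_int M" "\<And>i. i \<in> A \<Longrightarrow> g i \<in> sq_int M"
    "\<And>i. i \<in> A \<Longrightarrow> has_weak_deriv \<Omega> \<alpha> (f i) (g i)"
  shows "has_weak_deriv \<Omega> \<alpha> (\<lambda>x. \<Sum>i\<in>A. f i x) (\<lambda>x. \<Sum>i\<in>A. g i x)"
  using assms
proof (induction A)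
  case empty
  show ?case by (simp add: has_weak_deriv_iff)
next
  case (insert i A)
  have "has_weak_deriv \<Omega> \<alpha> (\<lambda>x. 1 * f i x + 1 * (\<Sum>i\<in>A. f i x)) (\<lambda>x. 1 * g i x + 1 * (\<Sum>i\<in>A. g i x))"
    using insert by (intro has_weak_deriv_combination sq_int_sum) auto
  then show ?case using insert.hyps by simp
qed

lemma sobolev_zero: "(\<lambda>_. 0) \<in> sobolev \<Omega> k"
proof (rule jets_AE(1)[where G = "\<lambda>_. 0"])
  show "(\<lambda>_. 0) \<in> jets k" by (auto simp: jets_def has_weak_deriv_iff)
qed auto

lemma sobolev_combination:
  assumes f: "f \<in> sobolev \<Omega> k" and g: "g \<in> sobolev \<Omega> k"
  shows "(\<lambda>x. a * f x + b * g x) \<in> sobolev \<Omega> k"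
proof (rule jets_AE(1)[OF _ jets_combination[OF jet_in_jets[OF f] jet_in_jets[OF g]]])
  show "(\<lambda>x. a * f x + b * g x) \<in> sq_int M" by (intro sq_int_add sq_int_scale sobolev_sq_int[OF f] sobolev_sq_int[OF g])
  show "AE x in M. a * f x + b * g x = a * jet f (\<lambda>_. 0, x) + b * jet g (\<lambda>_. 0, x)"
    using jet_zero_AE[OF f] jet_zero_AE[OF g] by eventually_elim simp
qed

text \<open>Linearity of \<open>T\<close> is given for two summands and up to null sets, so it is
  extended to finite sums by induction, collecting finitely many exceptional sets.\<close>

lemma bounded_linear_residual:
  assumes T: "sobolev_bounded_linear \<Omega> k l T"
    and f: "f \<in> sobolev \<Omega> k" and A: "finite A" "A \<subseteq> sobolev \<Omega> k"
  shows "AE y in M. T (\<lambda>x. f x - (\<Sum>e\<in>A. c e * e x)) y = T f y - (\<Sum>e\<in>A. c e * T e y)"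
proof -
  have lin: "AE y in M. T (\<lambda>x. a * f x + b * g x) y = a * T f y + b * T g y"
    if "f \<in> sobolev \<Omega> k" "g \<in> sobolev \<Omega> k" for f g a b
    using T that unfolding sobolev_bounded_linear_def by simp
  have "(\<lambda>x. \<Sum>e\<in>A. c e * e x) \<in> sobolev \<Omega> k \<and>
      (AE y in M. T (\<lambda>x. \<Sum>e\<in>A. c e * e x) y = (\<Sum>e\<in>A. c e * T e y))"
    using A
  proof (induction A)
    case empty
    \<comment> \<open>The zero function is the combination with coefficients 0 and 0, so
      \<open>T\<close> sends it to zero almost everywhere.\<close>
    show ?case using sobolev_zero lin[OF sobolev_zero sobolev_zero, of 0 0] by simp
  next
    case (insert e A)
    then have e: "e \<in> sobolev \<Omega> k" and s: "(\<lambda>x. \<Sum>e\<in>A. c e * e x) \<in> sobolev \<Omega> k"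
      and IH: "AE y in M. T (\<lambda>x. \<Sum>e\<in>A. c e * e x) y = (\<Sum>e\<in>A. c e * T e y)" by auto
    have eq: "(\<lambda>x. \<Sum>e\<in>insert e A. c e * e x) = (\<lambda>x. c e * e x + 1 * (\<Sum>e\<in>A. c e * e x))"
      using insert.hyps by simp
    show ?case
      unfolding eq
    proof
      show "(\<lambda>x. c e * e x + 1 * (\<Sum>e\<in>A. c e * e x)) \<in> sobolev \<Omega> k" by (rule sobolev_combination[OF e s])
      show "AE y in M. T (\<lambda>x. c e * e x + 1 * (\<Sum>e\<in>A. c e * e x)) y = (\<Sum>e\<in>insert e A. c e * T e y)"
        using lin[OF e s, of "c e" 1] IH by eventually_elim (use insert.hyps in simp)
    qed
  qed
  then have s: "(\<lambda>x. \<Sum>e\<in>A. c e * e x) \<in> sobolev \<Omega> k"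
    and eq: "AE y in M. T (\<lambda>x. \<Sum>e\<in>A. c e * e x) y = (\<Sum>e\<in>A. c e * T e y)" by auto
  show ?thesis using lin[OF f s, of 1 "-1"] eq by eventually_elim simp
qed

lemma bounded_linear_jet_residual:
  assumes T: "sobolev_bounded_linear \<Omega> k l T"
  shows "\<exists>C\<ge>0. \<forall>f\<in>sobolev \<Omega> k. \<forall>A c. finite A \<longrightarrow> A \<subseteq> sobolev \<Omega> k \<longrightarrow>
    nrm (P l) (\<lambda>p. jet (T f) p - (\<Sum>e\<in>A. c e * jet (T e) p))
      \<le> C * nrm (P k) (\<lambda>p. jet f p - (\<Sum>e\<in>A. c e * jet e p))"
proof -
  have TS: "T f \<in> sobolev \<Omega> l" if "f \<in> sobolev \<Omega> k" for f
    using T that by (simp add: sobolev_bounded_linear_def)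
  obtain C where C: "\<forall>f\<in>sobolev \<Omega> k. sobolev_norm \<Omega> l (T f) \<le> C * sobolev_norm \<Omega> k f"
    using T unfolding sobolev_bounded_linear_def by (elim conjE exE)
  have "nrm (P l) (\<lambda>p. jet (T f) p - (\<Sum>e\<in>A. c e * jet (T e) p))
      \<le> \<bar>C\<bar> * nrm (P k) (\<lambda>p. jet f p - (\<Sum>e\<in>A. c e * jet e p))"
    if f: "f \<in> sobolev \<Omega> k" and A: "finite A" "A \<subseteq> sobolev \<Omega> k" for f A c
  proof -
    let ?f = "\<lambda>x. f x - (\<Sum>e\<in>A. c e * e x)" and ?g = "\<lambda>y. T f y - (\<Sum>e\<in>A. c e * T e y)"
    have sf: "?f \<in> sobolev \<Omega> k" by (rule jet_residual(1)[OF f _ A(1)]) (rule subsetD[OF A(2)])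
    have sg: "?g \<in> sobolev \<Omega> l" by (rule jet_residual(1)[OF TS[OF f] _ A(1)]) (rule TS, rule subsetD[OF A(2)])
    have nf: "sobolev_norm \<Omega> k ?f = nrm (P k) (\<lambda>p. jet f p - (\<Sum>e\<in>A. c e * jet e p))"
      by (rule sobolev_norm_residual[OF f _ A(1)]) (rule subsetD[OF A(2)])
    have ng: "sobolev_norm \<Omega> l ?g = nrm (P l) (\<lambda>p. jet (T f) p - (\<Sum>e\<in>A. c e * jet (T e) p))"
      by (rule sobolev_norm_residual[OF TS[OF f] _ A(1)]) (rule TS, rule subsetD[OF A(2)])
    have "sobolev_norm \<Omega> l ?g = sobolev_norm \<Omega> l (T ?f)"
      unfolding sobolev_norm_eq[OF sg] sobolev_norm_eq[OF TS[OF sf]]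
    proof (rule nrm_cong_AE[OF jet_sq_int[OF sg] jet_sq_int[OF TS[OF sf]]])
      have "AE y in M. ?g y = T ?f y"
        using bounded_linear_residual[OF T f A, of c] by eventually_elim simp
      then show "AE p in P l. jet ?g p = jet (T ?f) p" by (rule jet_cong_AE[OF sg TS[OF sf]])
    qed
    also have "\<dots> \<le> C * sobolev_norm \<Omega> k ?f" using C sf by blast
    \<comment> \<open>The bound in the definition carries no sign condition; the later estimates
      need a nonnegative constant.\<close>
    also have "\<dots> \<le> \<bar>C\<bar> * sobolev_norm \<Omega> k ?f"
      unfolding nf by (intro mult_right_mono) auto
    finally show ?thesis unfolding nf ng .
  qed
  then show ?thesis by (intro exI[of _ "\<bar>C\<bar>"]) simp
qed

end

section \<open>Reconstruction of the kernel from a Hilbert-Schmidt operator\<close>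

context kernel_domain
begin

text \<open>Both sides are linear and continuous in \<open>f\<close>: the left one by boundedness of
  \<open>T\<close>, the right one by Cauchy-Schwarz against \<open>K\<close>. Agreement on the basis
  therefore suffices.\<close>

lemma ip_eq_by_density:
  assumes T: "sobolev_bounded_linear \<Omega> k l T" and E: "sobolev_onb \<Omega> k E" and K: "K \<in> sq_int R"
    and g: "g \<in> sq_int (P l)"
    and basis: "\<And>e. e \<in> E \<Longrightarrow> ip (P l) (jet (T e)) g = ip R K (tensor (jet e) g)"
    and f: "f \<in> sobolev \<Omega> k"
  shows "ip (P l) (jet (T f)) g = ip R K (tensor (jet f) g)"
proof -
  have ES: "E \<subseteq> sobolev \<Omega> k" using E by (simp add: sobolev_onb_def)
  have TS: "T f \<in> sobolev \<Omega> l" if "f \<in> sobolev \<Omega> k" for f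
    using T that by (simp add: sobolev_bounded_linear_def)
  obtain C where C0: "C \<ge> 0" and C: "\<forall>f\<in>sobolev \<Omega> k. \<forall>A c. finite A \<longrightarrow> A \<subseteq> sobolev \<Omega> k \<longrightarrow>
    nrm (P l) (\<lambda>p. jet (T f) p - (\<Sum>e\<in>A. c e * jet (T e) p))
      \<le> C * nrm (P k) (\<lambda>p. jet f p - (\<Sum>e\<in>A. c e * jet e p))"
    using bounded_linear_jet_residual[OF T] by (elim exE conjE)
  define d where "d = ip (P l) (jet (T f)) g - ip R K (tensor (jet f) g)"
  define B where "B = (C + nrm R K) * nrm (P l) g"
  have B0: "B \<ge> 0" using C0 by (simp add: B_def)
  have bound: "\<bar>d\<bar> \<le> B * \<epsilon>" if "\<epsilon> > 0" for \<epsilon>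
  proof -
    from sobolev_onb_jet(2)[OF E jet_in_jets[OF f]] \<open>\<epsilon> > 0\<close> obtain A c where A: "finite A" "A \<subseteq> E"
      and less: "nrm (P k) (\<lambda>p. jet f p - (\<Sum>e\<in>A. c e * jet e p)) < \<epsilon>"
      unfolding approximable_def by (elim allE impE exE conjE)
    have AS: "A \<subseteq> sobolev \<Omega> k" using A ES by simp
    let ?r = "\<lambda>p. jet f p - (\<Sum>e\<in>A. c e * jet e p)"
    let ?r' = "\<lambda>p. jet (T f) p - (\<Sum>e\<in>A. c e * jet (T e) p)"
    have je: "jet e \<in> sq_int (P k)" "jet (T e) \<in> sq_int (P l)" if "e \<in> A" for e
      using that AS by (auto intro: jet_sq_int TS)
    have jf: "jet f \<in> sq_int (P k)" "jet (T f) \<in> sq_int (P l)" by (intro jet_sq_int TS f)+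
    have s: "(\<lambda>p. \<Sum>e\<in>A. c e * jet (T e) p) \<in> sq_int (P l)" by (intro sq_int_sum sq_int_scale je)
    have s': "(\<lambda>p. \<Sum>e\<in>A. c e * jet e p) \<in> sq_int (P k)" by (intro sq_int_sum sq_int_scale je)
    note r = sq_int_diff[OF jf(1) s'] sq_int_diff[OF jf(2) s]
    have te: "tensor (jet e) g \<in> sq_int R" if "e \<in> A" for e by (intro PP.tensor_sq_int je that g)
    have ts: "(\<lambda>p. \<Sum>e\<in>A. c e * tensor (jet e) g p) \<in> sq_int R" by (intro sq_int_sum sq_int_scale te)
    have 1: "ip (P l) ?r' g = ip (P l) (jet (T f)) g - (\<Sum>e\<in>A. c e * ip (P l) (jet (T e)) g)"
      unfolding ip_diff_left[OF jf(2) s g]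
      by (subst ip_sum_left, rule sq_int_scale, erule je(2), rule g, simp)
    have "tensor ?r g = (\<lambda>p. tensor (jet f) g p - (\<Sum>e\<in>A. c e * tensor (jet e) g p))"
      by (auto simp: tensor_def left_diff_distrib sum_distrib_right mult.assoc)
    then have "ip R K (tensor ?r g) = ip R K (tensor (jet f) g) - (\<Sum>e\<in>A. c e * ip R K (tensor (jet e) g))"
      using ip_diff_right[OF PP.tensor_sq_int[OF jf(1) g] ts K]
      by (simp add: ip_sum_right te K)
    also have "(\<Sum>e\<in>A. c e * ip R K (tensor (jet e) g)) = (\<Sum>e\<in>A. c e * ip (P l) (jet (T e)) g)"
      by (intro sum.cong refl) (use A basis in auto)
    finally have "d = ip (P l) ?r' g - ip R K (tensor ?r g)" unfolding d_def 1 by simp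
    then have "\<bar>d\<bar> \<le> \<bar>ip (P l) ?r' g\<bar> + \<bar>ip R K (tensor ?r g)\<bar>" by simp
    also have "\<dots> \<le> nrm (P l) ?r' * nrm (P l) g + nrm R K * (nrm (P k) ?r * nrm (P l) g)"
      using ip_Cauchy_Schwarz[OF r(2) g] ip_Cauchy_Schwarz[OF K PP.tensor_sq_int[OF r(1) g]]
      unfolding PP.nrm_tensor[OF r(1) g] by (rule add_mono)
    also have "\<dots> \<le> (C * nrm (P k) ?r) * nrm (P l) g + nrm R K * (nrm (P k) ?r * nrm (P l) g)"
      using C f A(1) AS by (intro add_right_mono mult_right_mono) auto
    also have "\<dots> = B * nrm (P k) ?r" by (simp add: B_def algebra_simps)
    also have "\<dots> \<le> B * \<epsilon>" using less B0 by (intro mult_left_mono) auto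
    finally show ?thesis .
  qed
  have "d = 0"
  proof (rule ccontr)
    assume "d \<noteq> 0"
    \<comment> \<open>\<open>B\<close> may be 0, hence \<open>B + 1\<close> in the denominator; the
      resulting bound is strictly below the absolute value of \<open>d\<close>.\<close>
    then have "\<bar>d\<bar> \<le> B * (\<bar>d\<bar> / (B + 1))" using B0 by (intro bound) simp
    then have "\<bar>d\<bar> * (B + 1) \<le> B * \<bar>d\<bar>" using B0 by (simp add: field_simps)
    with \<open>d \<noteq> 0\<close> show False by (simp add: algebra_simps)
  qed
  then show ?thesis by (simp add: d_def)
qed

text \<open>The terms of the series are tensors of whole jets, so a single L2 limit contains all
  mixed derivatives at once. They are orthogonal because the first factors are, and their squared
  norms are those of the \<open>T e\<close>, whose sum is finite.\<close>

lemma hilbert_schmidt_kernel: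
  assumes T: "sobolev_bounded_linear \<Omega> k l T" and E: "sobolev_onb \<Omega> k E"
    and fin: "hs_sum \<Omega> l T E < \<infinity>"
  shows "\<exists>h\<in>mixed_sobolev \<Omega> k l. is_kernel_operator \<Omega> k T h"
proof -
  have ES: "e \<in> sobolev \<Omega> k" if "e \<in> E" for e using E that by (auto simp: sobolev_onb_def)
  have TS: "T f \<in> sobolev \<Omega> l" if "f \<in> sobolev \<Omega> k" for f
    using T that by (simp add: sobolev_bounded_linear_def)
  have je: "jet e \<in> sq_int (P k)" if "e \<in> E" for e by (rule jet_sq_int[OF ES[OF that]])
  have jT: "jet (T e) \<in> sq_int (P l)" if "e \<in> E" for e by (rule jet_sq_int[OF TS[OF ES[OF that]]])
  note onb = orthonormal_ip[OF sobolev_onb_jet(1)[OF E]]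
  let ?u = "\<lambda>e. tensor (jet e) (jet (T e))"
  have ip_u: "ip R (?u e) (tensor (jet e') g) = (if e = e' then ip (P l) (jet (T e)) g else 0)"
    if "e \<in> E" "e' \<in> E" "g \<in> sq_int (P l)" for e e' g
    by (simp add: PP.ip_tensor je jT that onb)
  have us: "\<forall>e\<in>E. ?u e \<in> sq_int R" using je jT by simp
  have orth: "\<forall>e\<in>E. \<forall>e'\<in>E. e \<noteq> e' \<longrightarrow> ip R (?u e) (?u e') = 0" using ip_u jT by simp
  have "\<forall>A. finite A \<longrightarrow> A \<subseteq> E \<longrightarrow> (\<Sum>e\<in>A. ip R (?u e) (?u e)) \<le> enn2real (hs_sum \<Omega> l T E)"
  proof (intro allI impI)
    fix A assume A: "finite A" "A \<subseteq> E"
    have "ip R (?u e) (?u e) = (sobolev_norm \<Omega> l (T e))\<^sup>2" if "e \<in> A" for e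
    proof -
      have e: "e \<in> E" using that A by blast
      show ?thesis using ip_u[OF e e jT[OF e]] sobolev_norm_eq[OF TS[OF ES[OF e]]] by (simp add: nrm_sq)
    qed
    then have "ennreal (\<Sum>e\<in>A. ip R (?u e) (?u e)) = (\<Sum>e\<in>A. ennreal ((sobolev_norm \<Omega> l (T e))\<^sup>2))"
      by (simp add: sum_ennreal)
    also have "\<dots> = (\<Sum>\<^sub>\<infinity>e\<in>A. ennreal ((sobolev_norm \<Omega> l (T e))\<^sup>2))"
      by (rule infsum_finite[OF A(1), symmetric])
    also have "\<dots> \<le> hs_sum \<Omega> l T E"
      unfolding hs_sum_def by (rule infsum_mono_neutral) (use A in \<open>auto intro!: nonneg_summable_on_complete\<close>)
    also have "\<dots> = ennreal (enn2real (hs_sum \<Omega> l T E))" using fin by simp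
    finally show "(\<Sum>e\<in>A. ip R (?u e) (?u e)) \<le> enn2real (hs_sum \<Omega> l T E)" by simp
  qed
  from PP.P.orthogonal_series[OF us orth this] obtain K F where K: "K \<in> sq_int R"
    and F1: "\<forall>n. finite (F n)" and F2: "\<forall>n. F n \<subseteq> E"
    and lim: "(\<lambda>n. nrm R (\<lambda>p. (\<Sum>e\<in>F n. ?u e p) - K p)) \<longlonglongrightarrow> 0"
    and tail: "\<forall>n. \<forall>e\<in>E - F n. ip R (?u e) (?u e) \<le> (1/4) ^ n"
    by (elim exE conjE)
  have FE: "e \<in> E" if "e \<in> F n" for e n using F2 that by blast
  let ?K = "\<lambda>n p. \<Sum>e\<in>F n. ?u e p"
  have Kn: "?K n \<in> sq_int R" for n using us FE by (intro sq_int_sum) blast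
  \<comment> \<open>The block of \<open>K\<close> at the indices 0 and 0; the remaining blocks turn
    out to be its mixed derivatives because weak differentiation is closed.\<close>
  define h where "h = (\<lambda>(x, y). K ((\<lambda>_. 0, x), (\<lambda>_. 0, y)))"
  have hs: "h \<in> sq_int Q" unfolding h_def by (rule sq_int_RD[OF K zero_index_mem zero_index_mem])
  have deriv: "has_weak_deriv (\<Omega> \<times> \<Omega>) (pair_index \<alpha> \<beta>) h (\<lambda>(x, y). K ((\<alpha>, x), (\<beta>, y)))"
    if \<alpha>: "\<alpha> \<in> multi_indices k" and \<beta>: "\<beta> \<in> multi_indices l" for \<alpha> \<beta>
  proof -
    let ?c = "\<lambda>\<alpha> \<beta> F. (\<lambda>(x, y). F ((\<alpha>, x), (\<beta>, y))) :: 'a \<times> 'a \<Rightarrow> real"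
    have comp: "(\<lambda>n. nrm Q (\<lambda>p. ?c \<alpha> \<beta> (?K n) p - ?c \<alpha> \<beta> K p)) \<longlonglongrightarrow> 0"
      if "\<alpha> \<in> multi_indices k" "\<beta> \<in> multi_indices l" for \<alpha> \<beta>
    proof (rule tendsto_sandwich[OF _ _ tendsto_const lim])
      have "(\<lambda>p. ?c \<alpha> \<beta> (?K n) p - ?c \<alpha> \<beta> K p) = ?c \<alpha> \<beta> (\<lambda>p. ?K n p - K p)" for n by auto
      then show "\<forall>\<^sub>F n in sequentially. nrm Q (\<lambda>p. ?c \<alpha> \<beta> (?K n) p - ?c \<alpha> \<beta> K p) \<le> nrm R (\<lambda>p. ?K n p - K p)"
        using nrm_R_component[OF sq_int_diff[OF Kn K] that] by simp
    qed simp
    have wd: "has_weak_deriv (\<Omega> \<times> \<Omega>) (pair_index \<alpha> \<beta>) (?c (\<lambda>_. 0) (\<lambda>_. 0) (?K n)) (?c \<alpha> \<beta> (?K n))" for n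
    proof -
      let ?t = "\<lambda>\<alpha> \<beta> e. tensor (\<lambda>x. jet e (\<alpha>, x)) (\<lambda>y. jet (T e) (\<beta>, y))"
      have eq: "?c \<alpha> \<beta> (?K n) = (\<lambda>p. \<Sum>e\<in>F n. ?t \<alpha> \<beta> e p)" for \<alpha> \<beta> by (auto simp: tensor_def)
      have ts: "?t \<alpha> \<beta> e \<in> sq_int (lborel_on (\<Omega> \<times> \<Omega>))"
        if "e \<in> E" "\<alpha> \<in> multi_indices k" "\<beta> \<in> multi_indices l" for e \<alpha> \<beta>
        unfolding Q_eq[symmetric]
        by (intro MM.tensor_sq_int sq_int_PD[OF je] sq_int_PD[OF jT] that)
      show ?thesis
        unfolding eq
      proof (rule PD.has_weak_deriv_sum)
        fix e assume "e \<in> F n"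
        note e = FE[OF this]
        show "has_weak_deriv (\<Omega> \<times> \<Omega>) (pair_index \<alpha> \<beta>) (?t (\<lambda>_. 0) (\<lambda>_. 0) e) (?t \<alpha> \<beta> e)"
        proof (rule has_weak_deriv_tensor)
          show "has_weak_deriv \<Omega> \<alpha> (\<lambda>x. jet e (\<lambda>_. 0, x)) (\<lambda>x. jet e (\<alpha>, x))"
            using jet_in_jets[OF ES[OF e]] \<alpha> by (simp add: jets_def)
          show "has_weak_deriv \<Omega> \<beta> (\<lambda>y. jet (T e) (\<lambda>_. 0, y)) (\<lambda>y. jet (T e) (\<beta>, y))"
            using jet_in_jets[OF TS[OF ES[OF e]]] \<beta> by (simp add: jets_def)
        qed (rule sq_int_PD[OF je[OF e]] sq_int_PD[OF jT[OF e]], rule \<alpha> \<beta> zero_index_mem)+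
      qed (use F1 FE ts \<alpha> \<beta> zero_index_mem in blast)+
    qed
    show ?thesis
      unfolding h_def
      by (rule PD.has_weak_deriv_limit[folded Q_eq, OF _ _ _ _ wd
            comp[OF zero_index_mem zero_index_mem] comp[OF \<alpha> \<beta>]])
        (rule sq_int_RD[OF Kn] sq_int_RD[OF K], rule \<alpha> \<beta> zero_index_mem, rule \<alpha> \<beta> zero_index_mem)+
  qed
  have h: "h \<in> mixed_sobolev \<Omega> k l"
    unfolding mixed_sobolev_def mem_Collect_eq L2_Q_eq
  proof (intro conjI hs ballI)
    fix \<alpha> \<beta> :: "'a \<Rightarrow> nat" assume "\<alpha> \<in> multi_indices k" "\<beta> \<in> multi_indices l"
    then show "\<exists>g\<in>sq_int Q. has_weak_deriv (\<Omega> \<times> \<Omega>) (pair_index \<alpha> \<beta>) h g"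
      using deriv sq_int_RD[OF K] by (intro bexI[of _ "\<lambda>(x, y). K ((\<alpha>, x), (\<beta>, y))"])
  qed
  \<comment> \<open>\<open>kernel h\<close> is built from representatives chosen by
    \<open>weak_deriv\<close>, so its blocks agree with those of \<open>K\<close> only almost
    everywhere.\<close>
  have ker: "ip R (kernel h) (tensor G g) = ip R K (tensor G g)"
    if G: "G \<in> sq_int (P k)" and g: "g \<in> sq_int (P l)" for G g
    unfolding ip_R[OF kernel_sq_int[OF h] PP.tensor_sq_int[OF G g]] ip_R[OF K PP.tensor_sq_int[OF G g]]
  proof (intro sum.cong refl ip_cong_AE)
    fix \<alpha> \<beta> :: "'a \<Rightarrow> nat" assume \<alpha>: "\<alpha> \<in> multi_indices k" and \<beta>: "\<beta> \<in> multi_indices l"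
    show "(\<lambda>(x, y). kernel h ((\<alpha>, x), (\<beta>, y))) \<in> sq_int Q" by (rule sq_int_RD[OF kernel_sq_int[OF h] \<alpha> \<beta>])
    show "(\<lambda>(x, y). K ((\<alpha>, x), (\<beta>, y))) \<in> sq_int Q" by (rule sq_int_RD[OF K \<alpha> \<beta>])
    show "(\<lambda>(x, y). tensor G g ((\<alpha>, x), (\<beta>, y))) \<in> sq_int Q"
      "(\<lambda>(x, y). tensor G g ((\<alpha>, x), (\<beta>, y))) \<in> sq_int Q"
      by (rule sq_int_RD[OF PP.tensor_sq_int[OF G g] \<alpha> \<beta>])+
    show "AE p in Q. (\<lambda>(x, y). kernel h ((\<alpha>, x), (\<beta>, y))) p = (\<lambda>(x, y). K ((\<alpha>, x), (\<beta>, y))) p"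
      using PD.weak_deriv_eq(2)[folded Q_eq, OF deriv[OF \<alpha> \<beta>]]
      by (simp add: kernel_def block_def case_prod_beta')
  qed simp
  \<comment> \<open>By orthogonality only the term of \<open>e\<close> itself contributes. If it is
    absent from \<open>F n\<close>, the tail bound makes the missing contribution at most
    \<open>(1/2) ^ n * nrm (P l) g\<close>.\<close>
  have basis: "ip (P l) (jet (T e)) g = ip R K (tensor (jet e) g)" if e: "e \<in> E" and g: "g \<in> sq_int (P l)" for e g
  proof (rule LIMSEQ_unique)
    show "(\<lambda>n. ip R (?K n) (tensor (jet e) g)) \<longlonglongrightarrow> ip R K (tensor (jet e) g)"
      by (rule ip_tendsto[OF Kn K PP.tensor_sq_int[OF je[OF e] g] lim])
    have val: "ip R (?K n) (tensor (jet e) g) = (if e \<in> F n then ip (P l) (jet (T e)) g else 0)" for n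
    proof -
      have "ip R (?K n) (tensor (jet e) g) = (\<Sum>e'\<in>F n. ip R (?u e') (tensor (jet e) g))"
        by (rule ip_sum_left) (use us FE in blast, rule PP.tensor_sq_int[OF je[OF e] g])
      also have "\<dots> = (\<Sum>e'\<in>F n. if e' = e then ip (P l) (jet (T e)) g else 0)"
        by (intro sum.cong refl) (simp add: ip_u[OF FE e g])
      also have "\<dots> = (if e \<in> F n then ip (P l) (jet (T e)) g else 0)"
        using F1 by simp
      finally show ?thesis .
    qed
    show "(\<lambda>n. ip R (?K n) (tensor (jet e) g)) \<longlonglongrightarrow> ip (P l) (jet (T e)) g"
    proof (rule Lim_null_comparison[THEN LIM_zero_cancel])
      show "\<forall>\<^sub>F n in sequentially. norm (ip R (?K n) (tensor (jet e) g) - ip (P l) (jet (T e)) g) \<le> (1/2) ^ n * nrm (P l) g"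
      proof (rule always_eventually, rule allI)
        fix n
        have "\<bar>ip (P l) (jet (T e)) g\<bar> \<le> (1/2) ^ n * nrm (P l) g" if "e \<notin> F n"
        proof -
          have "nrm (P l) (jet (T e)) \<le> (1/2) ^ n"
          proof (rule power2_le_imp_le)
            have "(nrm (P l) (jet (T e)))\<^sup>2 \<le> (1/4) ^ n"
              using bspec[OF spec[OF tail, of n], of e] e that ip_u[OF e e jT[OF e]] by (simp add: nrm_sq)
            also have "\<dots> = ((1/2) ^ n)\<^sup>2" by (simp add: power2_eq_square flip: power_mult_distrib)
            finally show "(nrm (P l) (jet (T e)))\<^sup>2 \<le> ((1/2) ^ n)\<^sup>2" .
          qed simp
          then show ?thesis
            using ip_Cauchy_Schwarz[OF jT[OF e] g] mult_right_mono[OF _ nrm_nonneg[of "P l" g]] order_trans by blast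
        qed
        then show "norm (ip R (?K n) (tensor (jet e) g) - ip (P l) (jet (T e)) g) \<le> (1/2) ^ n * nrm (P l) g"
          unfolding val by simp
      qed
      have "(\<lambda>n. (1/2) ^ n * nrm (P l) g) \<longlonglongrightarrow> 0 * nrm (P l) g"
        by (intro tendsto_intros LIMSEQ_power_zero) simp
      then show "(\<lambda>n. (1/2) ^ n * nrm (P l) g) \<longlonglongrightarrow> 0" by simp
    qed
  qed
  have "is_kernel_operator \<Omega> k T h"
    unfolding is_kernel_operator_def
  proof
    fix f assume f: "f \<in> sobolev \<Omega> k"
    let ?C = "PP.contract1 (kernel h) (jet f)"
    have jf: "jet f \<in> sq_int (P k)" and jTf: "jet (T f) \<in> sq_int (P l)" by (intro jet_sq_int TS f)+
    have C: "?C \<in> sq_int (P l)" by (rule PP.contract1_sq_int(1)[OF kernel_sq_int[OF h] jf])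
    \<comment> \<open>All derivatives of \<open>T f\<close> are identified at once by testing in the
      stacked space; the kernel formula is then read off at index 0.\<close>
    have "AE p in P l. jet (T f) p = ?C p"
    proof (rule sq_int_AE_eqI[OF jTf C])
      fix g assume g: "g \<in> sq_int (P l)"
      have "ip (P l) (jet (T f)) g = ip R K (tensor (jet f) g)"
        by (rule ip_eq_by_density[OF T E K g basis[OF _ g] f])
      then show "ip (P l) (jet (T f)) g = ip (P l) ?C g"
        using ker[OF jf g] PP.ip_contract1[OF kernel_sq_int[OF h] jf g] by simp
    qed
    then have "nrm (P l) (\<lambda>p. jet (T f) p - ?C p) = 0" using jTf C by (simp add: nrm_diff_zero_iff_AE)
    then have "AE y in M. jet (T f) (\<lambda>_. 0, y) - ?C (\<lambda>_. 0, y) = 0"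
      unfolding nrm_P_zero_iff[OF sq_int_diff[OF jTf C]] using zero_index_mem by (rule bspec)
    then show "AE y in M. T f y = kernel_operator \<Omega> k h f y"
      using jet_zero_AE[OF TS[OF f]] kernel_operator_AE[OF h f] by eventually_elim simp
  qed
  with h show ?thesis by blast
qed

end

theorem lemma3p2:
  fixes \<Theta> :: "(real ^ 'n) set" and k\<^sub>\<alpha> k\<^sub>\<beta> :: nat
    and T :: "(real ^ 'n \<Rightarrow> real) \<Rightarrow> real ^ 'n \<Rightarrow> real"
  assumes "open \<Theta>" and "bounded \<Theta>"
    and "sobolev_bounded_linear \<Theta> k\<^sub>\<alpha> k\<^sub>\<beta> T"
  shows "(hilbert_schmidt \<Theta> k\<^sub>\<alpha> k\<^sub>\<beta> T \<longleftrightarrow>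
            (\<exists>h\<in>mixed_sobolev \<Theta> k\<^sub>\<alpha> k\<^sub>\<beta>. is_kernel_operator \<Theta> k\<^sub>\<alpha> T h)) \<and>
         (\<forall>h\<in>mixed_sobolev \<Theta> k\<^sub>\<alpha> k\<^sub>\<beta>. is_kernel_operator \<Theta> k\<^sub>\<alpha> T h \<longrightarrow>
            hs_norm_sq \<Theta> k\<^sub>\<alpha> k\<^sub>\<beta> T =
              (\<Sum>\<alpha>\<in>multi_indices k\<^sub>\<alpha>. \<Sum>\<beta>\<in>multi_indices k\<^sub>\<beta>.
                 L2_norm_sq (\<Theta> \<times> \<Theta>) (weak_deriv (\<Theta> \<times> \<Theta>) (pair_index \<alpha> \<beta>) h)) \<and>
            (\<Sum>\<alpha>\<in>multi_indices k\<^sub>\<alpha>. \<Sum>\<beta>\<in>multi_indices k\<^sub>\<beta>.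
               L2_norm_sq (\<Theta> \<times> \<Theta>) (weak_deriv (\<Theta> \<times> \<Theta>) (pair_index \<alpha> \<beta>) h)) < \<infinity>)"
proof -
  interpret kernel_domain \<Theta> k\<^sub>\<alpha> k\<^sub>\<beta> by unfold_locales fact+
  note T = assms(3)
  obtain E where E: "sobolev_onb \<Theta> k\<^sub>\<alpha> E" using sobolev_onb_exists by blast
  show ?thesis
  proof (intro conjI iffI ballI impI)
    assume "hilbert_schmidt \<Theta> k\<^sub>\<alpha> k\<^sub>\<beta> T"
    then show "\<exists>h\<in>mixed_sobolev \<Theta> k\<^sub>\<alpha> k\<^sub>\<beta>. is_kernel_operator \<Theta> k\<^sub>\<alpha> T h"
      unfolding hilbert_schmidt_def using hilbert_schmidt_kernel[OF T] by blast
  next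
    assume "\<exists>h\<in>mixed_sobolev \<Theta> k\<^sub>\<alpha> k\<^sub>\<beta>. is_kernel_operator \<Theta> k\<^sub>\<alpha> T h"
    then obtain h where "h \<in> mixed_sobolev \<Theta> k\<^sub>\<alpha> k\<^sub>\<beta>" "is_kernel_operator \<Theta> k\<^sub>\<alpha> T h" by blast
    then have "hs_sum \<Theta> k\<^sub>\<beta> T E < \<infinity>" using hs_sum_kernel_operator[OF _ T _ E] by simp
    with T E show "hilbert_schmidt \<Theta> k\<^sub>\<alpha> k\<^sub>\<beta> T" unfolding hilbert_schmidt_def by blast
  next
    fix h assume h: "h \<in> mixed_sobolev \<Theta> k\<^sub>\<alpha> k\<^sub>\<beta>" and op: "is_kernel_operator \<Theta> k\<^sub>\<alpha> T h"
    have "hs_norm_sq \<Theta> k\<^sub>\<alpha> k\<^sub>\<beta> T = ennreal (ip R (kernel h) (kernel h))"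
      unfolding hs_norm_sq_def
    proof (rule the_equality)
      show "\<forall>E. sobolev_onb \<Theta> k\<^sub>\<alpha> E \<longrightarrow> hs_sum \<Theta> k\<^sub>\<beta> T E = ennreal (ip R (kernel h) (kernel h))"
        using hs_sum_kernel_operator[OF h T op] by blast
      \<comment> \<open>The existence of some basis \<open>E\<close> is essential here: over an
        empty collection of bases every \<open>s\<close> would qualify.\<close>
      show "s = ennreal (ip R (kernel h) (kernel h))"
        if "\<forall>E. sobolev_onb \<Theta> k\<^sub>\<alpha> E \<longrightarrow> hs_sum \<Theta> k\<^sub>\<beta> T E = s" for s
        using that E hs_sum_kernel_operator[OF h T op E] by simp
    qed
    then show "hs_norm_sq \<Theta> k\<^sub>\<alpha> k\<^sub>\<beta> T =
        (\<Sum>\<alpha>\<in>multi_indices k\<^sub>\<alpha>. \<Sum>\<beta>\<in>multi_indices k\<^sub>\<beta>.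
           L2_norm_sq (\<Theta> \<times> \<Theta>) (weak_deriv (\<Theta> \<times> \<Theta>) (pair_index \<alpha> \<beta>) h))"
      by (simp only: ip_kernel_self[OF h])
    show "(\<Sum>\<alpha>\<in>multi_indices k\<^sub>\<alpha>. \<Sum>\<beta>\<in>multi_indices k\<^sub>\<beta>.
           L2_norm_sq (\<Theta> \<times> \<Theta>) (weak_deriv (\<Theta> \<times> \<Theta>) (pair_index \<alpha> \<beta>) h)) < \<infinity>"
      by (simp only: ip_kernel_self[OF h, symmetric] infinity_ennreal_def ennreal_less_top)
  qed
qed

end
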